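(* Let $\varphi$ satisfy hypotheses (i)–(iii) of the context and let $X_t$ be the corresponding Markov chain on $\Omega_N$, with transition probabilities given by the determinantal formula of the context. Then for any $t\ge 0$, any $1\le n_1<\dots<n_m\le N$, any $\vec a\in\mathbb R^m$ and any $\vec y\in\Omega_N$, $$\mathbb P\bigl(X_t(n_i)>a_i,\ i=1,\dots,m\,\big|\,X_0=\vec y\bigr)=\det\bigl(I-\bar\chi_aK_t\bar\chi_a\bigr)_{\ell^2(\{n_1,\dots,n_m\}\times\mathbb Z)},$$ where $\det$ on the right is the Fredholm determinant, $\bar\chi_a(n_j,x)=\mathbf 1_{x\le a_j}$ (acting as a multiplication operator), and $$K_t(n_i,\cdot\,;n_j,\cdot\,)=-Q^{n_j-n_i}\mathbf 1_{n_i<n_j}+(\mathcal S_{-t,-n_i})^*\,\bar{\mathcal S}^{\mathrm{epi}(\vec y)}_{-t,n_j},$$ with $Q^n$, $\mathcal S_{-t,-n}$, $\bar{\mathcal S}^{\mathrm{epi}(\vec y)}_{-t,n}$ as defined in the context.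
   Context: Notation: $\gamma_s$ is the positively oriented circle of radius $s$ centred at $0$ in $\mathbb C$; $A_{s,S}=\{s\le|w|\le S\}$; a function is analytic on a closed set if it is analytic on some open set containing it. $\Omega_N=\{(x_1,\dots,x_N)\in\mathbb Z^N: x_1>x_2>\dots>x_N\}$. Kernels $K:\mathbb Z\times\mathbb Z\to\mathbb R$ act as $Kf(x)=\sum_yK(x,y)f(y)$ and compose as $KL(x,y)=\sum_zK(x,z)L(z,y)$ (absolutely convergent sums); $K^*(x,y)=K(y,x)$. Markov chain: time $t$ takes values in $\mathbb T=\mathbb R$ or $\mathbb T=\mathbb Z$. $X_t=(X_t(1),\dots,X_t(N))$ is a Markov chain on $\Omega_N$ with transition probabilities $$\mathbb P(X_t=\vec x\mid X_0=\vec y)=\det\bigl[F_{i-j}(x_{N+1-i}-y_{N+1-j},t)\bigr]_{i,j=1}^N,\qquad F_n(x,t)=\frac1{2\pi \mathrm i}\oint_{\gamma_{\bar\rho}}dw\,\frac{(w-1)^{-n}}{w^{x-n+1}}\varphi(w)^t .$$ The function $\varphi$ is such that this is a probability distribution in $\vec x$ (in particular $\varphi(1)=1$), and satisfies: (i) $\varphi:U\to\mathbb C$, where $U\subseteq\mathbb C$ is a domain containing $0$ and $1$, and $\varphi$ has at most finitely many singularities in $U$; (ii) $\varphi$ is analytic on an annulus $A_{\rho,\bar\rho}\subseteq U$ with $0<\rho<1<\bar\rho$; (iii) $\varphi(w)\ne0$ for all $w\in A_{\rho,\bar\rho}$. In continuous time, $\varphi(w)^t$ denotes the analytic family of powers on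 the annulus used in the definition of $F_n$. Kernels: fix $r,\theta\in(\rho,1)$, set $\alpha=(1-\theta)/\theta$, and $$Q(z_1,z_2)=(1-\theta)\theta^{z_1-z_2-1}\mathbf 1_{z_1>z_2},\qquad Q^n(z_1,z_2)=\frac{\alpha^n}{2\pi \mathrm i}\oint_{\gamma_r}dw\,\frac{\theta^{z_1-z_2}}{w^{z_1-z_2-n+1}}\,(1-w)^{-n},$$ $$\mathcal S_{-t,-n}(z_1,z_2)=\frac{\alpha^{-n+1}}{2\pi \mathrm i}\oint_{\gamma_r}dw\,\frac{\theta^{z_2-z_1}}{w^{z_2-z_1+n+1}}(1-w)^n\varphi(w)^t,$$ $$\bar{\mathcal S}_{-t,n}(z_1,z_2)=\frac{\alpha^{n-1}}{2\pi \mathrm i}\oint_{\gamma_\delta}dw\,\frac{(1-w)^{z_2-z_1+n-1}}{\theta^{z_2-z_1}w^n}\varphi(1-w)^{-t},$$ with $\delta\in(0,1)$ small enough that $\varphi(1-w)^{-t}$ is analytic inside $\gamma_\delta$. Let $(B_m)_{m\ge0}$ be the random walk on $\mathbb Z$ with transition matrix $Q$, and $\tau=\min\{m=0,\dots,N-1: B_m>y_{m+1}\}$ (with $\tau=\infty$ if there is no such $m$). Define $$\bar{\mathcal S}^{\mathrm{epi}(\vec y)}_{-t,n}(z_1,z_2)=\mathbb E_{B_0=z_1}\bigl[\bar{\mathcal S}_{-t,n-\tau}(B_\tau,z_2)\mathbf 1_{\tau<n}\bigr].$$ *)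

theory Defs
  imports
    "HOL-Complex_Analysis.Complex_Analysis"
    "HOL-Probability.Probability"
    "Jordan_Normal_Form.Determinant"
begin

section \<open>The generating function and its powers\<close>

definition annulus :: "real \<Rightarrow> real \<Rightarrow> complex set" where
  "annulus s S = {w. s \<le> norm w \<and> norm w \<le> S}"

definition circ_integral :: "real \<Rightarrow> (complex \<Rightarrow> complex) \<Rightarrow> complex" where
  "circ_integral s f = contour_integral (circlepath 0 s) f / (2 * of_real pi * \<i>)"

definition admissible ::
  "complex set \<Rightarrow> real \<Rightarrow> real \<Rightarrow> (complex \<Rightarrow> complex) \<Rightarrow> bool" where
  "admissible U \<rho> \<rho>' \<phi> \<longleftrightarrow>
     open U \<and> connected U \<and> 0 \<in> U \<and> 1 \<in> U \<and>
     (\<exists>P. finite P \<and> \<phi> holomorphic_on (U - P)) \<and>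
     0 < \<rho> \<and> \<rho> < 1 \<and> 1 < \<rho>' \<and> annulus \<rho> \<rho>' \<subseteq> U \<and>
     \<phi> analytic_on annulus \<rho> \<rho>' \<and>
     (\<forall>w \<in> annulus \<rho> \<rho>'. \<phi> w \<noteq> 0) \<and>
     \<phi> 1 = 1"

text \<open>
  The set \<open>T\<close> of times is \<open>\<int>\<close> or \<open>\<real>\<close>, and \<open>pw t w\<close> stands for \<open>\<phi>(w)\<^sup>t\<close>. In
  discrete time these are the ordinary integer powers. In continuous time they are
  \<open>exp (t * L w)\<close> for an analytic logarithm \<open>L\<close> of \<open>\<phi>\<close> on the annulus \<open>A\<close>. The value
  \<open>\<phi>(1)\<^sup>t = 1\<close>, which total mass one forces for all real \<open>t \<ge> 0\<close>, fixes the branch by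
  \<open>L 1 = 0\<close>. Outside \<open>A\<close> the function \<open>pw\<close> is used only on a disc around \<open>1\<close> on which
  it is assumed to be analytic, hence is the analytic continuation.
\<close>

definition power_family ::
  "real set \<Rightarrow> complex set \<Rightarrow> complex set \<Rightarrow> (complex \<Rightarrow> complex) \<Rightarrow>
   (real \<Rightarrow> complex \<Rightarrow> complex) \<Rightarrow> bool" where
  "power_family T U A \<phi> pw \<longleftrightarrow>
     (T = \<int> \<and> (\<forall>k::int. \<forall>w\<in>U. pw (of_int k) w = \<phi> w powi k)) \<or>
     (T = UNIV \<and>
       (\<exists>L. L analytic_on A \<and> L 1 = 0 \<and> (\<forall>w\<in>A. exp (L w) = \<phi> w) \<and>
            (\<forall>t. \<forall>w\<in>A. pw t w = exp (of_real t * L w))))"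


section \<open>The particle system\<close>

text \<open>Configurations are functions on \<open>{1..N}\<close>, extended by \<open>undefined\<close> elsewhere.\<close>

definition \<Omega> :: "nat \<Rightarrow> (nat \<Rightarrow> int) set" where
  "\<Omega> N = {x \<in> {1..N} \<rightarrow>\<^sub>E UNIV. strict_antimono_on {1..N} x}"

definition F_fun ::
  "(real \<Rightarrow> complex \<Rightarrow> complex) \<Rightarrow> real \<Rightarrow> int \<Rightarrow> int \<Rightarrow> real \<Rightarrow> complex" where
  "F_fun pw \<rho>' n x t =
     circ_integral \<rho>' (\<lambda>w. (w - 1) powi (- n) / w powi (x - n + 1) * pw t w)"

text \<open>
  The matrix indices of \<open>mat N N\<close> start at \<open>0\<close>, so that \<open>N + 1 - i\<close> for \<open>i \<in> {1..N}\<close>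
  appears as \<open>N - i\<close> for \<open>i \<in> {0..<N}\<close>.
\<close>

definition transition_det ::
  "nat \<Rightarrow> (real \<Rightarrow> complex \<Rightarrow> complex) \<Rightarrow> real \<Rightarrow> real \<Rightarrow> (nat \<Rightarrow> int) \<Rightarrow> (nat \<Rightarrow> int) \<Rightarrow> complex" where
  "transition_det N pw \<rho>' t y x =
     Determinant.det (Matrix.mat N N
       (\<lambda>(i, j). F_fun pw \<rho>' (int i - int j) (x (N - i) - y (N - j)) t))"

definition stochastic_transitions ::
  "real set \<Rightarrow> 's set \<Rightarrow> (real \<Rightarrow> 's \<Rightarrow> 's \<Rightarrow> complex) \<Rightarrow> bool" where
  "stochastic_transitions T S p \<longleftrightarrow>
     (\<forall>t\<in>T. 0 \<le> t \<longrightarrow> (\<forall>y\<in>S. \<exists>D. set_pmf D \<subseteq> S \<and> (\<forall>x\<in>S. of_real (pmf D x) = p t y x)))"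

text \<open>
  \<open>X\<close> is a time-homogeneous Markov chain on the countable set \<open>S\<close>, indexed by the
  non-negative times in \<open>T\<close>, with transition probabilities \<open>p u y x = P(X\<^sub>u = x | X\<^sub>0 = y)\<close>.
  In the last clause \<open>s\<close> is the present, \<open>F\<close> is a finite set of past times, \<open>h\<close> is the
  observed history and \<open>u\<close> is the future time.
\<close>

definition markov_chain ::
  "'w measure \<Rightarrow> real set \<Rightarrow> 's set \<Rightarrow> (real \<Rightarrow> 's \<Rightarrow> 's \<Rightarrow> complex) \<Rightarrow> (real \<Rightarrow> 'w \<Rightarrow> 's) \<Rightarrow> bool" where
  "markov_chain M T S p X \<longleftrightarrow>
     prob_space M \<and>
     (\<forall>s \<in> T \<inter> {0..}. X s \<in> M \<rightarrow>\<^sub>M count_space S) \<and>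
     (\<forall>s \<in> T \<inter> {0..}. \<forall>u \<in> T \<inter> {s..}. \<forall>F h. \<forall>x\<in>S.
        finite F \<and> F \<subseteq> T \<inter> {0..s} \<and>
        \<P>(\<omega> in M. X s \<omega> = h s \<and> (\<forall>r\<in>F. X r \<omega> = h r)) > 0 \<longrightarrow>
        of_real \<P>(\<omega> in M. X u \<omega> = x \<bar> X s \<omega> = h s \<and> (\<forall>r\<in>F. X r \<omega> = h r))
          = p (u - s) (h s) x)"


section \<open>The kernels\<close>

type_synonym kernel = "int \<Rightarrow> int \<Rightarrow> complex"

definition kernel_comp :: "kernel \<Rightarrow> kernel \<Rightarrow> kernel" where
  "kernel_comp K L x y = (\<Sum>\<^sub>\<infinity>z. K x z * L z y)"

definition kernel_comp_converges :: "kernel \<Rightarrow> kernel \<Rightarrow> bool" where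
  "kernel_comp_converges K L \<longleftrightarrow> (\<forall>x y. (\<lambda>z. norm (K x z * L z y)) summable_on UNIV)"

definition kernel_adj :: "kernel \<Rightarrow> kernel" where
  "kernel_adj K x y = K y x"

definition alpha :: "real \<Rightarrow> real" where
  "alpha \<theta> = (1 - \<theta>) / \<theta>"

definition Q_ker :: "real \<Rightarrow> int \<Rightarrow> int \<Rightarrow> real" where
  "Q_ker \<theta> z1 z2 = (1 - \<theta>) * \<theta> powi (z1 - z2 - 1) * of_bool (z1 > z2)"

definition Q_pow :: "real \<Rightarrow> real \<Rightarrow> nat \<Rightarrow> kernel" where
  "Q_pow \<theta> r n z1 z2 =
     of_real (alpha \<theta> ^ n) *
     circ_integral r (\<lambda>w. of_real \<theta> powi (z1 - z2) / w powi (z1 - z2 - int n + 1)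
                            * (1 - w) powi (- int n))"

text \<open>\<open>S_ker pw \<theta> r t n\<close> is \<open>S\<close> with indices \<open>-t, -n\<close>, and \<open>Sbar_ker pw \<theta> \<delta> t n\<close> is
  \<open>S-bar\<close> with indices \<open>-t, n\<close>.\<close>

definition S_ker ::
  "(real \<Rightarrow> complex \<Rightarrow> complex) \<Rightarrow> real \<Rightarrow> real \<Rightarrow> real \<Rightarrow> nat \<Rightarrow> kernel" where
  "S_ker pw \<theta> r t n z1 z2 =
     of_real (alpha \<theta> powi (1 - int n)) *
     circ_integral r (\<lambda>w. of_real \<theta> powi (z2 - z1) / w powi (z2 - z1 + int n + 1)
                            * (1 - w) ^ n * pw t w)"

definition Sbar_ker ::
  "(real \<Rightarrow> complex \<Rightarrow> complex) \<Rightarrow> real \<Rightarrow> real \<Rightarrow> real \<Rightarrow> nat \<Rightarrow> kernel" where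
  "Sbar_ker pw \<theta> \<delta> t n z1 z2 =
     of_real (alpha \<theta> powi (int n - 1)) *
     circ_integral \<delta> (\<lambda>w. (1 - w) powi (z2 - z1 + int n - 1)
                            / (of_real \<theta> powi (z2 - z1) * w ^ n) * pw (- t) (1 - w))"

subsection \<open>The random walk and its hitting time\<close>

definition walk_step :: "real \<Rightarrow> int \<Rightarrow> int pmf" where
  "walk_step \<theta> z = embed_pmf (Q_ker \<theta> z)"

lemma pmf_walk_step:
  assumes "0 < \<theta>" "\<theta> < 1"
  shows "pmf (walk_step \<theta> z) z' = Q_ker \<theta> z z'"
proof -
  let ?g = "map_pmf (\<lambda>k. z - 1 - int k) (geometric_pmf (1 - \<theta>))"
  have inj: "inj (\<lambda>k. z - 1 - int k)"
    by (auto simp: inj_on_def)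
  have eq: "Q_ker \<theta> z = pmf ?g"
  proof
    fix z'
    show "Q_ker \<theta> z z' = pmf ?g z'"
    proof (cases "z > z'")
      case True
      define k where "k = nat (z - z' - 1)"
      have k: "z' = z - 1 - int k" "z - z' - 1 = int k"
        using True by (auto simp: k_def)
      have "pmf ?g z' = pmf (geometric_pmf (1 - \<theta>)) k"
        unfolding k(1) by (rule pmf_map_inj'[OF inj])
      also have "\<dots> = \<theta> ^ k * (1 - \<theta>)"
        using assms by (subst pmf_geometric) auto
      finally show ?thesis
        using True unfolding Q_ker_def k(2) by simp
    next
      case False
      then have "z' \<notin> (\<lambda>k. z - 1 - int k) ` UNIV" by auto
      then have "z' \<notin> set_pmf ?g" by auto
      then have "pmf ?g z' = 0" by (simp only: set_pmf_iff not_not)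
      then show ?thesis
        using False by (simp add: Q_ker_def)
    qed
  qed
  have "(\<integral>\<^sup>+x. ennreal (pmf ?g x) \<partial>count_space UNIV) = 1"
    by (rule nn_integral_pmf_eq_1)
  then show ?thesis
    unfolding walk_step_def eq by (subst pmf_embed_pmf) auto
qed

text \<open>The law of the list \<open>[B\<^sub>0, \<dots>, B\<^sub>k\<^sub>-\<^sub>1]\<close> for the walk \<open>B\<close> started at \<open>z\<close>.\<close>

primrec walk_pmf :: "real \<Rightarrow> nat \<Rightarrow> int \<Rightarrow> int list pmf" where
  "walk_pmf \<theta> 0 z = return_pmf []"
| "walk_pmf \<theta> (Suc k) z =
     map_pmf (Cons z) (bind_pmf (walk_step \<theta> z) (walk_pmf \<theta> k))"

text \<open>The infimum of the empty set of extended naturals is \<open>\<infinity>\<close>.\<close>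

definition hit_time :: "nat \<Rightarrow> (nat \<Rightarrow> int) \<Rightarrow> int list \<Rightarrow> enat" where
  "hit_time N y B = Inf (enat ` {m. m < N \<and> B ! m > y (m + 1)})"

text \<open>The hitting time depends only on \<open>B\<^sub>0, \<dots>, B\<^sub>N\<^sub>-\<^sub>1\<close>, so it suffices to run the walk
  up to time \<open>N - 1\<close>.\<close>

definition Sbar_epi ::
  "nat \<Rightarrow> (nat \<Rightarrow> int) \<Rightarrow> (real \<Rightarrow> complex \<Rightarrow> complex) \<Rightarrow> real \<Rightarrow> real \<Rightarrow> real \<Rightarrow> nat \<Rightarrow> kernel" where
  "Sbar_epi N y pw \<theta> \<delta> t n z1 z2 =
     (\<integral>B. (let \<tau> = hit_time N y B in
             if \<tau> < enat n
             then Sbar_ker pw \<theta> \<delta> t (n - the_enat \<tau>) (B ! the_enat \<tau>) z2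
             else 0)
      \<partial>measure_pmf (walk_pmf \<theta> N z1))"

subsection \<open>The extended kernel\<close>

definition K_ext ::
  "nat \<Rightarrow> (nat \<Rightarrow> int) \<Rightarrow> (real \<Rightarrow> complex \<Rightarrow> complex) \<Rightarrow> real \<Rightarrow> real \<Rightarrow> real \<Rightarrow> real \<Rightarrow>
   nat \<times> int \<Rightarrow> nat \<times> int \<Rightarrow> complex" where
  "K_ext N y pw \<theta> r \<delta> t = (\<lambda>(ni, x1) (nj, x2).
     - Q_pow \<theta> r (nj - ni) x1 x2 * of_bool (ni < nj)
     + kernel_comp (kernel_adj (S_ker pw \<theta> r t ni)) (Sbar_epi N y pw \<theta> \<delta> t nj) x1 x2)"

definition chi_bar ::
  "nat \<Rightarrow> (nat \<Rightarrow> nat) \<Rightarrow> (nat \<Rightarrow> real) \<Rightarrow> nat \<times> int \<Rightarrow> complex" where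
  "chi_bar m n a = (\<lambda>(k, x). of_bool (\<exists>j\<in>{1..m}. k = n j \<and> real_of_int x \<le> a j))"

definition sandwich :: "('s \<Rightarrow> complex) \<Rightarrow> ('s \<Rightarrow> 's \<Rightarrow> complex) \<Rightarrow> 's \<Rightarrow> 's \<Rightarrow> complex" where
  "sandwich f K p q = f p * K p q * f q"


section \<open>Fredholm determinants on discrete spaces\<close>

text \<open>
  For a kernel \<open>K\<close> on a countable set \<open>S\<close> with counting measure, \<open>det (I - K)\<close> is the
  Fredholm series
  \<open>\<Sum>\<^sub>k (-1)\<^sup>k / k! \<cdot> \<Sum>\<^sub>p det [K(p\<^sub>a, p\<^sub>b)]\<close>, where \<open>p\<close> ranges over \<open>S\<^sup>k\<close>
  and \<open>a, b\<close> over the indices below \<open>k\<close>. No trace class assumption enters. The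
  powers of \<open>Q\<close> in \<open>K_ext\<close> make the associated operator trace
  class only after a conjugation, which does not change the determinants.
\<close>

definition fredholm_minor :: "('s \<Rightarrow> 's \<Rightarrow> complex) \<Rightarrow> nat \<Rightarrow> (nat \<Rightarrow> 's) \<Rightarrow> complex" where
  "fredholm_minor K k p = Determinant.det (Matrix.mat k k (\<lambda>(a, b). K (p a) (p b)))"

definition fredholm_coeff :: "'s set \<Rightarrow> ('s \<Rightarrow> 's \<Rightarrow> complex) \<Rightarrow> nat \<Rightarrow> complex" where
  "fredholm_coeff S K k =
     (-1) ^ k / fact k * (\<Sum>\<^sub>\<infinity>p \<in> {..<k} \<rightarrow>\<^sub>E S. fredholm_minor K k p)"

definition fredholm_det :: "'s set \<Rightarrow> ('s \<Rightarrow> 's \<Rightarrow> complex) \<Rightarrow> complex" where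
  "fredholm_det S K = (\<Sum>k. fredholm_coeff S K k)"

definition fredholm_converges :: "'s set \<Rightarrow> ('s \<Rightarrow> 's \<Rightarrow> complex) \<Rightarrow> bool" where
  "fredholm_converges S K \<longleftrightarrow>
     (\<forall>k. (\<lambda>p. norm (fredholm_minor K k p)) summable_on ({..<k} \<rightarrow>\<^sub>E S)) \<and>
     summable (fredholm_coeff S K)"

end

theory Submission
  imports Defs
begin

text \<open>
  Since \<open>F_n(x) - F_n(x + 1) = F_(n-1)(x)\<close>, summing the transition determinant over
  \<open>x_i > a_i\<close> row by row telescopes: with \<open>M = n_m\<close> and \<open>b_i = max(a_i, ..., a_M)\<close> the
  probability is the \<open>M \<times> M\<close> determinant \<open>det[F_(j-i+1)(b_i + 1 - y_j)]\<close>.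

  On the kernel side everything is expanded in powers of \<open>1 - w\<close>. The strong Markov property
  then becomes a linear system with a unitriangular matrix \<open>L\<close>, and up to conjugation the kernel
  is \<open>-Q^(n_j - n_i)\<close> (for \<open>n_i < n_j\<close>) plus the finite rank term
  \<open>\<Sum>_(k,l) \<Psi>_l (L^-1)_(kl) E_k\<close>. On a finite window the part \<open>P = 1 + Q\<close> is unipotent,
  so \<open>det(P - A B) = det P * det(1 - B P^-1 A)\<close> reduces the Fredholm determinant to an
  \<open>M \<times> M\<close> determinant, where \<open>P^-1 A\<close> is an iterated summation that is killed at the
  thresholds. Letting the window grow and summing by parts \<open>M\<close> times factors the limiting matrix
  into \<open>(F_(j-i+1)(b_i + 1 - y_j))\<close>, up to signs, and a triangular matrix with diagonal entries
  \<open>\<plusminus>1\<close>.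
\<close>

section \<open>Determinants over finite index sets\<close>

text \<open>The two factors of the kernel live on different contours: \<open>S\<close> on a circle
  around 0, \<open>Sbar\<close> on a small circle around 1. They meet in the Taylor expansion at 1,
  because pairing the Laurent coefficients of \<phi>^t with a polynomial in x evaluates a Taylor
  coefficient at 1. The pairings of the polynomials \<open>Ek\<close> with the functions
  \<open>Psi\<close> thus form an explicit triangular matrix \<open>Lmat\<close>, whose diagonal is
  \<phi>(1)^t = 1. No biorthogonal family is computed: the inverse of \<open>Lmat\<close> only has
  to exist, and it drops out of the determinant.

  The other obstacle is the infinite space, on which Q^(n_j - n_i) does not decay along the
  diagonal. Linear algebra is therefore done on finite windows, with bounds that are uniform in the
  window after conjugation by weights depending on the level.

  Levels below n_m that are not selected receive the threshold of level n_m, so that both sides can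
  be written with all levels 1, ..., n_m.\<close>

text \<open>
  Indexing by an arbitrary set lets the principal minors of a kernel and its restrictions to finite
  windows be treated without choosing an enumeration.
\<close>

definition dset :: "('s \<Rightarrow> 's \<Rightarrow> complex) \<Rightarrow> 's set \<Rightarrow> complex" where
  "dset f I = (\<Sum>\<sigma> | \<sigma> permutes I. of_int (sign \<sigma>) * (\<Prod>i\<in>I. f i (\<sigma> i)))"

lemma dset_cong:
  assumes "\<And>i j. i \<in> I \<Longrightarrow> j \<in> I \<Longrightarrow> f i j = g i j"
  shows "dset f I = dset g I"
  unfolding dset_def
  by (intro sum.cong refl arg_cong2[where f = "(*)"] prod.cong)
     (auto intro!: assms simp: permutes_in_image)

lemma dset_reindex:
  assumes "inj_on e J" "finite J"
  shows "dset f (e ` J) = dset (\<lambda>a b. f (e a) (e b)) J"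
proof -
  let ?h = "map_permutation J e"
  have bij: "bij_betw e J (e ` J)" using assms by (simp add: bij_betw_def)
  have h: "?h \<pi> = (\<lambda>x. if x \<in> e ` J then e (\<pi> (inv_into J e x)) else x)" for \<pi>
    by (auto simp: map_permutation_def restrict_id_def fun_eq_iff)
  have "bij_betw ?h {\<pi>. \<pi> permutes J} {\<pi>. \<pi> permutes e ` J}"
    unfolding h using bij_betw_permutations[OF bij] .
  then have "dset f (e ` J)
      = (\<Sum>\<pi> | \<pi> permutes J. of_int (sign (?h \<pi>)) * (\<Prod>i\<in>e ` J. f i (?h \<pi> i)))"
    unfolding dset_def by (subst sum.reindex_bij_betw[symmetric]) auto
  also have "\<dots> = dset (\<lambda>a b. f (e a) (e b)) J"
    unfolding dset_def
  proof (intro sum.cong refl)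
    fix \<pi> assume p: "\<pi> \<in> {\<pi>. \<pi> permutes J}"
    then have "sign (?h \<pi>) = sign \<pi>" using assms by (simp add: sign_map_permutation)
    moreover have "(\<Prod>i\<in>e ` J. f i (?h \<pi> i)) = (\<Prod>a\<in>J. f (e a) (e (\<pi> a)))"
      using assms(1) by (subst prod.reindex) (auto simp: h intro!: prod.cong)
    ultimately show "of_int (sign (?h \<pi>)) * (\<Prod>i\<in>e ` J. f i (?h \<pi> i))
        = of_int (sign \<pi>) * (\<Prod>a\<in>J. f (e a) (e (\<pi> a)))" by simp
  qed
  finally show ?thesis .
qed

lemma det_mat_eq_dset:
  "Determinant.det (Matrix.mat k k (\<lambda>(a, b). f a b)) = dset f {..<k}"
  unfolding dset_def
  by (subst det_def'[of _ k])
     (auto simp: lessThan_atLeast0 permutes_in_image intro!: sum.cong prod.cong)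

lemma fredholm_minor_eq_dset:
  "fredholm_minor K k p = dset (\<lambda>a b. K (p a) (p b)) {..<k}"
  unfolding fredholm_minor_def by (rule det_mat_eq_dset)

lemma fredholm_minor_inj:
  "inj_on p {..<k} \<Longrightarrow> fredholm_minor K k p = dset K (p ` {..<k})"
  by (simp add: fredholm_minor_eq_dset dset_reindex)

lemma enumerate_finite:
  assumes "finite I"
  obtains e where "inj_on e {..<card I}" "e ` {..<card I} = (I :: 's set)"
  using ex_bij_betw_nat_finite[OF assms] by (auto simp: bij_betw_def lessThan_atLeast0)

lemma dset_row_linear:
  assumes "finite I" "i \<in> I"
  shows "dset (f(i := (\<lambda>j. c * u j + v j))) I = c * dset (f(i := u)) I + dset (f(i := v)) I"
proof -
  have *: "(\<Prod>k\<in>I. (f(i := w)) k (\<sigma> k)) = w (\<sigma> i) * (\<Prod>k\<in>I - {i}. f k (\<sigma> k))" for w \<sigma>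
    using assms by (subst prod.remove[of _ i]) auto
  show ?thesis
    unfolding dset_def * sum_distrib_left sum.distrib[symmetric]
    by (intro sum.cong refl) (simp add: algebra_simps)
qed

lemma dset_identical_rows:
  assumes "finite I" "i \<in> I" "i' \<in> I" "i \<noteq> i'" "\<And>j. j \<in> I \<Longrightarrow> f i j = f i' j"
  shows "dset f I = 0"
proof -
  obtain e where e: "inj_on e {..<card I}" "e ` {..<card I} = I"
    using enumerate_finite[OF assms(1)] .
  obtain a b where ab: "a < card I" "b < card I" "e a = i" "e b = i'"
    using e(2) assms(2,3) by (metis imageE lessThan_iff)
  have "dset f I = Determinant.det (Matrix.mat (card I) (card I) (\<lambda>(a, b). f (e a) (e b)))"
    unfolding det_mat_eq_dset using e dset_reindex[of e "{..<card I}" f] by simp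
  also have "\<dots> = 0"
  proof (rule det_identical_rows[of _ "card I" a b])
    have "f (e a) (e c) = f (e b) (e c)" if "c < card I" for c
      using assms(5)[of "e c"] that e(2) ab by auto
    then show "Matrix.row (Matrix.mat (card I) (card I) (\<lambda>(a, b). f (e a) (e b))) a
        = Matrix.row (Matrix.mat (card I) (card I) (\<lambda>(a, b). f (e a) (e b))) b"
      using ab by (intro eq_vecI) auto
  qed (use ab assms in auto)
  finally show ?thesis .
qed

lemma dset_row_sum:
  assumes "finite I" "i \<in> I" "finite X"
  shows "dset (f(i := (\<lambda>j. \<Sum>x\<in>X. u x j))) I = (\<Sum>x\<in>X. dset (f(i := u x)) I)"
  using assms(3)
proof (induction X)
  case empty
  show ?case using dset_row_linear[OF assms(1,2), of f 0 "\<lambda>_. 0" "\<lambda>_. 0"]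
      dset_row_linear[OF assms(1,2), of f 1 "\<lambda>_. 0" "\<lambda>_. 0"] by (simp del: fun_upd_apply)
next
  case (insert x X)
  then show ?case
    using dset_row_linear[OF assms(1,2), of f 1 "u x" "\<lambda>j. \<Sum>x\<in>X. u x j"]
    by (simp del: fun_upd_apply)
qed

lemma dset_row_add_other:
  assumes "finite I" "i \<in> I" "i' \<in> I" "i \<noteq> i'"
  shows "dset (f(i := (\<lambda>j. c * f i' j + v j))) I = dset (f(i := v)) I"
proof -
  have "dset (f(i := f i')) I = 0"
    using assms by (intro dset_identical_rows[of _ i i']) auto
  then show ?thesis using dset_row_linear[OF assms(1,2), of f c "f i'" v] by simp
qed

lemma tendsto_dset:
  assumes "\<And>i j. i \<in> I \<Longrightarrow> j \<in> I \<Longrightarrow> ((\<lambda>R. F R i j) \<longlongrightarrow> f i j) G"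
  shows "((\<lambda>R. dset (F R) I) \<longlongrightarrow> dset f I) G"
  unfolding dset_def by (intro tendsto_intros assms) (auto simp: permutes_in_image)

lemma dset_mult:
  assumes "finite I"
  shows "dset (\<lambda>i j. \<Sum>k\<in>I. f i k * g k j) I = dset f I * dset g I"
proof -
  obtain e where e: "inj_on e {..<card I}" "e ` {..<card I} = I"
    using enumerate_finite[OF assms(1)] .
  define n where "n = card I"
  let ?M = "\<lambda>f. Matrix.mat n n (\<lambda>(a, b). f (e a) (e b))"
  have M: "dset f I = Determinant.det (?M f)" for f
    unfolding det_mat_eq_dset using e dset_reindex[of e "{..<card I}" f] by (simp add: n_def)
  have "?M (\<lambda>i j. \<Sum>k\<in>I. f i k * g k j) = ?M f * ?M g"
  proof (rule eq_matI)
    fix i j assume "i < dim_row (?M f * ?M g)" "j < dim_col (?M f * ?M g)"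
    then have ij: "i < n" "j < n" by auto
    have "(\<Sum>k\<in>I. f (e i) k * g k (e j)) = (\<Sum>a<n. f (e i) (e a) * g (e a) (e j))"
      using e unfolding n_def by (metis (no_types, lifting) sum.reindex_cong)
    then show "?M (\<lambda>i j. \<Sum>k\<in>I. f i k * g k j) $$ (i, j) = (?M f * ?M g) $$ (i, j)"
      using ij by (simp add: scalar_prod_def lessThan_atLeast0)
  qed auto
  then show ?thesis
    unfolding M using Determinant.det_mult[of "?M f" n "?M g"] by simp
qed

lemma dset_scale_rows: "dset (\<lambda>i j. c i * f i j) I = (\<Prod>i\<in>I. c i) * dset f I"
  unfolding dset_def sum_distrib_left by (intro sum.cong refl) (simp add: prod.distrib)

lemma dset_scale_cols: "dset (\<lambda>i j. f i j * c j) I = dset f I * (\<Prod>i\<in>I. c i)"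
proof -
  have "(\<Prod>i\<in>I. c (\<sigma> i)) = (\<Prod>i\<in>I. c i)" if "\<sigma> permutes I" for \<sigma>
    using that by (metis (mono_tags, lifting) comp_apply prod.cong prod.permute)
  then show ?thesis
    unfolding dset_def sum_distrib_right by (intro sum.cong refl) (simp add: prod.distrib)
qed

lemma dset_conjugate:
  assumes "finite I" "\<And>i. i \<in> I \<Longrightarrow> w i \<noteq> 0"
  shows "dset (\<lambda>i j. w i * f i j / w j) I = dset f I"
proof -
  have "dset (\<lambda>i j. w i * f i j / w j) I = dset (\<lambda>i j. w i * (f i j * inverse (w j))) I"
    by (simp add: divide_inverse mult.assoc)
  also have "\<dots> = (\<Prod>i\<in>I. w i) * (dset f I * (\<Prod>i\<in>I. inverse (w i)))"
    unfolding dset_scale_rows dset_scale_cols ..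
  also have "\<dots> = dset f I * (\<Prod>i\<in>I. w i * inverse (w i))"
    by (simp add: prod.distrib)
  also have "(\<Prod>i\<in>I. w i * inverse (w i)) = 1"
    using assms(2) by (intro prod.neutral) auto
  finally show ?thesis by simp
qed

lemma dset_transpose: "finite I \<Longrightarrow> dset (\<lambda>i j. f j i) I = dset f I"
proof -
  assume I: "finite I"
  have bij_inv: "bij_betw (inv_into UNIV) {\<sigma>. \<sigma> permutes I} {\<sigma>. \<sigma> permutes I}"
    by (rule bij_betwI[where g = "inv_into UNIV"]) (auto simp: permutes_inv permutes_inv_inv)
  have "dset (\<lambda>i j. f j i) I
      = (\<Sum>\<sigma> | \<sigma> permutes I. of_int (sign (inv_into UNIV \<sigma>)) * (\<Prod>i\<in>I. f (inv_into UNIV \<sigma> i) i))"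
    unfolding dset_def
    by (rule sum.reindex_bij_betw[OF bij_inv, symmetric])
  also have "\<dots> = dset f I"
    unfolding dset_def
  proof (intro sum.cong refl)
    fix \<sigma> assume "\<sigma> \<in> {\<sigma>. \<sigma> permutes I}"
    then have s: "\<sigma> permutes I" by simp
    have "sign (inv_into UNIV \<sigma>) = sign \<sigma>"
      using s I by (intro sign_inverse) (auto simp: permutation_permutes)
    moreover have "(\<Prod>i\<in>I. f (inv_into UNIV \<sigma> i) i) = (\<Prod>i\<in>I. f i (\<sigma> i))"
      using prod.permute[OF s, of "\<lambda>i. f (inv_into UNIV \<sigma> i) i"] permutes_inverses(2)[OF s]
      by (simp add: o_def)
    ultimately show "of_int (sign (inv_into UNIV \<sigma>)) * (\<Prod>i\<in>I. f (inv_into UNIV \<sigma> i) i)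
        = of_int (sign \<sigma>) * (\<Prod>i\<in>I. f i (\<sigma> i))" by simp
  qed
  finally show ?thesis .
qed

text \<open>
  A permutation that contributes satisfies \<open>\<mu> i \<le> \<mu> (\<sigma> i)\<close> for all \<open>i\<close>; as \<open>\<Sum>\<mu>\<close> is
  invariant, it is the identity.
\<close>

lemma dset_graded:
  fixes \<mu> :: "'s \<Rightarrow> nat"
  assumes "finite I"
    and "\<And>i j. i \<in> I \<Longrightarrow> j \<in> I \<Longrightarrow> i \<noteq> j \<Longrightarrow> f i j \<noteq> 0 \<Longrightarrow> \<mu> i < \<mu> j"
  shows "dset f I = (\<Prod>i\<in>I. f i i)"
proof -
  have z: "(\<Prod>i\<in>I. f i (\<sigma> i)) = 0" if s: "\<sigma> permutes I" "\<sigma> \<noteq> id" for \<sigma>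
  proof (rule ccontr)
    assume "(\<Prod>i\<in>I. f i (\<sigma> i)) \<noteq> 0"
    then have nz: "f i (\<sigma> i) \<noteq> 0" if "i \<in> I" for i using that assms(1) by auto
    have le: "\<mu> i \<le> \<mu> (\<sigma> i)" if "i \<in> I" for i
      using assms(2)[of i "\<sigma> i"] nz[OF that] that s(1) permutes_in_image[OF s(1)]
      by (cases "\<sigma> i = i") (auto simp: less_imp_le)
    obtain i where i: "\<sigma> i \<noteq> i" using s(2) by (auto simp: fun_eq_iff)
    then have "i \<in> I" using s(1) by (auto simp: permutes_def)
    then have "\<mu> i < \<mu> (\<sigma> i)"
      using assms(2)[of i "\<sigma> i"] nz i permutes_in_image[OF s(1)] by auto
    then have "(\<Sum>i\<in>I. \<mu> i) < (\<Sum>i\<in>I. \<mu> (\<sigma> i))"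
      using assms(1) le \<open>i \<in> I\<close> by (intro sum_strict_mono_ex1) auto
    moreover have "(\<Sum>i\<in>I. \<mu> (\<sigma> i)) = (\<Sum>i\<in>I. \<mu> i)"
      using sum.permute[OF s(1), of \<mu>] by (simp add: o_def)
    ultimately show False by simp
  qed
  have "dset f I = (\<Sum>\<sigma>\<in>{id}. of_int (sign \<sigma>) * (\<Prod>i\<in>I. f i (\<sigma> i)))"
    unfolding dset_def using z assms(1)
    by (intro sum.mono_neutral_right) (auto simp: finite_permutations permutes_id)
  then show ?thesis by simp
qed

text \<open>A permutation that moves a picks an entry of row a inside I, which is 0; the others are
  the permutations of I. This shrinks the transition determinant by one particle.\<close>

lemma dset_insert_unit_row:
  assumes "finite I" "a \<notin> I" "\<And>j. j \<in> I \<Longrightarrow> f a j = 0" "f a a = 1"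
  shows "dset f (insert a I) = dset f I"
proof -
  have "dset f (insert a I) = (\<Sum>\<sigma> | \<sigma> permutes I. of_int (sign \<sigma>) * (\<Prod>i\<in>insert a I. f i (\<sigma> i)))"
    unfolding dset_def
  proof (intro sum.mono_neutral_right ballI)
    show "finite {\<sigma>. \<sigma> permutes insert a I}" using assms(1) by (intro finite_permutations) auto
    show "{\<sigma>. \<sigma> permutes I} \<subseteq> {\<sigma>. \<sigma> permutes insert a I}"
      using permutes_subset[of _ I "insert a I"] by auto
    fix \<sigma> assume s: "\<sigma> \<in> {\<sigma>. \<sigma> permutes insert a I} - {\<sigma>. \<sigma> permutes I}"
    have "\<sigma> a \<noteq> a"
    proof
      assume "\<sigma> a = a"
      then have "\<sigma> x = x" if "x \<in> insert a I - I" for x using that by blast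
      moreover have "\<sigma> permutes insert a I" using s by blast
      ultimately have "\<sigma> permutes I" by (rule permutes_superset[rotated])
      then show False using s by blast
    qed
    moreover have "\<sigma> a \<in> insert a I"
      using permutes_in_image[of \<sigma> "insert a I" a] s by blast
    ultimately have "f a (\<sigma> a) = 0" using assms(3) by auto
    then show "of_int (sign \<sigma>) * (\<Prod>i\<in>insert a I. f i (\<sigma> i)) = 0"
      using assms(1,2) by simp
  qed
  also have "\<dots> = dset f I"
    unfolding dset_def using assms(1,2,4)
    by (intro sum.cong refl) (auto simp: permutes_not_in)
  finally show ?thesis .
qed

text \<open>Multiplying out the rows, let J collect those that contribute - f. A permutation
  survives only if it fixes I - J pointwise, that is, permutes J, so each J yields a principal
  minor: the finite form of the Fredholm series.\<close>

lemma dset_one_minus_expand: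
  assumes "finite I"
  shows "dset (\<lambda>i j. of_bool (i = j) - f i j) I = (\<Sum>J\<in>Pow I. (- 1) ^ card J * dset f J)"
proof -
  have fin: "finite {\<sigma>. \<sigma> permutes J}" if "J \<subseteq> I" for J
    using that assms by (intro finite_permutations) (auto dest: finite_subset)
  have "dset (\<lambda>i j. of_bool (i = j) - f i j) I
      = (\<Sum>\<sigma> | \<sigma> permutes I. \<Sum>J\<in>Pow I. of_int (sign \<sigma>) *
           ((\<Prod>i\<in>J. - f i (\<sigma> i)) * (\<Prod>i\<in>I - J. of_bool (i = \<sigma> i))))"
    unfolding dset_def diff_conv_add_uminus add.commute[of "of_bool _"]
    by (subst prod_add[OF assms]) (simp add: sum_distrib_left)
  also have "\<dots> = (\<Sum>J\<in>Pow I. \<Sum>\<sigma> | \<sigma> permutes I. of_int (sign \<sigma>) *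
           ((\<Prod>i\<in>J. - f i (\<sigma> i)) * (\<Prod>i\<in>I - J. of_bool (i = \<sigma> i))))"
    by (rule sum.swap)
  also have "\<dots> = (\<Sum>J\<in>Pow I. (- 1) ^ card J * dset f J)"
  proof (intro sum.cong refl)
    fix J assume J: "J \<in> Pow I"
    have "(\<Sum>\<sigma> | \<sigma> permutes I. of_int (sign \<sigma>) *
           ((\<Prod>i\<in>J. - f i (\<sigma> i)) * (\<Prod>i\<in>I - J. of_bool (i = \<sigma> i))))
        = (\<Sum>\<sigma> | \<sigma> permutes J. of_int (sign \<sigma>) *
           ((\<Prod>i\<in>J. - f i (\<sigma> i)) * (\<Prod>i\<in>I - J. of_bool (i = \<sigma> i))))"
    proof (intro sum.mono_neutral_right ballI)
      show "finite {\<sigma>. \<sigma> permutes I}" using fin by simp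
      show "{\<sigma>. \<sigma> permutes J} \<subseteq> {\<sigma>. \<sigma> permutes I}" using J permutes_subset[of _ J I] by auto
      fix \<sigma> assume s: "\<sigma> \<in> {\<sigma>. \<sigma> permutes I} - {\<sigma>. \<sigma> permutes J}"
      have "\<exists>i\<in>I - J. \<sigma> i \<noteq> i"
      proof (rule ccontr)
        assume "\<not> ?thesis"
        then have "\<sigma> x = x" if "x \<in> I - J" for x using that by blast
        moreover have "\<sigma> permutes I" using s by blast
        ultimately have "\<sigma> permutes J" by (rule permutes_superset[rotated])
        then show False using s by blast
      qed
      then have "\<exists>i\<in>I - J. (of_bool (i = \<sigma> i) :: complex) = 0" by force
      then have "(\<Prod>i\<in>I - J. of_bool (i = \<sigma> i) :: complex) = 0"
        using assms by (intro prod_zero) auto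
      then show "of_int (sign \<sigma>) *
           ((\<Prod>i\<in>J. - f i (\<sigma> i)) * (\<Prod>i\<in>I - J. of_bool (i = \<sigma> i))) = 0" by simp
    qed
    also have "\<dots> = (\<Sum>\<sigma> | \<sigma> permutes J. of_int (sign \<sigma>) * ((- 1) ^ card J * (\<Prod>i\<in>J. f i (\<sigma> i))))"
    proof (intro sum.cong refl)
      fix \<sigma> assume s: "\<sigma> \<in> {\<sigma>. \<sigma> permutes J}"
      then have "(\<Prod>i\<in>I - J. of_bool (i = \<sigma> i) :: complex) = 1"
        by (intro prod.neutral) (auto simp: permutes_not_in)
      then show "of_int (sign \<sigma>) *
           ((\<Prod>i\<in>J. - f i (\<sigma> i)) * (\<Prod>i\<in>I - J. of_bool (i = \<sigma> i)))
           = of_int (sign \<sigma>) * ((- 1) ^ card J * (\<Prod>i\<in>J. f i (\<sigma> i)))"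
        by (simp add: prod_uminus)
    qed
    also have "\<dots> = (- 1) ^ card J * dset f J"
      unfolding dset_def sum_distrib_left by (intro sum.cong refl) (simp add: mult_ac)
    finally show "(\<Sum>\<sigma> | \<sigma> permutes I. of_int (sign \<sigma>) *
           ((\<Prod>i\<in>J. - f i (\<sigma> i)) * (\<Prod>i\<in>I - J. of_bool (i = \<sigma> i)))) = (- 1) ^ card J * dset f J" .
  qed
  finally show ?thesis .
qed

text \<open>The product of the row sums is the sum over all maps from I to I, among which the
  permutations form a subset.\<close>

lemma norm_dset_le:
  assumes "finite I"
  shows "norm (dset f I) \<le> (\<Prod>i\<in>I. \<Sum>j\<in>I. norm (f i j))"
proof -
  have fin: "finite {\<sigma>. \<sigma> permutes I}" using assms by (rule finite_permutations)
  have inj: "inj_on (\<lambda>\<sigma>. restrict \<sigma> I) {\<sigma>. \<sigma> permutes I}"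
  proof (rule inj_onI)
    fix \<sigma> \<tau> assume "\<sigma> \<in> {\<sigma>. \<sigma> permutes I}" "\<tau> \<in> {\<sigma>. \<sigma> permutes I}" "restrict \<sigma> I = restrict \<tau> I"
    then show "\<sigma> = \<tau>" by (metis (no_types, lifting) mem_Collect_eq permutes_not_in restrict_apply' ext)
  qed
  have "norm (dset f I) \<le> (\<Sum>\<sigma> | \<sigma> permutes I. \<Prod>i\<in>I. norm (f i (restrict \<sigma> I i)))"
    unfolding dset_def
    by (intro order.trans[OF norm_sum] sum_mono)
       (auto simp: norm_mult prod_norm sign_def intro!: prod_mono)
  also have "\<dots> = (\<Sum>\<tau>\<in>(\<lambda>\<sigma>. restrict \<sigma> I) ` {\<sigma>. \<sigma> permutes I}. \<Prod>i\<in>I. norm (f i (\<tau> i)))"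
    by (simp only: sum.reindex[OF inj] o_def)
  also have "\<dots> \<le> (\<Sum>\<tau>\<in>I \<rightarrow>\<^sub>E I. \<Prod>i\<in>I. norm (f i (\<tau> i)))"
    using assms by (intro sum_mono2 finite_PiE) (auto simp: permutes_in_image intro!: prod_nonneg)
  also have "\<dots> = (\<Prod>i\<in>I. \<Sum>j\<in>I. norm (f i j))"
    using assms by (simp add: prod_sum_PiE)
  finally show ?thesis .
qed

lemma dset_inverse:
  assumes "finite I" "dset L I \<noteq> 0"
  obtains Li where "\<And>i j. i \<in> I \<Longrightarrow> j \<in> I \<Longrightarrow> (\<Sum>k\<in>I. Li i k * L k j) = of_bool (i = j)"
proof -
  obtain e where e: "inj_on e {..<card I}" "e ` {..<card I} = I"
    using enumerate_finite[OF assms(1)] .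
  define n where "n = card I"
  define M where "M = Matrix.mat n n (\<lambda>(a, b). L (e a) (e b))"
  have "Determinant.det M \<noteq> 0"
    unfolding det_mat_eq_dset M_def using e dset_reindex[of e "{..<card I}" L] assms(2)
    by (simp add: n_def)
  moreover have M: "M \<in> carrier_mat n n" by (simp add: M_def)
  ultimately have "M \<in> Units (ring_mat TYPE(complex) n ())"
    by (intro det_non_zero_imp_unit)
  then obtain B where B: "B \<in> carrier_mat n n" "B * M = 1\<^sub>m n"
    by (auto simp: Units_def ring_mat_def)
  define ie where "ie = inv_into {..<n} e"
  have ie: "ie i < n" "e (ie i) = i" if "i \<in> I" for i
    using that e inv_into_into[of i e "{..<n}"] f_inv_into_f[of i e "{..<n}"]
    by (auto simp: ie_def n_def)
  have sum: "(\<Sum>k\<in>I. h k) = (\<Sum>a<n. h (e a))" for h :: "'a \<Rightarrow> complex"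
    using e unfolding n_def by (metis (no_types, lifting) sum.reindex_cong)
  have iee: "ie (e a) = a" if "a < n" for a
    using that e by (simp add: ie_def n_def)
  show thesis
  proof (rule that[of "\<lambda>i j. B $$ (ie i, ie j)"])
    fix i j assume ij: "i \<in> I" "j \<in> I"
    have eq: "ie i = ie j \<longleftrightarrow> i = j" using ie ij by metis
    have "(\<Sum>k\<in>I. B $$ (ie i, ie k) * L k j) = (B * M) $$ (ie i, ie j)"
      using ie[OF ij(1)] ie[OF ij(2)] B(1) M unfolding sum
      by (simp add: scalar_prod_def M_def lessThan_atLeast0 iee)
    then show "(\<Sum>k\<in>I. B $$ (ie i, ie k) * L k j) = of_bool (i = j)"
      using ie ij by (simp add: B eq)
  qed
qed

text \<open>
  Both sides are the determinant of the block matrix \<open>(P, A; B, 1)\<close>. For invertible \<open>P\<close> this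
  is Sylvester's identity with \<open>U = P^-1 A\<close>.
\<close>

lemma det_minus_mult_eq:
  fixes P :: "complex mat"
  assumes [simp]: "P \<in> carrier_mat n n" "A \<in> carrier_mat n m" "B \<in> carrier_mat m n" "U \<in> carrier_mat n m"
    and PU: "P * U = A"
  shows "Determinant.det (P - A * B) = Determinant.det P * Determinant.det (1\<^sub>m m - B * U)"
proof -
  note [simp] = carrier_matD[OF assms(1)] carrier_matD[OF assms(2)] carrier_matD[OF assms(3)]
    carrier_matD[OF assms(4)]
  let ?X = "four_block_mat P A B (1\<^sub>m m)"
  let ?Y = "four_block_mat (1\<^sub>m n) (- U) (0\<^sub>m m n) (1\<^sub>m m)"
  let ?Z = "four_block_mat (1\<^sub>m n) (0\<^sub>m n m) (- B) (1\<^sub>m m)"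
  have [simp]: "-U \<in> carrier_mat n m" "-B \<in> carrier_mat m n" by auto
  have dX: "?X \<in> carrier_mat (n + m) (n + m)" and dY: "?Y \<in> carrier_mat (n + m) (n + m)"
    and dZ: "?Z \<in> carrier_mat (n + m) (n + m)" by auto
  have PA: "P * (- U) + A = 0\<^sub>m n m"
    unfolding PU[symmetric]
    by (intro eq_matI)
       (auto simp: scalar_prod_def sum_negf carrier_matD[OF assms(1)] carrier_matD[OF assms(4)])
  have "?X * ?Y = four_block_mat (P * 1\<^sub>m n + A * 0\<^sub>m m n) (P * (- U) + A * 1\<^sub>m m)
      (B * 1\<^sub>m n + 1\<^sub>m m * 0\<^sub>m m n) (B * (- U) + 1\<^sub>m m * 1\<^sub>m m)"
    by (rule mult_four_block_mat[where ?nr1.0 = n and ?n1.0 = n and ?n2.0 = m and ?nr2.0 = m and ?nc1.0 = n and ?nc2.0 = m]) simp_all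
  also have "\<dots> = four_block_mat P (0\<^sub>m n m) B (1\<^sub>m m - B * U)"
  proof -
    have "P * 1\<^sub>m n + A * 0\<^sub>m m n = P" by (intro eq_matI) auto
    moreover have "P * (- U) + A * 1\<^sub>m m = 0\<^sub>m n m" using PA by simp
    moreover have "B * 1\<^sub>m n + 1\<^sub>m m * 0\<^sub>m m n = B" by (intro eq_matI) auto
    moreover have "B * (- U) + 1\<^sub>m m * 1\<^sub>m m = 1\<^sub>m m - B * U"
      by (intro eq_matI) auto
    ultimately show ?thesis by simp
  qed
  finally have XY: "?X * ?Y = four_block_mat P (0\<^sub>m n m) B (1\<^sub>m m - B * U)" .
  have "?X * ?Z = four_block_mat (P * 1\<^sub>m n + A * (- B)) (P * 0\<^sub>m n m + A * 1\<^sub>m m)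
      (B * 1\<^sub>m n + 1\<^sub>m m * (- B)) (B * 0\<^sub>m n m + 1\<^sub>m m * 1\<^sub>m m)"
    by (rule mult_four_block_mat[where ?nr1.0 = n and ?n1.0 = n and ?n2.0 = m and ?nr2.0 = m and ?nc1.0 = n and ?nc2.0 = m]) simp_all
  also have "\<dots> = four_block_mat (P - A * B) A (0\<^sub>m m n) (1\<^sub>m m)"
  proof -
    have "P * 1\<^sub>m n + A * (- B) = P - A * B" by (intro eq_matI) auto
    moreover have "P * 0\<^sub>m n m + A * 1\<^sub>m m = A" by (intro eq_matI) auto
    moreover have "B * 1\<^sub>m n + 1\<^sub>m m * (- B) = 0\<^sub>m m n" by (intro eq_matI) auto
    moreover have "B * 0\<^sub>m n m + 1\<^sub>m m * 1\<^sub>m m = 1\<^sub>m m" by (intro eq_matI) auto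
    ultimately show ?thesis by simp
  qed
  finally have XZ: "?X * ?Z = four_block_mat (P - A * B) A (0\<^sub>m m n) (1\<^sub>m m)" .
  have [simp]: "1\<^sub>m m - B * U \<in> carrier_mat m m" "P - A * B \<in> carrier_mat n n" by auto
  have dY1: "Determinant.det ?Y = 1" by (subst det_four_block_mat_lower_left_zero[of _ n _ m]) auto
  have dZ1: "Determinant.det ?Z = 1" by (subst det_four_block_mat_upper_right_zero[of _ n _ m]) auto
  have "Determinant.det ?X = Determinant.det (?X * ?Y)"
    using Determinant.det_mult[OF dX dY] dY1 by simp
  also have "\<dots> = Determinant.det P * Determinant.det (1\<^sub>m m - B * U)"
    unfolding XY by (subst det_four_block_mat_upper_right_zero[of _ n _ m]) auto
  finally have 1: "Determinant.det ?X = Determinant.det P * Determinant.det (1\<^sub>m m - B * U)" .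
  have "Determinant.det ?X = Determinant.det (?X * ?Z)"
    using Determinant.det_mult[OF dX dZ] dZ1 by simp
  also have "\<dots> = Determinant.det (P - A * B)"
    unfolding XZ by (subst det_four_block_mat_lower_left_zero[of _ n _ m]) auto
  finally show ?thesis using 1 by simp
qed

text \<open>P enters through a solution U of P U = A, so that an explicit U can be checked instead
  of an inverse of P being formed; the killed sums will supply it. A determinant over a growing
  window is traded for one over a fixed T.\<close>

lemma dset_minus_finite_rank:
  assumes "finite S" "finite T"
    and PU: "\<And>p l. p \<in> S \<Longrightarrow> l \<in> T \<Longrightarrow> (\<Sum>q\<in>S. P p q * U q l) = A p l"
  shows "dset (\<lambda>p q. P p q - (\<Sum>l\<in>T. A p l * B l q)) S
       = dset P S * dset (\<lambda>l k. of_bool (l = k) - (\<Sum>q\<in>S. B l q * U q k)) T"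
proof -
  obtain e where e: "inj_on e {..<card S}" "e ` {..<card S} = S"
    using enumerate_finite[OF assms(1)] .
  obtain d where d: "inj_on d {..<card T}" "d ` {..<card T} = T"
    using enumerate_finite[OF assms(2)] .
  define n m where "n = card S" and "m = card T"
  have eS: "e a \<in> S" if "a < n" for a using that e by (auto simp: n_def)
  have dT: "d a \<in> T" if "a < m" for a using that d by (auto simp: m_def)
  have eqd: "a = b \<longleftrightarrow> d a = d b" if "a < m" "b < m" for a b
    using that d(1) by (auto simp: m_def inj_on_def)
  have sumS: "(\<Sum>k\<in>S. h k) = (\<Sum>a=0..<n. h (e a))" for h :: "'a \<Rightarrow> complex"
    using e unfolding n_def lessThan_atLeast0 by (metis (no_types, lifting) sum.reindex_cong)
  have sumT: "(\<Sum>k\<in>T. h k) = (\<Sum>a=0..<m. h (d a))" for h :: "'b \<Rightarrow> complex"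
    using d unfolding m_def lessThan_atLeast0 by (metis (no_types, lifting) sum.reindex_cong)
  have MS: "dset f S = Determinant.det (Matrix.mat n n (\<lambda>(a, b). f (e a) (e b)))" for f
    unfolding det_mat_eq_dset using e dset_reindex[of e "{..<card S}" f] by (simp add: n_def)
  have MT: "dset f T = Determinant.det (Matrix.mat m m (\<lambda>(a, b). f (d a) (d b)))" for f
    unfolding det_mat_eq_dset using d dset_reindex[of d "{..<card T}" f] by (simp add: m_def)
  let ?P = "Matrix.mat n n (\<lambda>(a, b). P (e a) (e b))"
  let ?A = "Matrix.mat n m (\<lambda>(a, b). A (e a) (d b))"
  let ?B = "Matrix.mat m n (\<lambda>(a, b). B (d a) (e b))"
  let ?U = "Matrix.mat n m (\<lambda>(a, b). U (e a) (d b))"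
  have "?P * ?U = ?A"
    by (rule eq_matI) (auto simp: scalar_prod_def PU[OF eS dT, symmetric] sumS)
  then have "Determinant.det (?P - ?A * ?B) = Determinant.det ?P * Determinant.det (1\<^sub>m m - ?B * ?U)"
    by (intro det_minus_mult_eq) auto
  moreover have "?P - ?A * ?B = Matrix.mat n n (\<lambda>(a, b). P (e a) (e b) - (\<Sum>l\<in>T. A (e a) l * B l (e b)))"
    by (rule eq_matI) (auto simp: scalar_prod_def sumT)
  moreover have "1\<^sub>m m - ?B * ?U
      = Matrix.mat m m (\<lambda>(a, b). of_bool (d a = d b) - (\<Sum>q\<in>S. B (d a) q * U q (d b)))"
    by (rule eq_matI) (auto simp: scalar_prod_def sumS eqd)
  ultimately show ?thesis unfolding MS MT by simp
qed

section \<open>Fredholm determinants of dominated kernels\<close>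

lemma norm_summable_on_le:
  assumes "g summable_on A" "\<And>x. x \<in> A \<Longrightarrow> norm (f x) \<le> g x"
  shows "(\<lambda>x. norm (f x)) summable_on A"
  by (rule summable_on_comparison_test[OF assms]) auto

text \<open>A finite set F carries all but \<epsilon>/4 of the sum of g, which bounds both tails
  uniformly in R; on F only finitely many limits are involved.\<close>

lemma infsum_tendsto_dominated:
  fixes f :: "nat \<Rightarrow> 'b \<Rightarrow> complex"
  assumes lim: "\<And>x. x \<in> A \<Longrightarrow> (\<lambda>R. f R x) \<longlonglongrightarrow> f0 x"
    and dom: "\<And>R x. x \<in> A \<Longrightarrow> norm (f R x) \<le> g x"
    and g: "g summable_on A"
  shows "(\<lambda>R. infsum (f R) A) \<longlonglongrightarrow> infsum f0 A"
proof -
  have dom0: "norm (f0 x) \<le> g x" if "x \<in> A" for x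
    by (rule LIMSEQ_le_const2[OF tendsto_norm[OF lim[OF that]]]) (use dom that in auto)
  show "(\<lambda>R. infsum (f R) A) \<longlonglongrightarrow> infsum f0 A"
  proof (rule LIMSEQ_I)
    fix \<epsilon> :: real assume "0 < \<epsilon>"
    then have e: "0 < \<epsilon> / 4" by simp
    obtain F where F: "finite F" "F \<subseteq> A" "dist (sum g F) (infsum g A) \<le> \<epsilon> / 4"
      using infsum_finite_approximation[OF g e] by blast
    have gF: "g summable_on F" "g summable_on (A - F)"
      using F g by (auto intro: summable_on_subset_banach)
    have "infsum g A = sum g F + infsum g (A - F)"
      using infsum_Un_disjoint[OF gF] F by (simp add: Un_absorb1)
    then have tail: "infsum g (A - F) \<le> \<epsilon> / 4"
      using F(3) by (simp add: dist_real_def)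
    have split: "infsum h A = sum h F + infsum h (A - F) \<and> norm (infsum h (A - F)) \<le> \<epsilon> / 4"
      if h: "\<And>x. x \<in> A \<Longrightarrow> norm (h x) \<le> g x" for h :: "'b \<Rightarrow> complex"
    proof
      have "(\<lambda>x. norm (h x)) summable_on A"
        by (rule norm_summable_on_le[OF g h])
      then have hs: "h summable_on A" by (rule abs_summable_summable)
      then have "h summable_on F" "h summable_on (A - F)"
        using F by (auto intro: summable_on_subset_banach)
      then show "infsum h A = sum h F + infsum h (A - F)"
        using infsum_Un_disjoint[of h F "A - F"] F by (simp add: Un_absorb1)
      have "norm (infsum h (A - F)) \<le> infsum g (A - F)"
        using h by (intro norm_infsum_le[OF has_sum_infsum has_sum_infsum] gF \<open>h summable_on (A - F)\<close>) auto
      then show "norm (infsum h (A - F)) \<le> \<epsilon> / 4" using tail by simp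
    qed
    have "(\<lambda>R. sum (f R) F) \<longlonglongrightarrow> sum f0 F"
      using F by (intro tendsto_sum lim) auto
    then obtain R0 where R0: "\<And>R. R \<ge> R0 \<Longrightarrow> norm (sum (f R) F - sum f0 F) < \<epsilon> / 4"
      using LIMSEQ_D e by blast
    show "\<exists>R0. \<forall>R\<ge>R0. norm (infsum (f R) A - infsum f0 A) < \<epsilon>"
    proof (intro exI allI impI)
      fix R assume "R \<ge> R0"
      have 1: "infsum (f R) A = sum (f R) F + infsum (f R) (A - F)"
          "norm (infsum (f R) (A - F)) \<le> \<epsilon> / 4" using split[of "f R"] dom by auto
      have 2: "infsum f0 A = sum f0 F + infsum f0 (A - F)"
          "norm (infsum f0 (A - F)) \<le> \<epsilon> / 4" using split[of f0] dom0 by auto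
      have "norm (infsum (f R) A - infsum f0 A)
          = norm ((sum (f R) F - sum f0 F) + (infsum (f R) (A - F) - infsum f0 (A - F)))"
        unfolding 1 2 by (simp add: algebra_simps)
      also have "\<dots> \<le> norm (sum (f R) F - sum f0 F)
          + (norm (infsum (f R) (A - F)) + norm (infsum f0 (A - F)))"
        by (intro norm_triangle_le add_mono norm_triangle_ineq4) auto
      also have "\<dots> < \<epsilon>" using R0[OF \<open>R \<ge> R0\<close>] 1(2) 2(2) \<open>0 < \<epsilon>\<close> by linarith
      finally show "norm (infsum (f R) A - infsum f0 A) < \<epsilon>" .
    qed
  qed
qed

lemma summable_on_prod_PiE:
  fixes h :: "'b \<Rightarrow> real"
  assumes "\<And>x. x \<in> S \<Longrightarrow> 0 \<le> h x" "h summable_on S"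
  shows "(\<lambda>p. \<Prod>a<k. h (p a)) summable_on ({..<k::nat} \<rightarrow>\<^sub>E S)"
    "infsum (\<lambda>p. \<Prod>a<k. h (p a)) ({..<k} \<rightarrow>\<^sub>E S) = infsum h S ^ k"
proof -
  let ?P = "\<lambda>p. \<Prod>a<k. h (p a)"
  have H0: "0 \<le> infsum h S" using assms(1) by (rule infsum_nonneg)
  have "sum ?P F \<le> infsum h S ^ k" if F: "finite F" "F \<subseteq> {..<k} \<rightarrow>\<^sub>E S" for F
  proof -
    \<comment> \<open>F lies in the box of all functions into the finite set B of its values, and
      over a box the sum of products factorises.\<close>
    define B where "B = (\<Union>p\<in>F. p ` {..<k})"
    have B: "finite B" "B \<subseteq> S" using F by (auto simp: B_def)
    have "sum ?P F \<le> sum ?P ({..<k} \<rightarrow>\<^sub>E B)"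
    proof (rule sum_mono2)
      show "F \<subseteq> {..<k} \<rightarrow>\<^sub>E B" using F by (auto simp: B_def PiE_iff)
      fix p assume "p \<in> ({..<k} \<rightarrow>\<^sub>E B) - F"
      then have "p a \<in> S" if "a < k" for a using B that by (auto simp: PiE_iff)
      then show "0 \<le> ?P p" by (intro prod_nonneg assms(1)) auto
    qed (use B in \<open>auto intro: finite_PiE\<close>)
    also have "\<dots> = (\<Prod>a<k. sum h B)" using B by (subst prod_sum_PiE) auto
    also have "\<dots> \<le> (\<Prod>a<k. infsum h S)"
      using B assms by (intro prod_mono conjI sum_nonneg finite_sum_le_infsum) auto
    finally show ?thesis by simp
  qed
  then show sm: "?P summable_on ({..<k} \<rightarrow>\<^sub>E S)"
    by (intro nonneg_bdd_above_summable_on bdd_aboveI2[where M = "infsum h S ^ k"])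
       (auto intro!: prod_nonneg assms(1))
  show "infsum ?P ({..<k} \<rightarrow>\<^sub>E S) = infsum h S ^ k"
    using infsum_prod_PiE[of "{..<k}" "\<lambda>_. h" "\<lambda>_. S"] sm assms(2) by simp
qed

text \<open>A substitute for the trace class property: after conjugation by w the kernel is bounded
  by the product g p * g q with g summable. The weight absorbs growth away from the diagonal and,
  being a conjugation, leaves the principal minors unchanged.\<close>

locale kernel_domination =
  fixes S :: "'s set" and w g :: "'s \<Rightarrow> real"
  assumes weight_pos: "p \<in> S \<Longrightarrow> 0 < w p"
    and bound_nonneg: "p \<in> S \<Longrightarrow> 0 \<le> g p"
    and bound_summable: "g summable_on S"
begin

definition dominated :: "('s \<Rightarrow> 's \<Rightarrow> complex) \<Rightarrow> bool" where
  "dominated K \<longleftrightarrow> (\<forall>p\<in>S. \<forall>q\<in>S. norm (K p q) \<le> w p * g p * (g q / w q))"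

definition minor_bound :: "nat \<Rightarrow> (nat \<Rightarrow> 's) \<Rightarrow> real" where
  "minor_bound k p = (\<Prod>a<k. g (p a) * infsum g S)"

lemma infsum_bound_nonneg: "0 \<le> infsum g S"
  by (rule infsum_nonneg) (rule bound_nonneg)

text \<open>
  For injective \<open>p\<close> the entries of a row sit at distinct points, so the conjugated row sums are
  bounded by \<open>g i\<close> times the full sum of \<open>g\<close>. The factor \<open>1 / k!\<close> then suffices for convergence, and
  Hadamard's inequality is not needed.
\<close>

lemma norm_minor_le:
  assumes "dominated K" "p \<in> {..<k} \<rightarrow>\<^sub>E S"
  shows "norm (fredholm_minor K k p) \<le> minor_bound k p"
proof (cases "inj_on p {..<k}")
  case True
  let ?I = "p ` {..<k}"
  have I: "?I \<subseteq> S" "finite ?I" using assms(2) by auto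
  have "dset K ?I = dset (\<lambda>i j. of_real (inverse (w i)) * K i j / of_real (inverse (w j))) ?I"
  proof (rule dset_conjugate[symmetric])
    fix i assume "i \<in> ?I"
    then have "0 < w i" using I weight_pos by blast
    then show "complex_of_real (inverse (w i)) \<noteq> 0" by simp
  qed (use I in auto)
  also have "norm \<dots> \<le> (\<Prod>i\<in>?I. \<Sum>j\<in>?I. norm (of_real (inverse (w i)) * K i j / of_real (inverse (w j))))"
    using I by (intro norm_dset_le) auto
  also have "\<dots> \<le> (\<Prod>i\<in>?I. g i * infsum g S)"
  proof (intro prod_mono conjI sum_nonneg)
    fix i assume i: "i \<in> ?I"
    have "(\<Sum>j\<in>?I. norm (of_real (inverse (w i)) * K i j / of_real (inverse (w j)))) \<le> (\<Sum>j\<in>?I. g i * g j)"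
    proof (rule sum_mono)
      fix j assume j: "j \<in> ?I"
      have w: "0 < w i" "0 < w j" using weight_pos I i j by auto
      have "norm (K i j) \<le> w i * g i * (g j / w j)"
        using assms(1) I i j unfolding dominated_def by blast
      then show "norm (of_real (inverse (w i)) * K i j / of_real (inverse (w j))) \<le> g i * g j"
        using w by (simp add: norm_mult norm_divide field_simps)
    qed
    also have "\<dots> \<le> g i * infsum g S"
      unfolding sum_distrib_left[symmetric] using I i bound_nonneg bound_summable
      by (intro mult_left_mono finite_sum_le_infsum) auto
    finally show "(\<Sum>j\<in>?I. norm (of_real (inverse (w i)) * K i j / of_real (inverse (w j)))) \<le> g i * infsum g S" .
  qed auto
  also have "\<dots> = minor_bound k p"
    unfolding minor_bound_def using True by (subst prod.reindex) auto
  finally show ?thesis using True by (simp add: fredholm_minor_inj)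
next
  case False
  then obtain a b where "a < k" "b < k" "a \<noteq> b" "p a = p b" by (auto simp: inj_on_def)
  then have "fredholm_minor K k p = 0"
    unfolding fredholm_minor_eq_dset by (intro dset_identical_rows[of _ a b]) auto
  then show ?thesis
    using assms(2) infsum_bound_nonneg bound_nonneg
    by (auto simp: minor_bound_def PiE_iff intro!: prod_nonneg mult_nonneg_nonneg)
qed

lemma minor_bound_summable:
  "minor_bound k summable_on ({..<k} \<rightarrow>\<^sub>E S)"
  "infsum (minor_bound k) ({..<k} \<rightarrow>\<^sub>E S) = (infsum g S * infsum g S) ^ k"
proof -
  have *: "minor_bound k = (\<lambda>p. \<Prod>a<k. g (p a) * infsum g S)"
    by (simp add: minor_bound_def fun_eq_iff)
  have s: "(\<lambda>p. g p * infsum g S) summable_on S"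
    using bound_summable by (rule summable_on_cmult_left)
  have 0: "0 \<le> g p * infsum g S" if "p \<in> S" for p
    using that infsum_bound_nonneg bound_nonneg by simp
  show "minor_bound k summable_on ({..<k} \<rightarrow>\<^sub>E S)"
    unfolding * by (rule summable_on_prod_PiE(1)[OF 0 s])
  have "infsum (\<lambda>p. g p * infsum g S) S = infsum g S * infsum g S"
    by (rule infsum_cmult_left) (simp add: bound_summable)
  then show "infsum (minor_bound k) ({..<k} \<rightarrow>\<^sub>E S) = (infsum g S * infsum g S) ^ k"
    unfolding * by (subst summable_on_prod_PiE(2)[OF 0 s]) auto
qed

lemma minors_summable:
  assumes "dominated K"
  shows "(\<lambda>p. norm (fredholm_minor K k p)) summable_on ({..<k} \<rightarrow>\<^sub>E S)"
  by (rule norm_summable_on_le[OF minor_bound_summable(1) norm_minor_le[OF assms]])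

lemma norm_fredholm_coeff_le:
  assumes "dominated K"
  shows "norm (fredholm_coeff S K k) \<le> (infsum g S * infsum g S) ^ k / fact k"
proof -
  have "norm (\<Sum>\<^sub>\<infinity>p\<in>{..<k} \<rightarrow>\<^sub>E S. fredholm_minor K k p) \<le> (infsum g S * infsum g S) ^ k"
    unfolding minor_bound_summable(2)[symmetric]
    using minors_summable[OF assms]
    by (intro norm_infsum_le[OF has_sum_infsum has_sum_infsum] norm_minor_le[OF assms]
        minor_bound_summable(1)) (auto intro: abs_summable_summable)
  then show ?thesis
    unfolding fredholm_coeff_def by (simp add: norm_mult norm_divide norm_power divide_right_mono)
qed

lemma coeff_bound_summable: "summable (\<lambda>k. (infsum g S * infsum g S) ^ k / fact k)"
  using summable_exp[of "infsum g S * infsum g S"] by (simp add: divide_inverse mult.commute)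

lemma fredholm_converges_dominated:
  assumes "dominated K"
  shows "fredholm_converges S K"
  unfolding fredholm_converges_def
  using minors_summable[OF assms] norm_fredholm_coeff_le[OF assms]
  by (auto intro: summable_comparison_test'[OF coeff_bound_summable])

text \<open>Dominated convergence is applied twice: to the tuples inside each coefficient with
  \<open>minor_bound\<close>, and to the series over k with the bound G^(2 k) / k!, where G is the
  sum of g. The domination passes to the pointwise limit K0.\<close>

lemma fredholm_det_tendsto:
  assumes K: "\<And>R. dominated (K R)"
    and lim: "\<And>p q. p \<in> S \<Longrightarrow> q \<in> S \<Longrightarrow> (\<lambda>R. K R p q) \<longlonglongrightarrow> K0 p q"
  shows "(\<lambda>R. fredholm_det S (K R)) \<longlonglongrightarrow> fredholm_det S K0" "fredholm_converges S K0"
proof -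
  have "dominated K0"
    unfolding dominated_def
  proof (intro ballI)
    fix p q assume "p \<in> S" "q \<in> S"
    then show "norm (K0 p q) \<le> w p * g p * (g q / w q)"
      using K unfolding dominated_def
      by (intro LIMSEQ_le_const2[OF tendsto_norm[OF lim]]) auto
  qed
  then show "fredholm_converges S K0" by (rule fredholm_converges_dominated)
  have "(\<lambda>R. fredholm_coeff S (K R) k) \<longlonglongrightarrow> fredholm_coeff S K0 k" for k
    unfolding fredholm_coeff_def
  proof (intro tendsto_mult tendsto_const infsum_tendsto_dominated)
    fix p assume p: "p \<in> {..<k} \<rightarrow>\<^sub>E S"
    then show "(\<lambda>R. fredholm_minor (K R) k p) \<longlonglongrightarrow> fredholm_minor K0 k p"
      unfolding fredholm_minor_eq_dset by (intro tendsto_dset lim) auto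
    show "norm (fredholm_minor (K R) k p) \<le> minor_bound k p" for R
      by (rule norm_minor_le[OF K p])
  qed (rule minor_bound_summable)
  then show "(\<lambda>R. fredholm_det S (K R)) \<longlonglongrightarrow> fredholm_det S K0"
    unfolding fredholm_det_def
    using tannerys_theorem[of "\<lambda>k R. fredholm_coeff S (K R) k" "fredholm_coeff S K0" sequentially
        "\<lambda>k. (infsum g S * infsum g S) ^ k / fact k"]
    by (simp add: norm_fredholm_coeff_le[OF K] coeff_bound_summable case_prod_unfold)
qed

end

section \<open>Kernels supported on finitely many rows\<close>

lemma card_injective_enumerations:
  assumes "finite J" "J \<subseteq> S"
  shows "card {p \<in> {..<card J} \<rightarrow>\<^sub>E S. inj_on p {..<card J} \<and> p ` {..<card J} = J} = fact (card J)"
proof -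
  have "{p \<in> {..<card J} \<rightarrow>\<^sub>E S. inj_on p {..<card J} \<and> p ` {..<card J} = J}
      = {p \<in> extensional_funcset {..<card J} J. inj_on p {..<card J}}"
  proof (intro equalityI subsetI)
    fix p assume "p \<in> {p \<in> extensional_funcset {..<card J} J. inj_on p {..<card J}}"
    then have p: "p \<in> extensional {..<card J}" "p ` {..<card J} \<subseteq> J" "inj_on p {..<card J}"
      by (auto simp: PiE_iff)
    then have "p ` {..<card J} = J" by (intro card_subset_eq assms(1)) (auto simp: card_image)
    then show "p \<in> {p \<in> {..<card J} \<rightarrow>\<^sub>E S. inj_on p {..<card J} \<and> p ` {..<card J} = J}"
      using p assms(2) by (auto simp: PiE_iff)
  qed (auto simp: PiE_iff)
  then show ?thesis
    using assms card_inj_on_subset_funcset[of "{..<card J}" J "{..<card J}"]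
      fact_prod_rev[of "card J", where 'a = nat] by simp
qed

text \<open>Tuples that leave I or repeat a point have vanishing minors. Each J of size k is the
  image of k! tuples with the same minor, which cancels the factor 1 / k!, and the series becomes
  the expansion of det (1 - K) into principal minors.\<close>

lemma fredholm_det_finite_support:
  assumes "finite I" "I \<subseteq> S"
    and supp: "\<And>p q. p \<in> S \<Longrightarrow> q \<in> S \<Longrightarrow> K p q \<noteq> 0 \<Longrightarrow> p \<in> I"
  shows "fredholm_det S K = dset (\<lambda>i j. of_bool (i = j) - K i j) I"
proof -
  have zero: "fredholm_minor K k p = 0" if p: "p \<in> ({..<k} \<rightarrow>\<^sub>E S) - ({..<k} \<rightarrow>\<^sub>E I)" for k p
  proof -
    obtain a where a: "a < k" "p a \<notin> I" using p by (auto simp: PiE_iff)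
    have "(\<Prod>i<k. K (p i) (p (\<sigma> i))) = 0" if s: "\<sigma> permutes {..<k}" for \<sigma>
    proof (rule prod_zero)
      have "K (p a) (p (\<sigma> a)) = 0"
        using supp[of "p a" "p (\<sigma> a)"] a p permutes_in_image[OF s, of a] by (auto simp: PiE_iff)
      then show "\<exists>i\<in>{..<k}. K (p i) (p (\<sigma> i)) = 0" using a by auto
    qed simp
    then show ?thesis
      unfolding fredholm_minor_eq_dset dset_def by (intro sum.neutral ballI) (simp only: mem_Collect_eq mult_zero_right)
  qed
  define E where "E k J = {p \<in> {..<k::nat} \<rightarrow>\<^sub>E I. inj_on p {..<k} \<and> p ` {..<k} = J}" for k J
  have coeff: "fredholm_coeff S K k = (\<Sum>J | J \<subseteq> I \<and> card J = k. (- 1) ^ card J * dset K J)" for k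
  proof -
    have fin: "finite ({..<k} \<rightarrow>\<^sub>E I)" using assms(1) by (intro finite_PiE) auto
    have "(\<Sum>\<^sub>\<infinity>p\<in>{..<k} \<rightarrow>\<^sub>E S. fredholm_minor K k p) = (\<Sum>p\<in>{..<k} \<rightarrow>\<^sub>E I. fredholm_minor K k p)"
      unfolding infsum_finite[OF fin, symmetric]
    proof (rule infsum_cong_neutral)
      fix p assume "p \<in> ({..<k} \<rightarrow>\<^sub>E I) - ({..<k} \<rightarrow>\<^sub>E S)"
      then show "fredholm_minor K k p = 0" using assms(2) by (auto simp: PiE_iff)
    qed (auto intro!: zero)
    also have "\<dots> = (\<Sum>p\<in>{p \<in> {..<k} \<rightarrow>\<^sub>E I. inj_on p {..<k}}. fredholm_minor K k p)"
    proof (rule sum.mono_neutral_right[OF fin])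
      show "\<forall>p\<in>({..<k} \<rightarrow>\<^sub>E I) - {p \<in> {..<k} \<rightarrow>\<^sub>E I. inj_on p {..<k}}. fredholm_minor K k p = 0"
      proof
        fix p assume "p \<in> ({..<k} \<rightarrow>\<^sub>E I) - {p \<in> {..<k} \<rightarrow>\<^sub>E I. inj_on p {..<k}}"
        then obtain a b where "a < k" "b < k" "a \<noteq> b" "p a = p b" by (auto simp: inj_on_def)
        then show "fredholm_minor K k p = 0"
          unfolding fredholm_minor_eq_dset by (intro dset_identical_rows[of _ a b]) auto
      qed
    qed auto
    also have "\<dots> = (\<Sum>J | J \<subseteq> I \<and> card J = k. \<Sum>p\<in>E k J. fredholm_minor K k p)"
    proof -
      have sub: "(\<lambda>p. p ` {..<k}) ` {p \<in> {..<k} \<rightarrow>\<^sub>E I. inj_on p {..<k}} \<subseteq> {J. J \<subseteq> I \<and> card J = k}"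
      proof clarify
        fix p assume "p \<in> {..<k} \<rightarrow>\<^sub>E I" "inj_on p {..<k}"
        then show "p ` {..<k} \<subseteq> I \<and> card (p ` {..<k}) = k" using card_image[of p "{..<k}"] by auto
      qed
      have "finite {p \<in> {..<k} \<rightarrow>\<^sub>E I. inj_on p {..<k}}" "finite {J. J \<subseteq> I \<and> card J = k}"
        using fin assms(1) by auto
      from sum.group[OF this sub, of "fredholm_minor K k", symmetric]
      show ?thesis by (simp add: E_def conj_assoc)
    qed
    also have "\<dots> = (\<Sum>J | J \<subseteq> I \<and> card J = k. fact k * dset K J)"
    proof (intro sum.cong refl)
      fix J assume J: "J \<in> {J. J \<subseteq> I \<and> card J = k}"
      then have "finite J" using assms(1) finite_subset by auto
      have "(\<Sum>p\<in>E k J. fredholm_minor K k p) = (\<Sum>p\<in>E k J. dset K J)"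
        by (intro sum.cong) (auto simp: E_def fredholm_minor_inj)
      also have "\<dots> = fact k * dset K J"
        using card_injective_enumerations[of J I] \<open>finite J\<close> J by (simp add: E_def)
      finally show "(\<Sum>p\<in>E k J. fredholm_minor K k p) = fact k * dset K J" .
    qed
    also have "\<dots> = fact k * (\<Sum>J | J \<subseteq> I \<and> card J = k. dset K J)"
      by (simp add: sum_distrib_left)
    finally have "fredholm_coeff S K k = (- 1) ^ k * (\<Sum>J | J \<subseteq> I \<and> card J = k. dset K J)"
      unfolding fredholm_coeff_def by simp
    then show ?thesis unfolding sum_distrib_left by (auto intro!: sum.cong)
  qed
  have "fredholm_det S K = (\<Sum>k\<le>card I. fredholm_coeff S K k)"
    unfolding fredholm_det_def
  proof (rule suminf_finite)
    fix k assume "k \<notin> {..card I}"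
    then have "{J. J \<subseteq> I \<and> card J = k} = {}" using assms(1) card_mono by fastforce
    then show "fredholm_coeff S K k = 0" by (simp only: coeff sum.empty)
  qed simp
  also have "\<dots> = (\<Sum>k\<le>card I. \<Sum>J | J \<in> Pow I \<and> card J = k. (- 1) ^ card J * dset K J)"
    by (simp add: coeff)
  also have "\<dots> = (\<Sum>J\<in>Pow I. (- 1) ^ card J * dset K J)"
    using assms(1) by (intro sum.group) (auto intro: card_mono)
  also have "\<dots> = dset (\<lambda>i j. of_bool (i = j) - K i j) I"
    using assms(1) by (simp add: dset_one_minus_expand)
  finally show ?thesis .
qed

section \<open>Laurent coefficients and expansions at 1\<close>

lemma circ_integral_cong:
  assumes "0 < s" "\<And>w. norm w = s \<Longrightarrow> f w = g w"
  shows "circ_integral s f = circ_integral s g"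
proof -
  have "contour_integral (circlepath 0 s) f = contour_integral (circlepath 0 s) g"
    using assms by (intro contour_integral_eq) simp
  then show ?thesis by (simp add: circ_integral_def)
qed

lemma circ_integral_add:
  assumes "0 < s" "continuous_on (sphere 0 s) f" "continuous_on (sphere 0 s) g"
  shows "circ_integral s (\<lambda>w. f w + g w) = circ_integral s f + circ_integral s g"
  using assms
  by (simp add: circ_integral_def contour_integral_add contour_integrable_continuous_circlepath
      add_divide_distrib)

lemma circ_integral_diff:
  assumes "0 < s" "continuous_on (sphere 0 s) f" "continuous_on (sphere 0 s) g"
  shows "circ_integral s (\<lambda>w. f w - g w) = circ_integral s f - circ_integral s g"
  using assms
  by (simp add: circ_integral_def contour_integral_diff contour_integrable_continuous_circlepath
      diff_divide_distrib)

lemma circ_integral_cmult: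
  assumes "0 < s" "continuous_on (sphere 0 s) f"
  shows "circ_integral s (\<lambda>w. c * f w) = c * circ_integral s f"
  using assms
  by (simp add: circ_integral_def contour_integral_lmul contour_integrable_continuous_circlepath)

lemma norm_circ_integral_le:
  assumes "0 < s" "continuous_on (sphere 0 s) f" "0 \<le> B" "\<And>w. norm w = s \<Longrightarrow> norm (f w) \<le> B"
  shows "norm (circ_integral s f) \<le> B * s"
proof -
  have "f contour_integrable_on circlepath 0 s"
    using assms by (intro contour_integrable_continuous_circlepath) simp
  then have "norm (contour_integral (circlepath 0 s) f) \<le> B * (2 * pi * s)"
    using assms by (intro has_contour_integral_bound_circlepath[OF has_contour_integral_integral]) auto
  then show ?thesis
    unfolding circ_integral_def by (simp add: norm_divide norm_mult field_simps)
qed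

lemma circ_integral_radius:
  assumes "f analytic_on annulus s1 s2" "0 < s1" "s1 \<le> s2"
  shows "circ_integral s1 f = circ_integral s2 f"
proof -
  obtain T where T: "open T" "annulus s1 s2 \<subseteq> T" "f holomorphic_on T"
    using assms(1) unfolding analytic_on_holomorphic by blast
  have "homotopic_loops T (circlepath 0 s1) (circlepath 0 s2)"
  proof (rule homotopic_loops_linear)
    fix t :: real assume "t \<in> {0..1}"
    show "closed_segment (circlepath 0 s1 t) (circlepath 0 s2 t) \<subseteq> T"
    proof
      fix x assume "x \<in> closed_segment (circlepath 0 s1 t) (circlepath 0 s2 t)"
      then obtain u where u: "0 \<le> u" "u \<le> 1"
        "x = (1 - u) *\<^sub>R circlepath 0 s1 t + u *\<^sub>R circlepath 0 s2 t"
        by (auto simp: closed_segment_def)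
      define a where "a = (1 - u) * s1 + u * s2"
      have "x = complex_of_real a * exp (2 * of_real pi * \<i> * of_real t)"
        using u(3) by (simp add: circlepath a_def scaleR_conv_of_real algebra_simps)
      then have "norm x = \<bar>a\<bar>"
        by (simp add: norm_mult)
      moreover have "s1 \<le> a" "a \<le> s2"
        using u assms convex_bound_le[of s1 s2 s2 "1 - u" u]
          convex_bound_le[of "-s1" "-s1" "-s2" "1 - u" u] by (auto simp: a_def)
      ultimately have "x \<in> annulus s1 s2" using assms by (auto simp: annulus_def)
      then show "x \<in> T" using T by auto
    qed
  qed auto
  then show ?thesis
    unfolding circ_integral_def using T by (subst Cauchy_theorem_homotopic_loops) auto
qed

lemma circ_integral_analytic_eq_0:
  assumes "f analytic_on cball 0 s" "0 < s"
  shows "circ_integral s f = 0"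
proof -
  obtain T where T: "open T" "cball 0 s \<subseteq> T" "f holomorphic_on T"
    using assms(1) unfolding analytic_on_holomorphic by blast
  have "(f has_contour_integral 0) (circlepath 0 s)"
    using assms T holomorphic_on_imp_continuous_on[OF T(3)]
    by (intro Cauchy_theorem_disc_simple[of f 0 "s + 1"] Cauchy_theorem_convex_simple[of f "cball 0 s"])
      (auto intro: holomorphic_on_subset)
  then show ?thesis by (simp add: circ_integral_def contour_integral_unique)
qed

lemma circ_integral_fps_nth:
  assumes f: "f analytic_on cball 0 s" and "0 < s" and F: "f has_fps_expansion F"
  shows "circ_integral s (\<lambda>w. f w / w ^ Suc n) = fps_nth F n"
proof -
  obtain T where T: "open T" "cball 0 s \<subseteq> T" "f holomorphic_on T"
    using f unfolding analytic_on_holomorphic by blast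
  have "((\<lambda>u. f u / (u - 0) ^ Suc n) has_contour_integral (2 * pi * \<i>) / fact n * (deriv ^^ n) f 0)
      (circlepath 0 s)"
    using T(2) assms(2) ball_subset_cball[of 0 s]
    by (intro Cauchy_has_contour_integral_higher_derivative_circlepath
        holomorphic_on_subset[OF T(3)] holomorphic_on_imp_continuous_on) auto
  then show ?thesis
    unfolding circ_integral_def fps_nth_fps_expansion[OF F] by (simp add: contour_integral_unique)
qed

lemma continuous_on_sphere_annulus:
  assumes "f analytic_on annulus \<rho> \<rho>'" "\<rho> \<le> s" "s \<le> \<rho>'"
  shows "continuous_on (sphere 0 s) f"
  using assms by (auto intro!: analytic_imp_holomorphic holomorphic_on_imp_continuous_on
      analytic_on_subset[OF assms(1)] simp: annulus_def)

lemma continuous_on_sphere_powi: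
  "0 < s \<Longrightarrow> continuous_on (sphere 0 s) (\<lambda>w::complex. w powi m)"
  by (intro continuous_on_power_int continuous_on_id) auto

lemma powi_analytic_on_annulus:
  "0 < \<rho> \<Longrightarrow> (\<lambda>w. w powi m) analytic_on annulus \<rho> \<rho>'"
  by (intro analytic_intros) (auto simp: annulus_def)

lemma annulus_mono: "\<rho> \<le> s1 \<Longrightarrow> s2 \<le> \<rho>' \<Longrightarrow> annulus s1 s2 \<subseteq> annulus \<rho> \<rho>'"
  by (auto simp: annulus_def)

text \<open>The coefficient of w^x in the Laurent expansion of f on the circle of radius s.\<close>

definition coef :: "real \<Rightarrow> (complex \<Rightarrow> complex) \<Rightarrow> int \<Rightarrow> complex" where
  "coef s f x = circ_integral s (\<lambda>w. f w * w powi (- x - 1))"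

text \<open>Cauchy's estimate: a radius below 1 gives decay as x tends to -\<infinity>, a radius
  above 1 as x tends to +\<infinity>.\<close>

lemma coef_bounded:
  assumes "0 < s" "continuous_on (sphere 0 s) f"
  obtains C where "0 \<le> C" "\<And>x. norm (coef s f x) \<le> C * s powi (- x)"
proof -
  have "compact (f ` sphere 0 s)" using assms by (intro compact_continuous_image) auto
  then obtain B where B: "\<And>w. norm w = s \<Longrightarrow> norm (f w) \<le> B"
    using compact_imp_bounded bounded_iff by (metis image_eqI mem_sphere_0)
  have "norm (complex_of_real s) = s" using assms by simp
  then have "0 \<le> B" using B norm_ge_zero order_trans by metis
  show thesis
  proof (rule that[OF \<open>0 \<le> B\<close>])
    fix x
    have "norm (coef s f x) \<le> (B * s powi (- x - 1)) * s"
      unfolding coef_def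
      using assms B \<open>0 \<le> B\<close>
      by (intro norm_circ_integral_le continuous_intros)
         (auto simp: norm_mult norm_power_int intro!: mult_right_mono)
    also have "\<dots> = B * s powi (- x)"
      using assms power_int_add[of s "- x - 1" 1] by simp
    finally show "norm (coef s f x) \<le> B * s powi (- x)" .
  qed
qed

lemma coef_radius:
  assumes "f analytic_on annulus \<rho> \<rho>'" "0 < \<rho>" "\<rho> \<le> s1" "s1 \<le> s2" "s2 \<le> \<rho>'"
  shows "coef s1 f x = coef s2 f x"
  unfolding coef_def
proof (rule circ_integral_radius)
  show "(\<lambda>w. f w * w powi (- x - 1)) analytic_on annulus s1 s2"
    using assms
    by (intro analytic_on_mult powi_analytic_on_annulus
        analytic_on_subset[OF assms(1) annulus_mono]) auto
qed (use assms in auto)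

lemma coef_const: "0 < s \<Longrightarrow> coef s (\<lambda>_. c) x = (if x = 0 then c else 0)"
proof (cases "0 \<le> x")
  case True
  assume s: "0 < s"
  have "coef s (\<lambda>_. c) x = circ_integral s (\<lambda>w. c / w ^ Suc (nat x))"
    unfolding coef_def using True s
    by (intro circ_integral_cong) (auto simp: power_int_def divide_inverse nat_add_distrib power_inverse)
  also have "\<dots> = fps_nth (fps_const c) (nat x)"
    using s by (intro circ_integral_fps_nth) auto
  also have "\<dots> = (if x = 0 then c else 0)" using True by (auto simp: fps_const_def)
  finally show ?thesis .
next
  case False
  assume s: "0 < s"
  have "coef s (\<lambda>_. c) x = circ_integral s (\<lambda>w. c * w ^ nat (- x - 1))"
    unfolding coef_def using False s by (intro circ_integral_cong) (auto simp: power_int_def)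
  also have "\<dots> = 0"
    using s by (intro circ_integral_analytic_eq_0 analytic_intros)
  finally show ?thesis using False by simp
qed

lemma divided_difference_at_1:
  assumes "g analytic_on annulus \<rho> \<rho>'"
  obtains g1 where "g1 analytic_on annulus \<rho> \<rho>'" "\<And>w. g w = g 1 + (1 - w) * g1 w"
proof
  \<comment> \<open>The value at 1 fills the removable singularity; the outer minus sign is there
    because the quotient goes with 1 - w instead of w - 1.\<close>
  let ?g1 = "\<lambda>z. - (if z = 1 then deriv g 1 else (g z - g 1) / (z - 1))"
  show "?g1 analytic_on annulus \<rho> \<rho>'"
  proof -
    obtain T where T: "open T" "annulus \<rho> \<rho>' \<subseteq> T" "g holomorphic_on T"
      using assms unfolding analytic_on_holomorphic by blast
    have "?g1 holomorphic_on T"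
      by (rule holomorphic_on_minus[OF pole_lemma_open[OF T(3,1)]])
    then show ?thesis unfolding analytic_on_holomorphic using T by blast
  qed
  show "g w = g 1 + (1 - w) * ?g1 w" for w
    by (auto simp: field_simps)
qed

text \<open>The binomial series of (1 - w)^x in w, for integers x of either sign. A power z^x
  expanded at z = 1 thus becomes a formal series whose coefficients are polynomials in x.\<close>

definition fpsY :: "int \<Rightarrow> complex fps" where
  "fpsY x = Abs_fps (\<lambda>j. (- 1) ^ j * (of_int x gchoose j))"

lemma fpsY_nth_0 [simp]: "fps_nth (fpsY x) 0 = 1"
  by (simp add: fpsY_def)

lemma fpsY_add: "fpsY (x + y) = fpsY x * fpsY y"
proof (rule fps_ext)
  fix j
  have "fps_nth (fpsY x * fpsY y) j
      = (\<Sum>k=0..j. (- 1) ^ j * ((of_int x gchoose k) * (of_int y gchoose (j - k))))"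
    unfolding fps_mult_nth
    by (intro sum.cong) (auto simp: fpsY_def mult_ac power_add[symmetric])
  also have "\<dots> = fps_nth (fpsY (x + y)) j"
    by (simp add: fpsY_def sum_distrib_left[symmetric] gbinomial_Vandermonde)
  finally show "fps_nth (fpsY (x + y)) j = fps_nth (fpsY x * fpsY y) j" ..
qed

lemma fpsY_0 [simp]: "fpsY 0 = 1"
  by (rule fps_ext) (auto simp: fpsY_def gbinomial_0_left)

lemma fpsY_1: "fpsY 1 = 1 - fps_X"
proof (rule fps_ext)
  fix j show "fps_nth (fpsY 1) j = fps_nth (1 - fps_X) j"
    using binomial_gbinomial[of 1 j, where 'a = complex]
    by (cases j; cases "j - 1") (auto simp: fpsY_def)
qed

text \<open>Coefficients of (1 - w)^x - (1 - w)^(x + 1) = w (1 - w)^x: differencing in x lowers the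
  degree of the coefficient polynomials by one.\<close>

lemma fpsY_Suc_diff: "fps_nth (fpsY x) (Suc j) - fps_nth (fpsY (x + 1)) (Suc j) = fps_nth (fpsY x) j"
  by (simp add: fpsY_add fpsY_1 algebra_simps)

lemma fpsY_has_fps_expansion: "(\<lambda>w. (1 - w) powi x) has_fps_expansion fpsY x"
proof -
  have 1: "(\<lambda>w. 1 - w) has_fps_expansion fpsY 1"
    unfolding fpsY_1 by (intro fps_expansion_intros)
  have nat: "fpsY (int n) = fpsY 1 ^ n" for n
    by (induction n) (simp_all add: fpsY_add)
  have pow: "(\<lambda>w. (1 - w) ^ n) has_fps_expansion fpsY (int n)" for n
    unfolding nat by (intro has_fps_expansion_power 1)
  show ?thesis
  proof (cases "0 \<le> x")
    case True
    then show ?thesis using pow[of "nat x"] by (simp add: power_int_def)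
  next
    case False
    have "fpsY (int (nat (- x))) * fpsY x = 1"
      unfolding fpsY_add[symmetric] using False by simp
    then have "fpsY x = inverse (fpsY (int (nat (- x))))"
      by (rule fps_inverse_unique[symmetric])
    moreover have "(\<lambda>w. inverse ((1 - w) ^ nat (- x))) has_fps_expansion inverse (fpsY (int (nat (- x))))"
      by (intro has_fps_expansion_inverse pow) simp
    ultimately show ?thesis using False by (simp add: power_int_def power_inverse)
  qed
qed

lemma of_nat_le_exponential:
  fixes b :: real
  assumes "1 < b"
  shows "real n \<le> 1 / (b - 1) * b ^ n"
  using Bernoulli_inequality[of "b - 1" n] assms by (simp add: field_simps)

text \<open>A polynomial in x grows slower than any exponential. Passing from j to j + 1 multiplies
  by a linear factor in x; one factor sqrt b is spent on it and one on the induction hypothesis,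
  which is why b is generalised in the induction.\<close>

lemma fpsY_nth_bound:
  assumes "1 < (b :: real)"
  shows "\<exists>C\<ge>0. \<forall>x. norm (fps_nth (fpsY x) j) \<le> C * b ^ nat \<bar>x\<bar>"
  using assms
proof (induction j arbitrary: b)
  case 0
  then show ?case by (intro exI[of _ 1]) auto
next
  case (Suc j)
  define c where "c = sqrt b"
  have c: "1 < c" "c * c = b" using Suc.prems by (auto simp: c_def)
  obtain C where C: "0 \<le> C" "\<And>x. norm (fps_nth (fpsY x) j) \<le> C * c ^ nat \<bar>x\<bar>"
    using Suc.IH[OF c(1)] by auto
  define D where "D = 1 / (c - 1) + real j"
  have D: "0 \<le> D" using c by (simp add: D_def)
  show ?case
  proof (intro exI[of _ "C * D"] conjI allI)
    fix x :: int
    have "complex_of_int x gchoose Suc j = (of_int x gchoose j) * (of_int x - of_nat j) / of_nat (Suc j)"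
      using gbinomial_mult_1[of "complex_of_int x" j] of_nat_neq_0[of j, where 'a = complex]
      by (simp add: field_simps del: of_nat_Suc)
    then have "fps_nth (fpsY x) (Suc j) = - (fps_nth (fpsY x) j * (of_int x - of_nat j) / of_nat (Suc j))"
      unfolding fpsY_def by (simp del: of_nat_Suc)
    then have "norm (fps_nth (fpsY x) (Suc j))
        = norm (fps_nth (fpsY x) j) * (norm (complex_of_int x - of_nat j) / real (Suc j))"
      by (simp add: norm_mult norm_divide del: of_nat_Suc)
    also have "\<dots> \<le> norm (fps_nth (fpsY x) j) * norm (complex_of_int x - of_nat j)"
      by (intro mult_left_mono) (auto simp: field_simps intro: mult_left_mono[of 1])
    also have "norm (complex_of_int x - of_nat j) \<le> real (nat \<bar>x\<bar>) + real j"
      by (rule norm_triangle_le_diff) simp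
    also have "\<dots> \<le> D * c ^ nat \<bar>x\<bar>"
      using of_nat_le_exponential[OF c(1), of "nat \<bar>x\<bar>"] one_le_power[of c "nat \<bar>x\<bar>"] c(1)
        mult_left_mono[of 1 "c ^ nat \<bar>x\<bar>" "real j"]
      by (simp add: D_def algebra_simps)
    also have "norm (fps_nth (fpsY x) j) * (D * c ^ nat \<bar>x\<bar>) \<le> (C * c ^ nat \<bar>x\<bar>) * (D * c ^ nat \<bar>x\<bar>)"
      using C(2) D c(1) by (intro mult_right_mono) auto
    also have "\<dots> = C * D * b ^ nat \<bar>x\<bar>"
      unfolding c(2)[symmetric] power_mult_distrib by (simp add: algebra_simps)
    finally show "norm (fps_nth (fpsY x) (Suc j)) \<le> C * D * b ^ nat \<bar>x\<bar>"
      by (simp add: mult_left_mono)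
  qed (use C D in auto)
qed

lemma summable_on_geometric_int:
  assumes "0 \<le> q" "(q::real) < 1"
  shows "(\<lambda>x::int. q ^ nat \<bar>x\<bar>) summable_on UNIV"
proof -
  have "(\<lambda>n. q ^ n) summable_on (UNIV :: nat set)"
    using assms by (intro summable_nonneg_imp_summable_on summable_geometric) auto
  then have "(\<lambda>x::int. q ^ nat \<bar>x\<bar>) summable_on range int"
      "(\<lambda>x::int. q ^ nat \<bar>x\<bar>) summable_on range (\<lambda>n. - int n)"
    by (subst summable_on_reindex; auto simp: o_def inj_on_def)+
  then have "(\<lambda>x::int. q ^ nat \<bar>x\<bar>) summable_on (range int \<union> range (\<lambda>n. - int n))"
    by (rule summable_on_union)
  moreover have "x \<in> range int \<union> range (\<lambda>n. - int n)" for x :: int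
    by (cases x rule: int_cases2) auto
  then have "range int \<union> range (\<lambda>n. - int n) = UNIV" by blast
  ultimately show ?thesis by simp
qed

text \<open>The radius \<rho>' serves for x \<ge> 0 and \<rho> for x < 0; analyticity on the annulus
  identifies the two coefficients.\<close>

lemma coef_bound_two_sided:
  assumes "g analytic_on annulus \<rho> \<rho>'" "0 < \<rho>" "\<rho> < 1" "1 < \<rho>'"
  obtains C q where "0 \<le> C" "0 < q" "q < 1" "\<And>x. norm (coef \<rho> g x) \<le> C * q ^ nat \<bar>x\<bar>"
proof -
  obtain C1 where C1: "0 \<le> C1" "\<And>x. norm (coef \<rho> g x) \<le> C1 * \<rho> powi (- x)"
    using coef_bounded[of \<rho> g] continuous_on_sphere_annulus[OF assms(1)] assms by auto
  obtain C2 where C2: "0 \<le> C2" "\<And>x. norm (coef \<rho>' g x) \<le> C2 * \<rho>' powi (- x)"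
    using coef_bounded[of \<rho>' g] continuous_on_sphere_annulus[OF assms(1)] assms by auto
  have eq: "coef \<rho>' g x = coef \<rho> g x" for x
    by (rule coef_radius[symmetric]) (use assms in auto)
  define q where "q = max \<rho> (1 / \<rho>')"
  have q: "0 < q" "q < 1" using assms by (auto simp: q_def)
  show thesis
  proof (rule that[of "C1 + C2" q])
    fix x :: int
    show "norm (coef \<rho> g x) \<le> (C1 + C2) * q ^ nat \<bar>x\<bar>"
    proof (cases "0 \<le> x")
      case True
      have "norm (coef \<rho> g x) \<le> C2 * (1 / \<rho>') ^ nat \<bar>x\<bar>"
        using C2(2)[of x] True unfolding eq
        by (simp add: power_int_minus power_int_def power_one_over inverse_eq_divide split: if_splits)
      also have "\<dots> \<le> C2 * q ^ nat \<bar>x\<bar>"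
        using C2 assms by (intro mult_left_mono power_mono) (auto simp: q_def)
      also have "\<dots> \<le> (C1 + C2) * q ^ nat \<bar>x\<bar>"
        using C1 q by (intro mult_right_mono) auto
      finally show ?thesis .
    next
      case False
      have "norm (coef \<rho> g x) \<le> C1 * \<rho> ^ nat \<bar>x\<bar>"
        using C1(2)[of x] False by (simp add: power_int_def)
      also have "\<dots> \<le> C1 * q ^ nat \<bar>x\<bar>"
        using C1 assms by (intro mult_left_mono power_mono) (auto simp: q_def)
      also have "\<dots> \<le> (C1 + C2) * q ^ nat \<bar>x\<bar>"
        using C2 q by (intro mult_right_mono) auto
      finally show ?thesis .
    qed
  qed (use C1 C2 q in auto)
qed

lemma coef_fpsY_summable:
  assumes "g analytic_on annulus \<rho> \<rho>'" "0 < \<rho>" "\<rho> < 1" "1 < \<rho>'"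
  shows "(\<lambda>x. fps_nth (fpsY (x + s)) j * coef \<rho> g x) summable_on UNIV"
proof -
  obtain C q where C: "0 \<le> C" "0 < q" "q < 1" "\<And>x. norm (coef \<rho> g x) \<le> C * q ^ nat \<bar>x\<bar>"
    using coef_bound_two_sided[OF assms] by blast
  \<comment> \<open>Chosen so that b * q = sqrt q < 1: growth at rate b leaves half of the decay
    exponent.\<close>
  define b where "b = 1 / sqrt q"
  have b: "1 < b" using C by (simp add: b_def)
  obtain D where D: "0 \<le> D" "\<And>x. norm (fps_nth (fpsY x) j) \<le> D * b ^ nat \<bar>x\<bar>"
    using fpsY_nth_bound[OF b] by blast
  have bq: "b * q = sqrt q" using C(2) by (simp add: b_def real_div_sqrt)
  have "(\<lambda>x. norm (fps_nth (fpsY (x + s)) j * coef \<rho> g x)) summable_on UNIV"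
  proof (rule norm_summable_on_le)
    show "(\<lambda>x::int. (D * b ^ nat \<bar>s\<bar> * C) * sqrt q ^ nat \<bar>x\<bar>) summable_on UNIV"
      using C by (intro summable_on_cmult_right summable_on_geometric_int) auto
    fix x :: int
    have "b ^ nat \<bar>x + s\<bar> \<le> b ^ (nat \<bar>s\<bar> + nat \<bar>x\<bar>)"
      using b by (intro power_increasing) auto
    then have 1: "norm (fps_nth (fpsY (x + s)) j) \<le> D * b ^ (nat \<bar>s\<bar> + nat \<bar>x\<bar>)"
      using D(2)[of "x + s"] D(1) mult_left_mono order_trans by blast
    have "norm (fps_nth (fpsY (x + s)) j * coef \<rho> g x) \<le> (D * b ^ (nat \<bar>s\<bar> + nat \<bar>x\<bar>)) * (C * q ^ nat \<bar>x\<bar>)"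
      unfolding norm_mult using 1 C(4) D(1) b by (intro mult_mono) auto
    also have "\<dots> = (D * b ^ nat \<bar>s\<bar> * C) * sqrt q ^ nat \<bar>x\<bar>"
      unfolding bq[symmetric] power_mult_distrib power_add by (simp add: algebra_simps)
    finally show "norm (fps_nth (fpsY (x + s)) j * coef \<rho> g x) \<le> (D * b ^ nat \<bar>s\<bar> * C) * sqrt q ^ nat \<bar>x\<bar>" .
  qed
  then show ?thesis by (rule abs_summable_summable)
qed

lemma has_sum_diff:
  fixes f g :: "'b \<Rightarrow> complex"
  assumes "(f has_sum a) A" "(g has_sum b) A"
  shows "((\<lambda>x. f x - g x) has_sum (a - b)) A"
  using has_sum_add[OF assms(1), of "\<lambda>x. - g x" "- b"] assms(2) by (simp add: has_sum_uminus)

lemma coef_divided_difference: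
  assumes "g1 analytic_on annulus \<rho> \<rho>'" "0 < \<rho>" "\<rho> \<le> \<rho>'"
  shows "coef \<rho> (\<lambda>w. c + (1 - w) * g1 w) x
    = (if x = 0 then c else 0) + (coef \<rho> g1 x - coef \<rho> g1 (x - 1))"
proof -
  have cont: "continuous_on (sphere 0 \<rho>) g1" "continuous_on (sphere 0 \<rho>) (\<lambda>w::complex. w powi m)" for m
    using assms by (auto intro!: continuous_on_sphere_annulus continuous_on_sphere_powi)
  have "coef \<rho> (\<lambda>w. c + (1 - w) * g1 w) x
      = circ_integral \<rho> (\<lambda>w. c * w powi (- x - 1) +
          (g1 w * w powi (- x - 1) - g1 w * w powi (- (x - 1) - 1)))"
    unfolding coef_def
  proof (rule circ_integral_cong[OF assms(2)])
    fix w :: complex assume "norm w = \<rho>"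
    then have "w \<noteq> 0" using assms by auto
    then have "w powi (- (x - 1) - 1) = w * w powi (- x - 1)"
      using power_int_add[of w 1 "- x - 1"] by simp
    then show "(c + (1 - w) * g1 w) * w powi (- x - 1) = c * w powi (- x - 1) +
          (g1 w * w powi (- x - 1) - g1 w * w powi (- (x - 1) - 1))"
      by (simp add: algebra_simps)
  qed
  also have "\<dots> = coef \<rho> (\<lambda>_. c) x + (coef \<rho> g1 x - coef \<rho> g1 (x - 1))"
    unfolding coef_def using assms(2) cont
    by (simp add: circ_integral_add circ_integral_diff continuous_on_mult continuous_on_diff
        continuous_on_const)
  finally show ?thesis using coef_const[OF assms(2)] by simp
qed

text \<open>
  Formally, \<open>\<Sum>_x coef \<rho> g x z^(x + s) = z^s g(z)\<close>, expanded at \<open>z = 1\<close>. The induction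
  replaces \<open>g\<close> by its divided difference at 1, which lowers \<open>j\<close> by one and avoids differentiating the
  Laurent series.
\<close>

lemma has_sum_fpsY_coef:
  assumes "g analytic_on annulus \<rho> \<rho>'" "0 < \<rho>" "\<rho> < 1" "1 < \<rho>'"
    and "(\<lambda>w. g (1 - w)) has_fps_expansion G"
  shows "((\<lambda>x. fps_nth (fpsY (x + s)) j * coef \<rho> g x) has_sum fps_nth (fpsY s * G) j) UNIV"
  using assms(1,5)
proof (induction j arbitrary: g G s rule: less_induct)
  case (less j g G s)
  obtain g1 where g1: "g1 analytic_on annulus \<rho> \<rho>'" "\<And>w. g w = g 1 + (1 - w) * g1 w"
    using divided_difference_at_1[OF less.prems(1)] by blast
  have "(\<lambda>w. g1 (1 - w)) analytic_on {0}"
  proof -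
    have "g1 analytic_on {1}" by (rule analytic_on_subset[OF g1(1)]) (use assms in \<open>auto simp: annulus_def\<close>)
    then show ?thesis
      by (intro analytic_on_compose_gen[of "\<lambda>w. 1 - w" "{0}" g1 "{1}", unfolded o_def] analytic_intros) auto
  qed
  then obtain G1 where G1: "(\<lambda>w. g1 (1 - w)) has_fps_expansion G1"
    using analytic_at_imp_has_fps_expansion_0 by blast
  have G: "G = fps_const (g 1) + fps_X * G1"
  proof (rule fps_ext)
    fix n
    have "(\<lambda>w. g 1 + w * g1 (1 - w)) has_fps_expansion (fps_const (g 1) + fps_X * G1)"
      by (intro fps_expansion_intros G1)
    moreover have "(\<lambda>w. g (1 - w)) = (\<lambda>w. g 1 + w * g1 (1 - w))"
    proof
      fix w show "g (1 - w) = g 1 + w * g1 (1 - w)" using g1(2)[of "1 - w"] by simp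
    qed
    ultimately show "fps_nth G n = fps_nth (fps_const (g 1) + fps_X * G1) n"
      using less.prems(2) fps_nth_fps_expansion by metis
  qed
  have coef: "coef \<rho> g x = (if x = 0 then g 1 else 0) + (coef \<rho> g1 x - coef \<rho> g1 (x - 1))" for x
  proof -
    have "coef \<rho> g x = coef \<rho> (\<lambda>w. g 1 + (1 - w) * g1 w) x"
      by (rule arg_cong[where f = "\<lambda>h. coef \<rho> h x"], rule ext, rule g1(2))
    then show ?thesis using coef_divided_difference[OF g1(1), of "g 1" x] assms by simp
  qed
  have sm: "(\<lambda>x. fps_nth (fpsY (x + s)) i * coef \<rho> g1 x) summable_on UNIV" for i s
    by (rule coef_fpsY_summable[OF g1(1)]) (use assms in auto)
  have 1: "((\<lambda>x. fps_nth (fpsY (x + s)) j * (if x = 0 then g 1 else 0)) has_sum fps_nth (fpsY s) j * g 1) UNIV"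
    by (rule has_sum_finite_neutralI[of "{0}"]) auto
  have 2: "((\<lambda>x. fps_nth (fpsY (x + s)) j * coef \<rho> g1 x) has_sum
      (\<Sum>\<^sub>\<infinity>x. fps_nth (fpsY (x + s)) j * coef \<rho> g1 x)) UNIV"
    by (rule has_sum_infsum[OF sm])
  have 3: "((\<lambda>x. fps_nth (fpsY (x + 1 + s)) j * coef \<rho> g1 x) has_sum
      (\<Sum>\<^sub>\<infinity>x. fps_nth (fpsY (x + 1 + s)) j * coef \<rho> g1 x)) UNIV"
    using has_sum_infsum[OF sm[of "1 + s" j]] by (simp add: add.assoc)
  have 4: "((\<lambda>x. fps_nth (fpsY (x + s)) j * coef \<rho> g1 (x - 1)) has_sum
      (\<Sum>\<^sub>\<infinity>x. fps_nth (fpsY (x + 1 + s)) j * coef \<rho> g1 x)) UNIV"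
    using 3 by (subst has_sum_reindex_bij_witness[where S = UNIV and i = "\<lambda>x. x + 1" and j = "\<lambda>x. x - 1"
          and h = "\<lambda>x. fps_nth (fpsY (x + 1 + s)) j * coef \<rho> g1 x"]) auto
  have 5: "((\<lambda>x. (fps_nth (fpsY (x + s)) j - fps_nth (fpsY (x + 1 + s)) j) * coef \<rho> g1 x) has_sum
      (\<Sum>\<^sub>\<infinity>x. fps_nth (fpsY (x + s)) j * coef \<rho> g1 x) - (\<Sum>\<^sub>\<infinity>x. fps_nth (fpsY (x + 1 + s)) j * coef \<rho> g1 x)) UNIV"
    using has_sum_diff[OF 2 3] by (simp add: algebra_simps)
  have 6: "((\<lambda>x. (fps_nth (fpsY (x + s)) j - fps_nth (fpsY (x + 1 + s)) j) * coef \<rho> g1 x) has_sum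
      fps_nth (fps_X * (fpsY s * G1)) j) UNIV"
  proof (cases j)
    case 0
    then show ?thesis by simp
  next
    case (Suc i)
    have "fps_nth (fpsY (x + s)) j - fps_nth (fpsY (x + 1 + s)) j = fps_nth (fpsY (x + s)) i" for x
      using fpsY_Suc_diff[of "x + s" i] by (simp add: Suc add_ac)
    then show ?thesis using less.IH[of i g1 G1 s] g1(1) G1 by (simp add: Suc)
  qed
  have "((\<lambda>x. fps_nth (fpsY (x + s)) j * coef \<rho> g x) has_sum
      fps_nth (fpsY s) j * g 1 + fps_nth (fps_X * (fpsY s * G1)) j) UNIV"
    using has_sum_add[OF 1 has_sum_diff[OF 2 4]] has_sum_unique[OF 5 6]
    by (simp add: coef algebra_simps)
  also have "fps_nth (fpsY s) j * g 1 + fps_nth (fps_X * (fpsY s * G1)) j = fps_nth (fpsY s * G) j"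
    by (simp add: G algebra_simps)
  finally show ?case .
qed

section \<open>The functions of the model in terms of Laurent coefficients\<close>

lemma coef_one_minus_mult:
  assumes "0 < s" "continuous_on (sphere 0 s) f"
  shows "coef s (\<lambda>w. (1 - w) * f w) x = coef s f x - coef s f (x - 1)"
proof -
  have "coef s (\<lambda>w. (1 - w) * f w) x
      = circ_integral s (\<lambda>w. f w * w powi (- x - 1) - f w * w powi (- (x - 1) - 1))"
    unfolding coef_def
  proof (rule circ_integral_cong[OF assms(1)])
    fix w :: complex assume "norm w = s"
    then have "w \<noteq> 0" using assms by auto
    then have "w powi (- (x - 1) - 1) = w * w powi (- x - 1)"
      using power_int_add[of w 1 "- x - 1"] by simp
    then show "(1 - w) * f w * w powi (- x - 1) = f w * w powi (- x - 1) - f w * w powi (- (x - 1) - 1)"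
      by (simp add: algebra_simps)
  qed
  also have "\<dots> = coef s f x - coef s f (x - 1)"
    unfolding coef_def using assms
    by (intro circ_integral_diff continuous_on_mult continuous_on_sphere_powi)
  finally show ?thesis .
qed

lemma coef_cong:
  "0 < s \<Longrightarrow> (\<And>w. norm w = s \<Longrightarrow> f w = g w) \<Longrightarrow> coef s f x = coef s g x"
  unfolding coef_def by (intro circ_integral_cong) auto

lemma coef_cmult:
  assumes "0 < s" "continuous_on (sphere 0 s) f"
  shows "coef s (\<lambda>w. c * f w) x = c * coef s f x"
  unfolding coef_def mult.assoc using assms
  by (intro circ_integral_cmult continuous_on_mult continuous_on_sphere_powi)

text \<open>
  The number of strictly decreasing integer paths with \<open>n\<close> steps and total descent \<open>d\<close>, so that
  \<open>Q^n(z1, z2) = \<alpha>^n \<theta>^(z1 - z2) qn n (z1 - z2)\<close>.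
\<close>

definition qn :: "nat \<Rightarrow> int \<Rightarrow> nat" where
  "qn n d = (if n = 0 then of_bool (d = 0) else if 1 \<le> d then nat (d - 1) choose (n - 1) else 0)"

lemma qn_0 [simp]: "qn 0 d = of_bool (d = 0)"
  by (simp add: qn_def)

lemma qn_1: "qn (Suc 0) d = of_bool (1 \<le> d)"
  by (simp add: qn_def)

lemma qn_eq_0: "d < int n \<Longrightarrow> qn n d = 0"
  by (auto simp: qn_def intro!: binomial_eq_0)

lemma qn_rec: "qn (Suc n) (d + 1) = qn (Suc n) d + qn n d"
proof (cases "1 \<le> d \<and> n \<noteq> 0")
  case True
  then obtain m k where "n = Suc m" "nat d = Suc k" "nat (d - 1) = k"
    by (metis Suc_nat_eq_nat_zadd1 add.commute diff_add_cancel not0_implies_Suc zero_le_one order_trans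
        diff_ge_0_iff_ge)
  then show ?thesis using True by (simp add: qn_def)
next
  case False
  then show ?thesis by (auto simp: qn_def)
qed

lemma qn_sum:
  assumes "lo \<le> 0" "lo \<le> d"
  shows "(\<Sum>e\<in>{lo..<d}. qn n e) = qn (Suc n) d"
  using assms(2)
proof (induction d rule: int_ge_induct)
  case base
  then show ?case using assms by (simp add: qn_eq_0)
next
  case (step d)
  then have "{lo..<d + 1} = insert d {lo..<d}" by auto
  then show ?case using step by (simp add: qn_rec)
qed

lemma fpsY_nth_gbinomial: "fps_nth (fpsY x) j = (of_nat j - of_int x - 1) gchoose j"
  using gbinomial_negated_upper[of "complex_of_int x" j]
  by (simp add: fpsY_def power_mult_distrib[symmetric])

text \<open>A polynomial of degree n - 1 in d, but only for d \<ge> 1: path counts are cut off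
  below, while the polynomial goes on. The link between the random walk and the contour integrals
  therefore rests on the walk being strictly above y when it hits.\<close>

lemma qn_eq_fpsY:
  assumes "1 \<le> d" "1 \<le> n"
  shows "of_nat (qn n d) = fps_nth (fpsY (int n - 1 - d)) (n - 1)"
proof -
  have "of_nat (n - 1) - complex_of_int (int n - 1 - d) - 1 = of_nat (nat (d - 1))"
    using assms by (simp add: of_nat_diff)
  then have "fps_nth (fpsY (int n - 1 - d)) (n - 1) = of_nat (nat (d - 1)) gchoose (n - 1)"
    unfolding fpsY_nth_gbinomial by simp
  then show ?thesis using assms by (simp add: qn_def binomial_gbinomial)
qed

text \<open>Compositions of d into n positive parts, read off the generating function (1 - w)^(-n);
  this is the form in which the contour integral of \<open>Q_pow\<close> produces them.\<close>

lemma qn_eq_fpsY':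
  assumes "int n \<le> d"
  shows "of_nat (qn n d) = fps_nth (fpsY (- int n)) (nat (d - int n))"
proof (cases "n = 0")
  case False
  have "of_nat (nat (d - int n)) - complex_of_int (- int n) - 1 = of_nat (nat (d - 1))"
    using assms False by (simp add: of_nat_diff)
  then have "fps_nth (fpsY (- int n)) (nat (d - int n)) = of_nat (nat (d - 1)) gchoose (nat (d - int n))"
    unfolding fpsY_nth_gbinomial by simp
  also have "\<dots> = of_nat (nat (d - 1) choose (nat (d - int n)))"
    by (simp only: binomial_gbinomial)
  also have "nat (d - 1) choose (nat (d - int n)) = nat (d - 1) choose (n - 1)"
  proof -
    have "nat (d - 1) - (n - 1) = nat (d - int n)" "n - 1 \<le> nat (d - 1)" using assms False by auto
    then show ?thesis using binomial_symmetric[of "n - 1" "nat (d - 1)"] by simp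
  qed
  finally show ?thesis using assms False by (simp add: qn_def)
qed (use assms in auto)

lemma circ_integral_qn:
  assumes "0 < r" "r < 1"
  shows "circ_integral r (\<lambda>w. w powi (int n - 1 - d) * (1 - w) powi (- int n)) = of_nat (qn n d)"
proof (cases "int n \<le> d")
  case True
  have "circ_integral r (\<lambda>w. w powi (int n - 1 - d) * (1 - w) powi (- int n))
      = circ_integral r (\<lambda>w. (1 - w) powi (- int n) / w ^ Suc (nat (d - int n)))"
  proof (rule circ_integral_cong[OF assms(1)])
    fix w :: complex assume "norm w = r"
    have "int n - 1 - d = - int (Suc (nat (d - int n)))" using True by simp
    then show "w powi (int n - 1 - d) * (1 - w) powi (- int n)
        = (1 - w) powi (- int n) / w ^ Suc (nat (d - int n))"
      by (simp only: power_int_minus power_int_of_nat divide_inverse mult.commute)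
  qed
  also have "\<dots> = fps_nth (fpsY (- int n)) (nat (d - int n))"
    using assms by (intro circ_integral_fps_nth fpsY_has_fps_expansion analytic_intros) auto
  finally show ?thesis using qn_eq_fpsY'[OF True] by simp
next
  case False
  have "circ_integral r (\<lambda>w. w powi (int n - 1 - d) * (1 - w) powi (- int n)) = 0"
  proof (rule circ_integral_analytic_eq_0[OF _ assms(1)])
    show "(\<lambda>w. w powi (int n - 1 - d) * (1 - w) powi (- int n)) analytic_on cball 0 r"
    proof (rule analytic_on_mult)
      have "(\<lambda>w::complex. w powi (int n - 1 - d)) = (\<lambda>w. w ^ nat (int n - 1 - d))"
        using False by (auto simp: power_int_def)
      then show "(\<lambda>w::complex. w powi (int n - 1 - d)) analytic_on cball 0 r"
        by (simp add: analytic_intros)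
      show "(\<lambda>w. (1 - w) powi (- int n)) analytic_on cball 0 r"
        using assms by (intro analytic_intros) auto
    qed
  qed
  then show ?thesis using False by (simp add: qn_eq_0)
qed

lemma fpsY_nth_bound_shift:
  assumes "1 < (b :: real)"
  obtains C where "0 \<le> C" "\<And>x. norm (fps_nth (fpsY (x + s)) j) \<le> C * b ^ nat \<bar>x\<bar>"
proof -
  obtain D where D: "0 \<le> D" "\<And>x. norm (fps_nth (fpsY x) j) \<le> D * b ^ nat \<bar>x\<bar>"
    using fpsY_nth_bound[OF assms] by blast
  show thesis
  proof (rule that[of "D * b ^ nat \<bar>s\<bar>"])
    fix x
    have "b ^ nat \<bar>x + s\<bar> \<le> b ^ (nat \<bar>s\<bar> + nat \<bar>x\<bar>)"
      using assms by (intro power_increasing) auto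
    then have "norm (fps_nth (fpsY (x + s)) j) \<le> D * b ^ (nat \<bar>s\<bar> + nat \<bar>x\<bar>)"
      using D(2)[of "x + s"] D(1) mult_left_mono order_trans by blast
    then show "norm (fps_nth (fpsY (x + s)) j) \<le> D * b ^ nat \<bar>s\<bar> * b ^ nat \<bar>x\<bar>"
      by (simp add: power_add mult.assoc)
  qed (use D assms in auto)
qed

text \<open>Path counts vanish for d < 0 and grow polynomially, so a one-sided exponential with any
  rate \<kappa> < 1 bounds them on all integers.\<close>

lemma qn_bound:
  assumes "0 < \<kappa>" "(\<kappa>::real) < 1"
  obtains C where "0 \<le> C" "\<And>d. real (qn n d) \<le> C * \<kappa> powi (- d)"
proof (cases "n = 0")
  case True
  show thesis
    by (rule that[of 1]) (use True assms in \<open>auto simp: zero_le_power_int\<close>)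
next
  case False
  have b: "1 < 1 / \<kappa>" using assms by simp
  obtain C where C: "0 \<le> C" "\<And>x. norm (fps_nth (fpsY (x + (int n - 1))) (n - 1)) \<le> C * (1 / \<kappa>) ^ nat \<bar>x\<bar>"
    using fpsY_nth_bound_shift[OF b] by blast
  show thesis
  proof (rule that[OF C(1)])
    fix d
    show "real (qn n d) \<le> C * \<kappa> powi (- d)"
    proof (cases "1 \<le> d")
      case True
      have "real (qn n d) = norm (complex_of_nat (qn n d))" by simp
      also have "\<dots> \<le> C * (1 / \<kappa>) ^ nat d"
        using C(2)[of "- d"] True False by (subst qn_eq_fpsY) (auto simp: algebra_simps)
      also have "(1 / \<kappa>) ^ nat d = \<kappa> powi (- d)"
        using True by (simp add: power_int_def power_one_over inverse_eq_divide)
      finally show ?thesis .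
    next
      case d: False
      then show ?thesis using False C assms by (simp add: qn_eq_0)
    qed
  qed
qed

text \<open>
  A polynomial in \<open>x\<close> of degree \<open>n - k\<close>. For fixed \<open>n\<close> these span the second argument of the
  kernels \<open>Sbar\<close> at level \<open>n\<close>, and the backward difference takes level \<open>n + 1\<close> to level \<open>n\<close>.
\<close>

definition Ek :: "nat \<Rightarrow> nat \<Rightarrow> int \<Rightarrow> complex" where
  "Ek n k x = (if k \<le> n then fps_nth (fpsY (x + (int n - 1))) (n - k) else 0)"

lemma Ek_eq_0: "n < k \<Longrightarrow> Ek n k x = 0"
  by (simp add: Ek_def)

lemma Ek_diag [simp]: "Ek n n x = 1"
  by (simp add: Ek_def)

lemma Ek_rec: "Ek (Suc n) k (x - 1) - Ek (Suc n) k x = Ek n k x"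
proof (cases "k \<le> n")
  case True
  then show ?thesis
    using fpsY_Suc_diff[of "x + (int n - 1)" "n - k"] by (simp add: Ek_def Suc_diff_le algebra_simps)
next
  case False
  then show ?thesis by (cases "k = Suc n") (auto simp: Ek_def)
qed

lemma Ek_bound:
  assumes "1 < (b :: real)"
  obtains C where "0 \<le> C" "\<And>x. norm (Ek n k x) \<le> C * b ^ nat \<bar>x\<bar>"
proof -
  obtain C where C: "0 \<le> C" "\<And>x. norm (fps_nth (fpsY (x + (int n - 1))) (n - k)) \<le> C * b ^ nat \<bar>x\<bar>"
    using fpsY_nth_bound_shift[OF assms] by blast
  show thesis
    by (rule that[OF C(1)]) (use C assms in \<open>auto simp: Ek_def\<close>)
qed

lemma power_int_add_eq:
  "a \<noteq> 0 \<Longrightarrow> m = i + j \<Longrightarrow> (a :: 'a :: field) powi m = a powi i * a powi j"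
  by (simp add: power_int_add)

text \<open>
  The function \<open>g\<close> stands for \<open>\<phi>^t\<close>. Up to elementary factors \<open>hs n\<close> is the integral in
  \<open>S_(-t,-n)\<close>, and \<open>Fr n\<close> is \<open>F_n\<close>; their circles lie on different sides of the pole at 1, which
  is absent from \<open>F_n\<close> for \<open>n \<le> 0\<close>.
\<close>

locale gen_fun =
  fixes \<rho> \<rho>' :: real and g :: "complex \<Rightarrow> complex"
  assumes radii: "0 < \<rho>" "\<rho> < 1" "1 < \<rho>'"
    and g_analytic: "g analytic_on annulus \<rho> \<rho>'"
    and g_at_1: "g 1 = 1"
begin

definition hs :: "int \<Rightarrow> int \<Rightarrow> complex" where
  "hs j d = coef \<rho> (\<lambda>w. (1 - w) powi j * g w) (d + j)"

definition Fr :: "int \<Rightarrow> int \<Rightarrow> complex" where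
  "Fr n x = coef \<rho>' (\<lambda>w. (w - 1) powi (- n) * g w) (x - n)"

lemma continuous_hs:
  assumes "\<rho> \<le> s" "s \<le> \<rho>'" "s \<noteq> 1"
  shows "continuous_on (sphere 0 s) (\<lambda>w. (1 - w) powi j * g w)"
    "continuous_on (sphere 0 s) (\<lambda>w. (w - 1) powi j * g w)"
proof -
  have g: "continuous_on (sphere 0 s) g"
    using continuous_on_sphere_annulus[OF g_analytic] assms by simp
  have "norm (1::complex) = 1" by simp
  then have ne: "w \<noteq> 1" if "w \<in> sphere 0 s" for w :: complex using that assms(3) by auto
  show "continuous_on (sphere 0 s) (\<lambda>w. (1 - w) powi j * g w)"
    using ne by (intro continuous_on_mult g continuous_on_power_int continuous_intros) auto
  show "continuous_on (sphere 0 s) (\<lambda>w. (w - 1) powi j * g w)"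
    using ne by (intro continuous_on_mult g continuous_on_power_int continuous_intros) auto
qed

lemma hs_rec: "hs j d = hs (j - 1) (d + 1) - hs (j - 1) d"
proof -
  have "hs j d = coef \<rho> (\<lambda>w. (1 - w) * ((1 - w) powi (j - 1) * g w)) (d + j)"
    unfolding hs_def
  proof (rule coef_cong[OF radii(1)])
    fix w :: complex assume "norm w = \<rho>"
    then have "1 - w \<noteq> 0" using radii by auto
    then show "(1 - w) powi j * g w = (1 - w) * ((1 - w) powi (j - 1) * g w)"
      using power_int_add[of "1 - w" 1 "j - 1"] by simp
  qed
  then show ?thesis
    using coef_one_minus_mult[OF radii(1) continuous_hs(1)[of \<rho> "j - 1"], of "d + j"] radii
    by (simp add: hs_def algebra_simps)
qed

lemma hs_bound: obtains C where "0 \<le> C" "\<And>d. norm (hs j d) \<le> C * \<rho> powi (- d)"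
proof -
  obtain C where C: "0 \<le> C" "\<And>x. norm (coef \<rho> (\<lambda>w. (1 - w) powi j * g w) x) \<le> C * \<rho> powi (- x)"
    using coef_bounded[OF radii(1) continuous_hs(1)[of \<rho> j]] radii by auto
  show thesis
  proof (rule that[of "C * \<rho> powi (- j)"])
    fix d
    have "\<rho> powi (- (d + j)) = \<rho> powi (- j) * \<rho> powi (- d)"
      using radii by (intro power_int_add_eq) auto
    then show "norm (hs j d) \<le> C * \<rho> powi (- j) * \<rho> powi (- d)"
      using C(2)[of "d + j"] by (simp only: hs_def mult.assoc)
  qed (use C radii in \<open>auto intro!: mult_nonneg_nonneg\<close>)
qed

lemma Fr_rec: "Fr n x - Fr n (x + 1) = Fr (n - 1) x"
proof -
  have "Fr (n - 1) x = coef \<rho>' (\<lambda>w. (1 - w) * (- 1 * ((w - 1) powi (- n) * g w))) (x - n + 1)"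
    unfolding Fr_def
  proof (subst coef_cong[where f = "\<lambda>w. (w - 1) powi - (n - 1) * g w"])
    fix w :: complex assume "norm w = \<rho>'"
    then have "w - 1 \<noteq> 0" using radii by auto
    then have eq: "(w - 1) powi (- (n - 1)) = (w - 1) * (w - 1) powi (- n)"
      using power_int_add[of "w - 1" 1 "- n"] by simp
    show "(w - 1) powi (- (n - 1)) * g w = (1 - w) * (- 1 * ((w - 1) powi (- n) * g w))"
      unfolding eq by (simp add: algebra_simps)
  qed (use radii in \<open>auto simp: algebra_simps\<close>)
  also have "\<dots> = coef \<rho>' (\<lambda>w. - 1 * ((w - 1) powi (- n) * g w)) (x - n + 1)
      - coef \<rho>' (\<lambda>w. - 1 * ((w - 1) powi (- n) * g w)) (x - n)"
    using coef_one_minus_mult[of \<rho>' "\<lambda>w. - 1 * ((w - 1) powi (- n) * g w)" "x - n + 1"]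
      continuous_hs(2)[of \<rho>' "- n"] radii
    by (simp add: continuous_on_minus)
  also have "\<dots> = Fr n x - Fr n (x + 1)"
    using coef_cmult[OF _ continuous_hs(2)[of \<rho>' "- n"], of "- 1"] radii
    by (simp add: Fr_def algebra_simps)
  finally show ?thesis ..
qed

lemma Fr_bound: obtains C where "0 \<le> C" "\<And>x. norm (Fr n x) \<le> C * \<rho>' powi (- x)"
proof -
  obtain C where C: "0 \<le> C" "\<And>x. norm (coef \<rho>' (\<lambda>w. (w - 1) powi (- n) * g w) x) \<le> C * \<rho>' powi (- x)"
    using coef_bounded[OF _ continuous_hs(2)[of \<rho>' "- n"]] radii by auto
  show thesis
  proof (rule that[of "C * \<rho>' powi n"])
    fix x
    have "\<rho>' powi (- (x - n)) = \<rho>' powi n * \<rho>' powi (- x)"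
      using radii by (intro power_int_add_eq) auto
    then show "norm (Fr n x) \<le> C * \<rho>' powi n * \<rho>' powi (- x)"
      using C(2)[of "x - n"] by (simp only: Fr_def mult.assoc)
  qed (use C radii in \<open>auto intro!: mult_nonneg_nonneg\<close>)
qed

text \<open>Since (w - 1)^j has no pole at 1, the circle can be moved from \<rho>' across 1 to
  \<rho>. For these indices the functions of the chain and of the kernel agree up to sign;
  \<open>Fr\<close> with larger index continues the family by summation.\<close>

lemma Fr_nonpos: "Fr (- int j) x = (- 1) ^ j * hs (int j) x"
proof -
  let ?f = "\<lambda>w. (1 - w) ^ j * g w"
  have f: "?f analytic_on annulus \<rho> \<rho>'"
    by (intro analytic_intros g_analytic)
  have "Fr (- int j) x = coef \<rho>' (\<lambda>w. (- 1) ^ j * ?f w) (x + int j)"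
    unfolding Fr_def
  proof (subst coef_cong[where f = "\<lambda>w. (w - 1) powi - (- int j) * g w"])
    fix w :: complex
    have "(w - 1) ^ j = (- 1) ^ j * (1 - w) ^ j"
      unfolding power_mult_distrib[symmetric] by simp
    then show "(w - 1) powi - (- int j) * g w = (- 1) ^ j * ?f w" by simp
  qed (use radii in auto)
  also have "\<dots> = (- 1) ^ j * coef \<rho>' ?f (x + int j)"
    using f radii by (intro coef_cmult continuous_on_sphere_annulus) auto
  also have "coef \<rho>' ?f (x + int j) = coef \<rho> ?f (x + int j)"
    by (rule coef_radius[OF f, symmetric]) (use radii in auto)
  also have "\<dots> = hs (int j) x" by (simp add: hs_def)
  finally show ?thesis .
qed

lemma powi_LIMSEQ_0:
  assumes "0 < q" "q < (1::real)"
  shows "(\<lambda>R. C * q powi (c + int R)) \<longlonglongrightarrow> 0"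
proof -
  have "(\<lambda>R. C * (q powi c * q ^ R)) \<longlonglongrightarrow> C * (q powi c * 0)"
    using assms by (intro tendsto_mult tendsto_const LIMSEQ_realpow_zero) auto
  then show ?thesis using assms by (simp add: power_int_add)
qed

lemma Fr_at_top: "(\<lambda>R. Fr n (c + int R)) \<longlonglongrightarrow> 0"
proof -
  obtain C where C: "\<And>x. norm (Fr n x) \<le> C * \<rho>' powi (- x)" using Fr_bound by blast
  have "(\<lambda>R. C * (1 / \<rho>') powi (c + int R)) \<longlonglongrightarrow> 0"
    using radii by (intro powi_LIMSEQ_0) auto
  then show ?thesis
    by (rule Lim_null_comparison[rotated])
       (use C in \<open>auto simp: power_int_minus power_int_one_over inverse_eq_divide power_int_divide_distrib\<close>)
qed

lemma hs_at_bot: "(\<lambda>R. hs j (c - int R)) \<longlonglongrightarrow> 0"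
proof -
  obtain C where C: "\<And>x. norm (hs j x) \<le> C * \<rho> powi (- x)" using hs_bound by blast
  have "(\<lambda>R. C * \<rho> powi (- c + int R)) \<longlonglongrightarrow> 0"
    using radii by (intro powi_LIMSEQ_0) auto
  then show ?thesis
  proof (rule Lim_null_comparison[rotated], intro always_eventually allI)
    show "norm (hs j (c - int R)) \<le> C * \<rho> powi (- c + int R)" for R
      using C[of "c - int R"] by (simp add: algebra_simps)
  qed
qed

text \<open>Writing g = 1 + (1 - w) f separates the pole at 1. For x \<le> 0 the pole contributes
  the Cauchy integral of w^(-x) at 1, which is 1, and the remainder is a Laurent coefficient of an
  analytic function.\<close>

lemma Fr_1_nonpos:
  obtains f where "f analytic_on annulus \<rho> \<rho>'" "\<And>x. x \<le> 0 \<Longrightarrow> Fr 1 x = 1 - coef \<rho>' f (x - 1)"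
proof -
  obtain g1 where g1: "g1 analytic_on annulus \<rho> \<rho>'" "\<And>w. g w = g 1 + (1 - w) * g1 w"
    using divided_difference_at_1[OF g_analytic] by blast
  have cont: "continuous_on (sphere 0 \<rho>') g1"
    using continuous_on_sphere_annulus[OF g1(1)] radii by simp
  have "Fr 1 x = 1 - coef \<rho>' g1 (x - 1)" if "x \<le> 0" for x
  proof -
    have cont2: "continuous_on (sphere 0 \<rho>') (\<lambda>w::complex. w ^ nat (- x) / (w - 1))"
      using radii by (intro continuous_intros) auto
    have "Fr 1 x = circ_integral \<rho>' (\<lambda>w. w ^ nat (- x) / (w - 1) - g1 w * w powi (- (x - 1) - 1))"
      unfolding Fr_def coef_def
    proof (rule circ_integral_cong)
      fix w :: complex assume "norm w = \<rho>'"
      then have "w - 1 \<noteq> 0" using radii by auto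
      moreover have "w powi (- (x - 1) - 1) = w ^ nat (- x)" using that by (simp add: power_int_def)
      ultimately show "(w - 1) powi - 1 * g w * w powi (- (x - 1) - 1)
          = w ^ nat (- x) / (w - 1) - g1 w * w powi (- (x - 1) - 1)"
        unfolding g1(2)[of w] g_at_1 by (simp add: power_int_minus field_simps)
    qed (use radii in simp)
    also have "\<dots> = circ_integral \<rho>' (\<lambda>w. w ^ nat (- x) / (w - 1)) - coef \<rho>' g1 (x - 1)"
      unfolding coef_def using radii cont cont2
      by (intro circ_integral_diff continuous_on_mult continuous_on_sphere_powi) auto
    also have "circ_integral \<rho>' (\<lambda>w. w ^ nat (- x) / (w - 1)) = 1"
    proof -
      have "norm ((1::complex) - 0) < \<rho>'" using radii by simp
      then have "((\<lambda>w. w ^ nat (- x) / (w - 1)) has_contour_integral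
          (2 * of_real pi * \<i> * 1 ^ nat (- x))) (circlepath 0 \<rho>')"
        by (intro Cauchy_integral_circlepath_simple holomorphic_intros)
      then show ?thesis by (simp add: circ_integral_def contour_integral_unique)
    qed
    finally show ?thesis .
  qed
  then show thesis using that g1(1) by blast
qed

text \<open>Moving the lowest summation end of a particle to -\<infinity> turns its row of the
  transition determinant into a unit row; the indices j - N of that telescoped row are at most
  1.\<close>

lemma Fr_at_bot:
  assumes "n \<le> 1"
  shows "(\<lambda>R. Fr n (c - int R)) \<longlonglongrightarrow> of_bool (n = 1)"
proof (cases "n = 1")
  case False
  define j where "j = nat (- n)"
  have n: "n = - int j" using assms False by (simp add: j_def)
  have "(\<lambda>R. (- 1) ^ j * hs (int j) (c - int R)) \<longlonglongrightarrow> (- 1) ^ j * 0"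
    by (intro tendsto_mult tendsto_const hs_at_bot)
  then show ?thesis unfolding n by (simp add: Fr_nonpos)
next
  case True
  obtain f where f: "f analytic_on annulus \<rho> \<rho>'" "\<And>x. x \<le> 0 \<Longrightarrow> Fr 1 x = 1 - coef \<rho>' f (x - 1)"
    using Fr_1_nonpos by blast
  have "continuous_on (sphere 0 \<rho>) f" using continuous_on_sphere_annulus[OF f(1)] radii by simp
  then obtain C where "0 \<le> C" and C: "\<And>x. norm (coef \<rho> f x) \<le> C * \<rho> powi (- x)"
    using coef_bounded[OF radii(1)] by blast
  have eq: "coef \<rho>' f x = coef \<rho> f x" for x
    by (rule coef_radius[OF f(1), symmetric]) (use radii in auto)
  have "(\<lambda>R. coef \<rho> f (c - int R - 1)) \<longlonglongrightarrow> 0"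
  proof (rule Lim_null_comparison)
    show "(\<lambda>R. C * \<rho> powi (1 - c + int R)) \<longlonglongrightarrow> 0"
      using radii by (intro powi_LIMSEQ_0) auto
    have "norm (coef \<rho> f (c - int R - 1)) \<le> C * \<rho> powi (1 - c + int R)" for R
      using C[of "c - int R - 1"] by (simp add: algebra_simps)
    then show "\<forall>\<^sub>F R in sequentially. norm (coef \<rho> f (c - int R - 1)) \<le> C * \<rho> powi (1 - c + int R)"
      by simp
  qed
  then have "(\<lambda>R. 1 - coef \<rho> f (c - int R - 1)) \<longlonglongrightarrow> 1 - 0"
    by (intro tendsto_diff tendsto_const)
  moreover have "\<forall>\<^sub>F R in sequentially. 1 - coef \<rho> f (c - int R - 1) = Fr 1 (c - int R)"
  proof (rule eventually_sequentiallyI[of "nat c"])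
    fix R assume "nat c \<le> R"
    then show "1 - coef \<rho> f (c - int R - 1) = Fr 1 (c - int R)"
      using f(2)[of "c - int R"] eq by simp
  qed
  ultimately show ?thesis using True by (simp add: tendsto_cong)
qed

lemma circ_integral_eq_hs:
  assumes "r \<in> {\<rho><..<1}"
  shows "circ_integral r (\<lambda>w. (1 - w) ^ n / w powi (d + int n + 1) * g w) = hs (int n) d"
proof -
  let ?f = "\<lambda>w. (1 - w) ^ n * g w"
  have f: "?f analytic_on annulus \<rho> \<rho>'"
    by (intro analytic_intros g_analytic)
  have "circ_integral r (\<lambda>w. (1 - w) ^ n / w powi (d + int n + 1) * g w) = coef r ?f (d + int n)"
    unfolding coef_def
  proof (rule circ_integral_cong)
    fix w
    have "- (d + int n) - 1 = - (d + int n + 1)" by simp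
    then show "(1 - w) ^ n / w powi (d + int n + 1) * g w = ?f w * w powi (- (d + int n) - 1)"
      by (simp only: power_int_minus divide_inverse) (simp add: mult_ac)
  qed (use assms radii in auto)
  also have "\<dots> = coef \<rho> ?f (d + int n)"
    by (rule coef_radius[OF f, symmetric]) (use assms radii in auto)
  finally show ?thesis by (simp add: hs_def)
qed

text \<open>The expansion at 1 is applied to (1 - w)^(N - l) g. With Laurent index x - y + N - l,
  the exponent x + N - 1 in \<open>Ek\<close> leaves y + l - 1, which becomes the power series
  \<open>fpsY (y + int l - 1)\<close> in the result.\<close>

lemma has_sum_Ek_hs:
  assumes G: "(\<lambda>w. g (1 - w)) has_fps_expansion G" and "l \<le> N" "k \<le> N"
  shows "((\<lambda>x. Ek N k x * hs (int (N - l)) (x - y)) has_sum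
     fps_nth (fpsY (y + int l - 1) * (fps_X ^ (N - l) * G)) (N - k)) UNIV"
proof -
  let ?f = "\<lambda>w. (1 - w) ^ (N - l) * g w"
  have f: "?f analytic_on annulus \<rho> \<rho>'"
    by (intro analytic_intros g_analytic)
  have fX: "(\<lambda>w. ?f (1 - w)) has_fps_expansion (fps_X ^ (N - l) * G)"
    using has_fps_expansion_mult[OF has_fps_expansion_fps_X_power G] by simp
  have "((\<lambda>x. fps_nth (fpsY (x + (y + int l - 1))) (N - k) * coef \<rho> ?f x) has_sum
      fps_nth (fpsY (y + int l - 1) * (fps_X ^ (N - l) * G)) (N - k)) UNIV"
    by (rule has_sum_fpsY_coef[OF f radii fX])
  then have "((\<lambda>x. fps_nth (fpsY (x - (y - int (N - l)) + (y + int l - 1))) (N - k)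
      * coef \<rho> ?f (x - (y - int (N - l)))) has_sum
      fps_nth (fpsY (y + int l - 1) * (fps_X ^ (N - l) * G)) (N - k)) UNIV"
    by (subst has_sum_reindex_bij_witness[where S = UNIV and i = "\<lambda>x. x + (y - int (N - l))"
          and j = "\<lambda>x. x - (y - int (N - l))"
          and h = "\<lambda>x. fps_nth (fpsY (x + (y + int l - 1))) (N - k) * coef \<rho> ?f x"]) auto
  moreover have "x - (y - int (N - l)) + (y + int l - 1) = x + (int N - 1)"
      "x - (y - int (N - l)) = x - y + int (N - l)" for x
    using assms(2) by auto
  ultimately show ?thesis
    using assms(3) by (simp only: Ek_def hs_def power_int_of_nat if_True)
qed

end

section \<open>One-sided distribution functions\<close>

lemma Omega_iff: "x \<in> \<Omega> N \<longleftrightarrow> x \<in> extensional {1..N} \<and> (\<forall>i\<in>{1..N}. \<forall>j\<in>{1..N}. i < j \<longrightarrow> x j < x i)"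
  by (auto simp: \<Omega>_def monotone_on_def PiE_iff)

lemma restrict_Omega: "x \<in> \<Omega> N \<Longrightarrow> restrict x {1..N} = x"
  by (simp only: Omega_iff extensional_restrict)

lemma restrict_in_Omega: "x \<in> \<Omega> N \<Longrightarrow> i \<le> N \<Longrightarrow> restrict x {1..i} \<in> \<Omega> i"
  by (auto simp: Omega_iff)

lemma Omega_Suc_upd:
  assumes "z \<in> \<Omega> i" "1 \<le> i \<Longrightarrow> v < z i"
  shows "z(Suc i := v) \<in> \<Omega> (Suc i)"
  unfolding Omega_iff
proof (intro conjI ballI impI)
  show "z(Suc i := v) \<in> extensional {1..Suc i}"
    using assms(1) by (auto simp: Omega_iff extensional_def)
  fix k j assume kj: "k \<in> {1..Suc i}" "j \<in> {1..Suc i}" "k < j"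
  have "z i \<le> z k" if "k \<le> i" "1 \<le> k"
    using assms(1) that by (cases "k = i") (auto simp: Omega_iff less_imp_le)
  then show "(z(Suc i := v)) j < (z(Suc i := v)) k"
    using assms kj by (cases "j = Suc i") (auto simp: Omega_iff)
qed

lemma restrict_Suc_eq_iff:
  assumes "z \<in> \<Omega> i"
  shows "restrict x {1..Suc i} = z(Suc i := v) \<longleftrightarrow> restrict x {1..i} = z \<and> x (Suc i) = v"
proof
  assume eq: "restrict x {1..Suc i} = z(Suc i := v)"
  have "restrict x {1..i} k = z k" for k
    using fun_cong[OF eq, of k] assms by (auto simp: Omega_iff extensional_def restrict_def split: if_splits)
  then show "restrict x {1..i} = z \<and> x (Suc i) = v" using fun_cong[OF eq, of "Suc i"] by auto
next
  assume "restrict x {1..i} = z \<and> x (Suc i) = v"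
  then show "restrict x {1..Suc i} = z(Suc i := v)" by (auto simp: restrict_def)
qed

lemma measure_pmf_cong_set:
  assumes "\<And>x. x \<in> set_pmf D \<Longrightarrow> x \<in> A \<longleftrightarrow> x \<in> B"
  shows "measure_pmf.prob D A = measure_pmf.prob D B"
proof -
  have "A \<inter> set_pmf D = B \<inter> set_pmf D" using assms by auto
  then show ?thesis using measure_Int_set_pmf[of D A] measure_Int_set_pmf[of D B] by simp
qed

lemma measure_pmf_partition:
  assumes "finite V" "\<And>x. x \<in> set_pmf D \<Longrightarrow> x \<in> A \<Longrightarrow> h x \<in> V"
  shows "measure_pmf.prob D A = (\<Sum>v\<in>V. measure_pmf.prob D {x \<in> A. h x = v})"
proof -
  have "measure_pmf.prob D A = measure_pmf.prob D (\<Union>v\<in>V. {x \<in> A. h x = v})"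
    using assms(2) by (intro measure_pmf_cong_set) auto
  also have "\<dots> = (\<Sum>v\<in>V. measure_pmf.prob D {x \<in> A. h x = v})"
    using assms(1) by (intro measure_pmf.finite_measure_finite_Union) (auto simp: disjoint_family_on_def)
  finally show ?thesis .
qed

section \<open>Summing the transition determinant over particles\<close>

context gen_fun
begin

lemma Fr_sum:
  assumes "lo \<le> hi"
  shows "(\<Sum>v\<in>{lo..<hi}. Fr n (v - c)) = Fr (n + 1) (lo - c) - Fr (n + 1) (hi - c)"
  using assms
proof (induction hi rule: int_ge_induct)
  case (step hi)
  have "{lo..<hi + 1} = insert hi {lo..<hi}" using step by auto
  then show ?case using step Fr_rec[of "n + 1" "hi - c"] by (simp add: algebra_simps)
qed simp

definition trans_dset :: "nat \<Rightarrow> (nat \<Rightarrow> int) \<Rightarrow> (nat \<Rightarrow> int) \<Rightarrow> complex" where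
  "trans_dset N y x = dset (\<lambda>i j. Fr (int j - int i) (x i - y j)) {1..N}"

lemma dset_sum_row:
  assumes "lo \<le> hi" "1 \<le> i" "i < N"
    and prev: "\<And>j. f i j = Fr (int j - int i) (hi - y j)"
  shows "(\<Sum>v\<in>{lo..<hi}. dset (f(Suc i := (\<lambda>j. Fr (int j - int (Suc i)) (v - y j)))) {1..N})
    = dset (f(Suc i := (\<lambda>j. Fr (int j - int i) (lo - y j)))) {1..N}"
proof -
  have "(\<Sum>v\<in>{lo..<hi}. dset (f(Suc i := (\<lambda>j. Fr (int j - int (Suc i)) (v - y j)))) {1..N})
    = dset (f(Suc i := (\<lambda>j. \<Sum>v\<in>{lo..<hi}. Fr (int j - int (Suc i)) (v - y j)))) {1..N}"
    using assms by (subst dset_row_sum) auto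
  also have "(\<lambda>j. \<Sum>v\<in>{lo..<hi}. Fr (int j - int (Suc i)) (v - y j))
      = (\<lambda>j. - 1 * f i j + Fr (int j - int i) (lo - y j))"
  proof
    fix j show "(\<Sum>v\<in>{lo..<hi}. Fr (int j - int (Suc i)) (v - y j)) = - 1 * f i j + Fr (int j - int i) (lo - y j)"
      using Fr_sum[OF assms(1), of "int j - int (Suc i)" "y j"] by (simp add: prev algebra_simps)
  qed
  also have "dset (f(Suc i := \<dots>)) {1..N} = dset (f(Suc i := (\<lambda>j. Fr (int j - int i) (lo - y j)))) {1..N}"
    using assms by (intro dset_row_add_other) auto
  finally show ?thesis .
qed

text \<open>The last coordinate is summed from z N - 1 downwards. The row of particle N + 1 keeps
  only the lower end of the telescoping sum, which tends to a unit row. Hence the first particles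
  form a system of the same kind, and N can be replaced by n_m.\<close>

lemma trans_marginal:
  assumes D: "set_pmf D \<subseteq> \<Omega> (Suc N)" "\<And>x. x \<in> \<Omega> (Suc N) \<Longrightarrow> of_real (pmf D x) = trans_dset (Suc N) y x"
    and "1 \<le> N"
  shows "set_pmf (map_pmf (\<lambda>x. restrict x {1..N}) D) \<subseteq> \<Omega> N"
    "\<And>z. z \<in> \<Omega> N \<Longrightarrow> of_real (pmf (map_pmf (\<lambda>x. restrict x {1..N}) D) z) = trans_dset N y z"
proof -
  show "set_pmf (map_pmf (\<lambda>x. restrict x {1..N}) D) \<subseteq> \<Omega> N"
    using D(1) restrict_in_Omega[of _ "Suc N" N] by auto
  fix z assume z: "z \<in> \<Omega> N"
  define A where "A R = {x. restrict x {1..N} = z \<and> z N - int R \<le> x (Suc N)}" for R :: nat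
  have "incseq A" by (auto simp: A_def incseq_def)
  then have "(\<lambda>R. measure_pmf.prob D (A R)) \<longlonglongrightarrow> measure_pmf.prob D (\<Union>R. A R)"
    by (intro measure_pmf.finite_Lim_measure_incseq) auto
  also have "(\<Union>R. A R) = (\<lambda>x. restrict x {1..N}) -` {z}"
  proof (intro equalityI subsetI)
    fix x assume "x \<in> (\<lambda>x. restrict x {1..N}) -` {z}"
    then have "x \<in> A (nat (z N - x (Suc N)))" by (auto simp: A_def)
    then show "x \<in> (\<Union>R. A R)" by blast
  qed (auto simp: A_def)
  finally have lim1: "(\<lambda>R. complex_of_real (measure_pmf.prob D (A R)))
      \<longlonglongrightarrow> of_real (pmf (map_pmf (\<lambda>x. restrict x {1..N}) D) z)"
    unfolding pmf_map by (rule tendsto_of_real)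
  define f where "f = (\<lambda>i j. Fr (int j - int i) (z i - y j))"
  have val: "complex_of_real (measure_pmf.prob D (A R))
      = dset (f(Suc N := (\<lambda>j. Fr (int j - int N) (z N - int R - y j)))) {1..Suc N}" for R
  proof -
    have lt: "x (Suc N) < x N" if "x \<in> set_pmf D" for x
      using that D(1) assms(3) by (auto simp: Omega_iff subset_iff)
    have "measure_pmf.prob D (A R) = (\<Sum>v\<in>{z N - int R..<z N}. measure_pmf.prob D {x \<in> A R. x (Suc N) = v})"
      using lt assms(3) by (intro measure_pmf_partition) (auto simp: A_def restrict_def)
    also have "\<dots> = (\<Sum>v\<in>{z N - int R..<z N}. pmf D (z(Suc N := v)))"
    proof (intro sum.cong refl)
      fix v assume v: "v \<in> {z N - int R..<z N}"
      have "measure_pmf.prob D {x \<in> A R. x (Suc N) = v} = measure_pmf.prob D {z(Suc N := v)}"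
      proof (rule measure_pmf_cong_set)
        fix x assume "x \<in> set_pmf D"
        then have "x \<in> \<Omega> (Suc N)" using D(1) by auto
        then have "restrict x {1..Suc N} = x" by (rule restrict_Omega)
        then show "x \<in> {x \<in> A R. x (Suc N) = v} \<longleftrightarrow> x \<in> {z(Suc N := v)}"
          using restrict_Suc_eq_iff[OF z, of x v] v by (auto simp: A_def)
      qed
      then show "measure_pmf.prob D {x \<in> A R. x (Suc N) = v} = pmf D (z(Suc N := v))"
        by (simp add: measure_pmf_single)
    qed
    finally have "complex_of_real (measure_pmf.prob D (A R))
        = (\<Sum>v\<in>{z N - int R..<z N}. trans_dset (Suc N) y (z(Suc N := v)))"
      using D(2) Omega_Suc_upd[OF z] by simp
    also have "\<dots> = (\<Sum>v\<in>{z N - int R..<z N}. dset (f(Suc N := (\<lambda>j. Fr (int j - int (Suc N)) (v - y j)))) {1..Suc N})"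
      unfolding trans_dset_def f_def by (intro sum.cong refl dset_cong) auto
    also have "\<dots> = dset (f(Suc N := (\<lambda>j. Fr (int j - int N) (z N - int R - y j)))) {1..Suc N}"
      using assms(3) by (intro dset_sum_row) (auto simp: f_def)
    finally show ?thesis .
  qed
  have lim2: "(\<lambda>R. complex_of_real (measure_pmf.prob D (A R)))
      \<longlonglongrightarrow> dset (f(Suc N := (\<lambda>j. of_bool (int j - int N = 1)))) {1..Suc N}"
    unfolding val
  proof (rule tendsto_dset)
    fix i j assume "i \<in> {1..Suc N}" "j \<in> {1..Suc N}"
    then show "(\<lambda>R. (f(Suc N := (\<lambda>j. Fr (int j - int N) (z N - int R - y j)))) i j)
        \<longlonglongrightarrow> (f(Suc N := (\<lambda>j. of_bool (int j - int N = 1)))) i j"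
      using Fr_at_bot[of "int j - int N" "z N - y j"] by (auto simp: algebra_simps)
  qed
  have "{1..Suc N} = insert (Suc N) {1..N}" by auto
  then have "dset (f(Suc N := (\<lambda>j. of_bool (int j - int N = 1)))) {1..Suc N}
      = dset (f(Suc N := (\<lambda>j. of_bool (int j - int N = 1)))) {1..N}"
    by (simp only:) (rule dset_insert_unit_row; auto)
  also have "\<dots> = trans_dset N y z"
    unfolding trans_dset_def f_def by (intro dset_cong) auto
  finally show "of_real (pmf (map_pmf (\<lambda>x. restrict x {1..N}) D) z) = trans_dset N y z"
    using LIMSEQ_unique[OF lim1 lim2] by simp
qed

lemma trans_marginal_le:
  assumes "set_pmf D \<subseteq> \<Omega> N" "\<And>x. x \<in> \<Omega> N \<Longrightarrow> of_real (pmf D x) = trans_dset N y x"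
    and "1 \<le> n" "n \<le> N"
  shows "\<exists>D'. set_pmf D' \<subseteq> \<Omega> n \<and> (\<forall>x\<in>\<Omega> n. of_real (pmf D' x) = trans_dset n y x)
    \<and> D' = map_pmf (\<lambda>x. restrict x {1..n}) D"
  using assms(4,1,2)
proof (induction N arbitrary: D rule: dec_induct)
  case base
  have "map_pmf (\<lambda>x. restrict x {1..n}) D = map_pmf id D"
  proof (rule map_pmf_cong[OF refl])
    fix x assume "x \<in> set_pmf D"
    then show "restrict x {1..n} = id x" using base(1) restrict_Omega[of x n] by auto
  qed
  then have eq: "map_pmf (\<lambda>x. restrict x {1..n}) D = D" by (simp only: pmf.map_id)
  show ?case unfolding eq using base by blast
next
  case (step N)
  have N: "1 \<le> N" using step(1) assms(3) by simp
  note marg = trans_marginal[OF step(4,5) N]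
  have eq: "map_pmf (\<lambda>x. restrict x {1..n}) (map_pmf (\<lambda>x. restrict x {1..N}) D)
      = map_pmf (\<lambda>x. restrict x {1..n}) D"
    using step(1) unfolding pmf.map_comp o_def
    by (intro map_pmf_cong refl) (auto simp: restrict_def fun_eq_iff)
  show ?case using step.IH[OF marg] unfolding eq .
qed

definition suffix_max :: "nat \<Rightarrow> (nat \<Rightarrow> int) \<Rightarrow> nat \<Rightarrow> int" where
  "suffix_max N a i = Max (a ` {i..N})"

lemma suffix_max_rec: "i < N \<Longrightarrow> suffix_max N a i = max (a i) (suffix_max N a (Suc i))"
proof -
  assume "i < N"
  then have "{i..N} = insert i {Suc i..N}" by auto
  moreover have "{Suc i..N} \<noteq> {}" using \<open>i < N\<close> by auto
  ultimately show ?thesis by (simp add: suffix_max_def)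
qed

lemma suffix_max_self [simp]: "suffix_max N a N = a N"
  by (simp add: suffix_max_def)

text \<open>Particles beyond i are summed out, those up to i are frozen at z. The next one to be
  summed lies above its own threshold and above the bound left by the particles below it, which
  turns thresholds into suffix maxima. The value 0 means that no room is left below z i.\<close>

lemma prob_partial:
  assumes D: "set_pmf D \<subseteq> \<Omega> N" "\<And>x. x \<in> \<Omega> N \<Longrightarrow> of_real (pmf D x) = trans_dset N y x"
    and "1 \<le> i" "i \<le> N" and z: "z \<in> \<Omega> i"
  shows "of_real (measure_pmf.prob D {x. restrict x {1..i} = z \<and> (\<forall>k\<in>{Suc i..N}. a k < x k)})
    = (if i = N \<or> suffix_max N a (Suc i) < z i
       then dset (\<lambda>k j. if k \<le> i then Fr (int j - int k) (z k - y j)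
              else Fr (int j - int k + 1) (suffix_max N a k + 1 - y j)) {1..N}
       else 0)"
  using assms(4,3) z
proof (induction i arbitrary: z rule: inc_induct)
  case base
  have "measure_pmf.prob D {x. restrict x {1..N} = z \<and> (\<forall>k\<in>{Suc N..N}. a k < x k)}
      = measure_pmf.prob D {z}"
  proof (rule measure_pmf_cong_set)
    fix x assume "x \<in> set_pmf D"
    then have "restrict x {1..N} = x" using D(1) by (intro restrict_Omega) auto
    then show "x \<in> {x. restrict x {1..N} = z \<and> (\<forall>k\<in>{Suc N..N}. a k < x k)} \<longleftrightarrow> x \<in> {z}" by auto
  qed
  then have "of_real (measure_pmf.prob D {x. restrict x {1..N} = z \<and> (\<forall>k\<in>{Suc N..N}. a k < x k)})
      = trans_dset N y z"
    using D(2)[OF base(2)] by (simp add: measure_pmf_single)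
  also have "\<dots> = dset (\<lambda>k j. if k \<le> N then Fr (int j - int k) (z k - y j)
              else Fr (int j - int k + 1) (suffix_max N a k + 1 - y j)) {1..N}"
    unfolding trans_dset_def by (intro dset_cong) auto
  finally show ?case by (simp only: simp_thms if_True)
next
  case (step i)
  let ?b = "suffix_max N a"
  define f where "f = (\<lambda>k j. if k \<le> i then Fr (int j - int k) (z k - y j)
              else Fr (int j - int k + 1) (?b k + 1 - y j))"
  let ?A = "{x. restrict x {1..i} = z \<and> (\<forall>k\<in>{Suc i..N}. a k < x k)}"
  have i: "i < N" "1 \<le> i" using step by auto
  have lt: "x (Suc i) < x i" if "x \<in> set_pmf D" for x
    using that D(1) i by (auto simp: Omega_iff subset_iff)
  have "measure_pmf.prob D ?A = (\<Sum>v\<in>{a (Suc i)<..<z i}. measure_pmf.prob D {x \<in> ?A. x (Suc i) = v})"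
    using lt i by (intro measure_pmf_partition) (auto simp: restrict_def)
  also have "\<dots> = (\<Sum>v\<in>{a (Suc i)<..<z i}. measure_pmf.prob D
      {x. restrict x {1..Suc i} = z(Suc i := v) \<and> (\<forall>k\<in>{Suc (Suc i)..N}. a k < x k)})"
  proof (intro sum.cong refl arg_cong[where f = "measure_pmf.prob D"] equalityI subsetI)
    fix v x assume v: "v \<in> {a (Suc i)<..<z i}"
    have *: "(\<forall>k\<in>{Suc i..N}. a k < x k) \<longleftrightarrow> a (Suc i) < x (Suc i) \<and> (\<forall>k\<in>{Suc (Suc i)..N}. a k < x k)"
      using i(1) by (auto simp: Suc_le_eq le_less)
    { assume "x \<in> {x \<in> ?A. x (Suc i) = v}"
      then show "x \<in> {x. restrict x {1..Suc i} = z(Suc i := v) \<and> (\<forall>k\<in>{Suc (Suc i)..N}. a k < x k)}"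
        unfolding mem_Collect_eq restrict_Suc_eq_iff[OF step.prems(2)] * by simp }
    { assume "x \<in> {x. restrict x {1..Suc i} = z(Suc i := v) \<and> (\<forall>k\<in>{Suc (Suc i)..N}. a k < x k)}"
      then show "x \<in> {x \<in> ?A. x (Suc i) = v}"
        using v unfolding mem_Collect_eq restrict_Suc_eq_iff[OF step.prems(2)] * by simp }
  qed
  finally have "complex_of_real (measure_pmf.prob D ?A) = (\<Sum>v\<in>{a (Suc i)<..<z i}.
      complex_of_real (measure_pmf.prob D
      {x. restrict x {1..Suc i} = z(Suc i := v) \<and> (\<forall>k\<in>{Suc (Suc i)..N}. a k < x k)}))"
    by (simp only: of_real_sum)
  also have "\<dots> = (\<Sum>v\<in>{a (Suc i)<..<z i}.
      if Suc i = N \<or> ?b (Suc (Suc i)) < v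
       then dset (\<lambda>k j. if k \<le> Suc i then Fr (int j - int k) ((z(Suc i := v)) k - y j)
              else Fr (int j - int k + 1) (?b k + 1 - y j)) {1..N}
       else 0)"
    by (rule sum.cong[OF refl], subst step.IH[OF _ Omega_Suc_upd[OF step.prems(2)]]) (auto simp: restrict_Omega)
  also have "\<dots> = (\<Sum>v\<in>{a (Suc i)<..<z i}. if ?b (Suc i) < v
       then dset (f(Suc i := (\<lambda>j. Fr (int j - int (Suc i)) (v - y j)))) {1..N} else 0)"
  proof (intro sum.cong refl if_cong)
    fix v assume "v \<in> {a (Suc i)<..<z i}"
    then show "(Suc i = N \<or> ?b (Suc (Suc i)) < v) = (?b (Suc i) < v)"
      using i suffix_max_rec[of "Suc i" N a] by (cases "Suc i = N") auto
    show "dset (\<lambda>k j. if k \<le> Suc i then Fr (int j - int k) ((z(Suc i := v)) k - y j)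
              else Fr (int j - int k + 1) (?b k + 1 - y j)) {1..N}
        = dset (f(Suc i := (\<lambda>j. Fr (int j - int (Suc i)) (v - y j)))) {1..N}"
      unfolding f_def by (intro dset_cong) auto
  qed
  also have "\<dots> = (\<Sum>v\<in>{?b (Suc i) + 1..<z i}. dset (f(Suc i := (\<lambda>j. Fr (int j - int (Suc i)) (v - y j)))) {1..N})"
  proof (rule sum.mono_neutral_cong_right)
    have "a (Suc i) \<le> ?b (Suc i)" using i suffix_max_rec[of "Suc i" N a] by (cases "Suc i = N") auto
    then show "{?b (Suc i) + 1..<z i} \<subseteq> {a (Suc i)<..<z i}" by auto
  qed auto
  also have "\<dots> = (if ?b (Suc i) < z i then dset (f(Suc i := (\<lambda>j. Fr (int j - int i) (?b (Suc i) + 1 - y j)))) {1..N} else 0)"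
  proof (cases "?b (Suc i) < z i")
    case True
    then show ?thesis
      using dset_sum_row[of "?b (Suc i) + 1" "z i" i N f y] i by (simp only: f_def if_True) simp
  qed simp
  also have "f(Suc i := (\<lambda>j. Fr (int j - int i) (?b (Suc i) + 1 - y j))) = f"
    by (auto simp: f_def fun_eq_iff)
  finally have *: "complex_of_real (measure_pmf.prob D ?A) = (if ?b (Suc i) < z i then dset f {1..N} else 0)" .
  have "(i = N \<or> ?b (Suc i) < z i) = (?b (Suc i) < z i)" using i by auto
  then show ?case unfolding * f_def by (simp only:)
qed

text \<open>The first particle has no neighbour above to cancel the upper end of its telescoping
  sum. That end vanishes because \<open>Fr\<close>, an integral over a circle of radius \<rho>' > 1,
  decays at +\<infinity>.\<close>

lemma prob_eq_dset:
  assumes D: "set_pmf D \<subseteq> \<Omega> N" "\<And>x. x \<in> \<Omega> N \<Longrightarrow> of_real (pmf D x) = trans_dset N y x"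
    and "1 \<le> N"
  shows "of_real (measure_pmf.prob D {x. \<forall>k\<in>{1..N}. a k < x k})
    = dset (\<lambda>k j. Fr (int j - int k + 1) (suffix_max N a k + 1 - y j)) {1..N}"
proof -
  let ?b = "suffix_max N a"
  define f where "f = (\<lambda>k j. Fr (int j - int k + 1) (?b k + 1 - y j))"
  define z where "z v = (\<lambda>_::nat. undefined)(1 := v)" for v :: int
  define A where "A R = {x. (\<forall>k\<in>{1..N}. a k < x k) \<and> x 1 \<le> ?b 1 + int R}" for R :: nat
  have ab: "a 1 \<le> ?b 1" using assms(3) suffix_max_rec[of 1 N a] by (cases "1 = N") auto
  have z: "z v \<in> \<Omega> 1" for v by (auto simp: z_def Omega_iff extensional_def)
  have "incseq A" by (auto simp: A_def incseq_def)
  then have "(\<lambda>R. measure_pmf.prob D (A R)) \<longlonglongrightarrow> measure_pmf.prob D (\<Union>R. A R)"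
    by (intro measure_pmf.finite_Lim_measure_incseq) auto
  also have "(\<Union>R. A R) = {x. \<forall>k\<in>{1..N}. a k < x k}"
  proof (intro equalityI subsetI)
    fix x assume "x \<in> {x. \<forall>k\<in>{1..N}. a k < x k}"
    then have "x \<in> A (nat (x 1 - ?b 1))" by (auto simp: A_def)
    then show "x \<in> (\<Union>R. A R)" by blast
  qed (auto simp: A_def)
  finally have lim1: "(\<lambda>R. complex_of_real (measure_pmf.prob D (A R)))
      \<longlonglongrightarrow> of_real (measure_pmf.prob D {x. \<forall>k\<in>{1..N}. a k < x k})"
    by (rule tendsto_of_real)
  have val: "complex_of_real (measure_pmf.prob D (A R))
      = dset (f(1 := (\<lambda>j. Fr (int j) (?b 1 + 1 - y j) - Fr (int j) (?b 1 + 1 + int R - y j)))) {1..N}" for R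
  proof -
    have "measure_pmf.prob D (A R) = (\<Sum>v\<in>{a 1<..?b 1 + int R}. measure_pmf.prob D {x \<in> A R. x 1 = v})"
      using assms(3) by (intro measure_pmf_partition) (auto simp: A_def)
    also have "\<dots> = (\<Sum>v\<in>{a 1<..?b 1 + int R}. measure_pmf.prob D
        {x. restrict x {1..1} = z v \<and> (\<forall>k\<in>{Suc 1..N}. a k < x k)})"
    proof (intro sum.cong refl arg_cong[where f = "measure_pmf.prob D"] equalityI subsetI)
      fix v x assume v: "v \<in> {a 1<..?b 1 + int R}"
      have eq: "restrict x {1..1} = z v \<longleftrightarrow> x 1 = v"
        by (auto simp: z_def fun_eq_iff restrict_def)
      have *: "(\<forall>k\<in>{1..N}. a k < x k) \<longleftrightarrow> a 1 < x 1 \<and> (\<forall>k\<in>{Suc 1..N}. a k < x k)"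
        using assms(3) by (auto simp: Suc_le_eq le_less)
      { assume "x \<in> {x \<in> A R. x 1 = v}"
        then show "x \<in> {x. restrict x {1..1} = z v \<and> (\<forall>k\<in>{Suc 1..N}. a k < x k)}"
          unfolding mem_Collect_eq A_def * eq by simp }
      { assume "x \<in> {x. restrict x {1..1} = z v \<and> (\<forall>k\<in>{Suc 1..N}. a k < x k)}"
        then show "x \<in> {x \<in> A R. x 1 = v}" using v unfolding mem_Collect_eq A_def * eq by simp }
    qed
    finally have "complex_of_real (measure_pmf.prob D (A R)) = (\<Sum>v\<in>{a 1<..?b 1 + int R}.
        if 1 = N \<or> ?b (Suc 1) < z v 1
         then dset (\<lambda>k j. if k \<le> 1 then Fr (int j - int k) (z v k - y j)
              else Fr (int j - int k + 1) (?b k + 1 - y j)) {1..N} else 0)"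
      using prob_partial[OF D order.refl assms(3) z] by simp
    also have "\<dots> = (\<Sum>v\<in>{a 1<..?b 1 + int R}. if ?b 1 < v
         then dset (f(1 := (\<lambda>j. Fr (int j - 1) (v - y j)))) {1..N} else 0)"
    proof (intro sum.cong refl if_cong)
      fix v assume "v \<in> {a 1<..?b 1 + int R}"
      then show "(1 = N \<or> ?b (Suc 1) < z v 1) = (?b 1 < v)"
        using assms(3) suffix_max_rec[of 1 N a] by (cases "1 = N") (auto simp: z_def)
      show "dset (\<lambda>k j. if k \<le> 1 then Fr (int j - int k) (z v k - y j)
              else Fr (int j - int k + 1) (?b k + 1 - y j)) {1..N}
          = dset (f(1 := (\<lambda>j. Fr (int j - 1) (v - y j)))) {1..N}"
        unfolding f_def by (intro dset_cong) (auto simp: z_def le_Suc_eq)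
    qed
    also have "\<dots> = (\<Sum>v\<in>{?b 1 + 1..<?b 1 + 1 + int R}. dset (f(1 := (\<lambda>j. Fr (int j - 1) (v - y j)))) {1..N})"
      using ab by (intro sum.mono_neutral_cong_right) auto
    also have "\<dots> = dset (f(1 := (\<lambda>j. \<Sum>v\<in>{?b 1 + 1..<?b 1 + 1 + int R}. Fr (int j - 1) (v - y j)))) {1..N}"
      using assms(3) by (subst dset_row_sum) auto
    finally show ?thesis by (simp add: Fr_sum)
  qed
  have lim2: "(\<lambda>R. complex_of_real (measure_pmf.prob D (A R))) \<longlonglongrightarrow> dset f {1..N}"
    unfolding val
  proof (rule tendsto_dset)
    fix i j
    have "(\<lambda>R. Fr (int j) (?b 1 + 1 - y j) - Fr (int j) (?b 1 + 1 - y j + int R))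
        \<longlonglongrightarrow> Fr (int j) (?b 1 + 1 - y j) - 0"
      by (intro tendsto_diff tendsto_const Fr_at_top)
    then show "(\<lambda>R. (f(1 := (\<lambda>j. Fr (int j) (?b 1 + 1 - y j) - Fr (int j) (?b 1 + 1 + int R - y j)))) i j)
        \<longlonglongrightarrow> f i j"
      by (cases "i = 1") (simp_all add: f_def algebra_simps)
  qed
  show ?thesis using LIMSEQ_unique[OF lim1 lim2] by (simp add: f_def)
qed

end

section \<open>Hitting the initial configuration\<close>

text \<open>The pair of \<tau> and B_\<tau> by recursion on the path. Shifting y instead of counting
  steps matches the recursion of \<open>walk_pmf\<close>, so that the law can be computed by
  conditioning on the first step.\<close>

primrec first_above :: "nat \<Rightarrow> (nat \<Rightarrow> int) \<Rightarrow> int list \<Rightarrow> (nat \<times> int) option" where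
  "first_above 0 y B = None"
| "first_above (Suc N) y B = (if y 1 < hd B then Some (0, hd B)
     else map_option (map_prod Suc id) (first_above N (\<lambda>k. y (Suc k)) (tl B)))"

lemma first_above_SomeD:
  "first_above N y B = Some (m, b) \<Longrightarrow> length B = N \<Longrightarrow>
     m < N \<and> B ! m = b \<and> y (m + 1) < b \<and> (\<forall>k<m. B ! k \<le> y (k + 1))"
proof (induction N arbitrary: y B m b)
  case (Suc N)
  then obtain x xs where B: "B = x # xs" "length xs = N" by (cases B) auto
  show ?case
  proof (cases "y 1 < x")
    case False
    then obtain m' where m': "m = Suc m'" "first_above N (\<lambda>k. y (Suc k)) xs = Some (m', b)"
      using Suc.prems(1) B by auto
    have "B ! k \<le> y (k + 1)" if "k < m" for k
      using Suc.IH[OF m'(2) B(2)] B False m'(1) that by (cases k) auto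
    then show ?thesis using Suc.IH[OF m'(2) B(2)] m' B by auto
  qed (use Suc.prems B in auto)
qed simp

lemma first_above_NoneD:
  "first_above N y B = None \<Longrightarrow> length B = N \<Longrightarrow> k < N \<Longrightarrow> B ! k \<le> y (k + 1)"
proof (induction N arbitrary: y B k)
  case (Suc N)
  then obtain x xs where B: "B = x # xs" "length xs = N" by (cases B) auto
  show ?case
  proof (cases k)
    case 0
    then show ?thesis using Suc.prems B by (auto split: if_splits)
  next
    case (Suc k')
    then show ?thesis using Suc.prems Suc.IH[of "\<lambda>k. y (Suc k)" xs k'] B by (auto split: if_splits)
  qed
qed simp

lemma hit_time_eq:
  assumes "length B = N"
  shows "hit_time N y B = (case first_above N y B of None \<Rightarrow> \<infinity> | Some (m, b) \<Rightarrow> enat m)"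
proof (cases "first_above N y B")
  case None
  then have "{m. m < N \<and> B ! m > y (m + 1)} = {}"
    using first_above_NoneD[OF None assms] by force
  then have "hit_time N y B = Inf {}" unfolding hit_time_def by (simp only: image_empty)
  then show ?thesis using None by (simp add: top_enat_def)
next
  case (Some p)
  obtain m b where p: "p = (m, b)" by (cases p)
  have H: "m < N" "B ! m = b" "y (m + 1) < b" "\<forall>k<m. B ! k \<le> y (k + 1)"
    using first_above_SomeD[of N y B m b] Some p assms by auto
  have "hit_time N y B = enat m"
    unfolding hit_time_def
  proof (rule antisym)
    show "Inf (enat ` {m. m < N \<and> B ! m > y (m + 1)}) \<le> enat m"
      using H by (intro Inf_lower) auto
    show "enat m \<le> Inf (enat ` {m. m < N \<and> B ! m > y (m + 1)})"
    proof (rule Inf_greatest, clarify)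
      fix k assume "y (k + 1) < B ! k"
      then have "\<not> k < m" using H(4) by force
      then show "enat m \<le> enat k" by simp
    qed
  qed
  then show ?thesis using Some p by simp
qed

text \<open>
  All paths from \<open>z\<close> to \<open>b\<close> with \<open>m\<close> steps have the same probability \<open>\<alpha>^m \<theta>^(z - b)\<close>, so
  the joint law of \<open>\<tau>\<close> and \<open>B_\<tau>\<close> is given by counting the paths that exceed \<open>y\<close> for the first time
  at step \<open>m\<close>.
\<close>

primrec path_count :: "nat \<Rightarrow> (nat \<Rightarrow> int) \<Rightarrow> int \<Rightarrow> int \<Rightarrow> nat" where
  "path_count 0 y z b = of_bool (y 1 < z \<and> b = z)"
| "path_count (Suc m) y z b
     = (if y 1 < z then 0 else \<Sum>z'\<in>{b..<z}. path_count m (\<lambda>k. y (Suc k)) z' b)"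

lemma path_count_zD: "path_count m y z b \<noteq> 0 \<Longrightarrow> b \<le> z"
proof (induction m arbitrary: y z)
  case (Suc m)
  then have "\<not> y 1 < z" by auto
  then have "(\<Sum>z'\<in>{b..<z}. path_count m (\<lambda>k. y (Suc k)) z' b) \<noteq> 0"
    using Suc.prems by (simp only: path_count.simps if_False not_False_eq_True)
  then have "{b..<z} \<noteq> {}" by (metis sum.empty)
  then show ?case by auto
qed (auto split: if_splits)

lemma path_count_yD: "path_count m y z b \<noteq> 0 \<Longrightarrow> y (Suc m) < b"
proof (induction m arbitrary: y z)
  case (Suc m)
  then have "\<not> y 1 < z" by auto
  then have "(\<Sum>z'\<in>{b..<z}. path_count m (\<lambda>k. y (Suc k)) z' b) \<noteq> 0"
    using Suc.prems by (simp only: path_count.simps if_False not_False_eq_True)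
  then obtain z' where "path_count m (\<lambda>k. y (Suc k)) z' b \<noteq> 0"
    using sum.not_neutral_contains_not_neutral by blast
  then show ?case using Suc.IH[of "\<lambda>k. y (Suc k)"] by simp
qed (auto split: if_splits)

lemma length_walk: "B \<in> set_pmf (walk_pmf \<theta> N z) \<Longrightarrow> length B = N"
  by (induction N arbitrary: z B) auto

lemma pmf_first_above:
  assumes "0 < \<theta>" "\<theta> < 1" "m < N"
  shows "pmf (map_pmf (first_above N y) (walk_pmf \<theta> N z)) (Some (m, b))
    = alpha \<theta> ^ m * \<theta> powi (z - b) * path_count m y z b"
  using assms(3)
proof (induction N arbitrary: y z m)
  case (Suc N)
  let ?y = "\<lambda>k. y (Suc k)"
  have eq: "map_pmf (first_above (Suc N) y) (walk_pmf \<theta> (Suc N) z)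
      = (if y 1 < z then return_pmf (Some (0, z))
         else bind_pmf (walk_step \<theta> z) (\<lambda>z'. map_pmf (map_option (map_prod Suc id))
                (map_pmf (first_above N ?y) (walk_pmf \<theta> N z'))))"
    by (simp add: pmf.map_comp o_def map_bind_pmf)
  show ?case
  proof (cases "y 1 < z")
    case True
    then show ?thesis unfolding eq by (cases m) auto
  next
    case False
    let ?H = "\<lambda>z'. map_pmf (first_above N ?y) (walk_pmf \<theta> N z')"
    have "pmf (map_pmf (first_above (Suc N) y) (walk_pmf \<theta> (Suc N) z)) (Some (m, b))
        = (LINT z'|walk_step \<theta> z. pmf (map_pmf (map_option (map_prod Suc id)) (?H z')) (Some (m, b)))"
      unfolding eq using False by (simp add: pmf_bind)
    also have "\<dots> = alpha \<theta> ^ m * \<theta> powi (z - b) * path_count m y z b"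
    proof (cases m)
      case 0
      have "pmf (map_pmf (map_option (map_prod Suc id)) (?H z')) (Some (0, b)) = 0" for z'
        by (rule pmf_map_outside) auto
      then show ?thesis using False 0 by simp
    next
      case (Suc m')
      have inj: "inj (map_option (map_prod Suc (id :: int \<Rightarrow> int)))"
        by (intro option.inj_map prod.inj_map) auto
      have "pmf (map_pmf (map_option (map_prod Suc id)) (?H z')) (Some (Suc m', b))
          = alpha \<theta> ^ m' * \<theta> powi (z' - b) * path_count m' ?y z' b" for z'
        using pmf_map_inj'[OF inj, of "?H z'" "Some (m', b)"] Suc.IH[of m' ?y z'] Suc.prems Suc by simp
      then have "(LINT z'|walk_step \<theta> z. pmf (map_pmf (map_option (map_prod Suc id)) (?H z')) (Some (m, b)))
          = (LINT z'|walk_step \<theta> z. alpha \<theta> ^ m' * \<theta> powi (z' - b) * path_count m' ?y z' b)"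
        using Suc by simp
      also have "\<dots> = (\<Sum>z'\<in>{b..<z}. alpha \<theta> ^ m' * \<theta> powi (z' - b) * path_count m' ?y z' b * pmf (walk_step \<theta> z) z')"
      proof (rule integral_measure_pmf_real)
        fix z' assume z': "z' \<in> set_pmf (walk_step \<theta> z)" "alpha \<theta> ^ m' * \<theta> powi (z' - b) * path_count m' ?y z' b \<noteq> 0"
        then have "Q_ker \<theta> z z' \<noteq> 0" using pmf_walk_step[OF assms(1,2), of z z'] by (simp add: set_pmf_iff)
        then have "z' < z" by (simp add: Q_ker_def split: if_splits)
        then show "z' \<in> {b..<z}" using z'(2) path_count_zD[of m' ?y z' b] by auto
      qed simp
      also have "\<dots> = (\<Sum>z'\<in>{b..<z}. alpha \<theta> ^ m * \<theta> powi (z - b) * path_count m' ?y z' b)"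
      proof (intro sum.cong refl)
        fix z' assume "z' \<in> {b..<z}"
        \<comment> \<open>One step from z to z' has probability (1 - \<theta>) \<theta>^(z - z' - 1)
          = \<alpha> \<theta>^(z - z'), which makes the weight of a path depend only on its ends and
          its length.\<close>
        have "\<theta> powi (z - b) = \<theta> powi (z' - b) * (\<theta> powi (z - z' - 1) * \<theta>)"
          using assms(1) power_int_add[of \<theta> "z' - b" "z - z'"] power_int_add[of \<theta> "z - z' - 1" 1] by simp
        moreover have "alpha \<theta> * \<theta> = 1 - \<theta>" using assms by (simp add: alpha_def)
        ultimately have "alpha \<theta> * \<theta> powi (z - b) = \<theta> powi (z' - b) * ((1 - \<theta>) * \<theta> powi (z - z' - 1))"
          by (metis (no_types, opaque_lifting) mult.assoc mult.commute)
        then show "alpha \<theta> ^ m' * \<theta> powi (z' - b) * path_count m' ?y z' b * pmf (walk_step \<theta> z) z'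
            = alpha \<theta> ^ m * \<theta> powi (z - b) * path_count m' ?y z' b"
          using \<open>z' \<in> {b..<z}\<close> assms(1,2) by (simp add: pmf_walk_step Q_ker_def Suc mult_ac)
      qed
      also have "\<dots> = alpha \<theta> ^ m * \<theta> powi (z - b) * path_count m y z b"
        using False Suc by (simp add: sum_distrib_left)
      finally show ?thesis .
    qed
    finally show ?thesis .
  qed
qed simp

lemma walk_bounded:
  assumes "0 < \<theta>" "\<theta> < 1" "B \<in> set_pmf (walk_pmf \<theta> N z)" "k < N"
  shows "B ! k \<le> z"
  using assms(3,4)
proof (induction N arbitrary: z B k)
  case (Suc N)
  then obtain z' B' where B: "B = z # B'" "z' \<in> set_pmf (walk_step \<theta> z)" "B' \<in> set_pmf (walk_pmf \<theta> N z')" by auto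
  have "Q_ker \<theta> z z' \<noteq> 0" using pmf_walk_step[OF assms(1,2), of z z'] B(2) by (simp add: set_pmf_iff)
  then have "z' < z" by (simp add: Q_ker_def split: if_splits)
  then show ?case using Suc.IH[OF B(3)] Suc.prems(2) B(1) by (cases k) fastforce+
qed simp

text \<open>
  A path that is at \<open>y k\<close> after \<open>k\<close> steps was above \<open>y k\<close> one step before, hence has exceeded
  \<open>y\<close> at some time \<open>m < k\<close>; decompose at the first such time.
\<close>

lemma path_count_decomposition:
  assumes "1 \<le> k" "\<And>j. j \<in> {1..k} \<Longrightarrow> lo \<le> y j" "z \<le> hi"
  shows "(\<Sum>m<k. \<Sum>b\<in>{lo<..hi}. path_count m y z b * qn (k - m) (b - y k)) = qn k (z - y k)"
  using assms
proof (induction k arbitrary: y z)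
  case (Suc k)
  let ?y = "\<lambda>k. y (Suc k)"
  show ?case
  proof (cases "y 1 < z")
    case True
    have "lo < z" using True Suc.prems(2)[of 1] by simp
    have "(\<Sum>m<Suc k. \<Sum>b\<in>{lo<..hi}. path_count m y z b * qn (Suc k - m) (b - y (Suc k)))
        = (\<Sum>b\<in>{lo<..hi}. of_bool (b = z) * qn (Suc k) (b - y (Suc k)))"
      using True by (simp add: sum.lessThan_Suc_shift del: sum.lessThan_Suc)
    also have "\<dots> = (\<Sum>b\<in>{z}. qn (Suc k) (b - y (Suc k)))"
      using \<open>lo < z\<close> Suc.prems(3) by (intro sum.mono_neutral_cong_right) auto
    finally show ?thesis by simp
  next
    case False
    have "(\<Sum>m<Suc k. \<Sum>b\<in>{lo<..hi}. path_count m y z b * qn (Suc k - m) (b - y (Suc k)))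
        = (\<Sum>m<k. \<Sum>b\<in>{lo<..hi}. (\<Sum>z'\<in>{b..<z}. path_count m ?y z' b) * qn (k - m) (b - y (Suc k)))"
      using False by (simp add: sum.lessThan_Suc_shift del: sum.lessThan_Suc)
    also have "\<dots> = (\<Sum>m<k. \<Sum>b\<in>{lo<..hi}. \<Sum>z'\<in>{lo..<z}. path_count m ?y z' b * qn (k - m) (b - y (Suc k)))"
    proof (intro sum.cong refl)
      fix m b assume "b \<in> {lo<..hi}"
      have "(\<Sum>z'\<in>{b..<z}. path_count m ?y z' b) = (\<Sum>z'\<in>{lo..<z}. path_count m ?y z' b)"
      proof (rule sum.mono_neutral_left)
        show "{b..<z} \<subseteq> {lo..<z}" using \<open>b \<in> {lo<..hi}\<close> by auto
        show "\<forall>z'\<in>{lo..<z} - {b..<z}. path_count m ?y z' b = 0"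
        proof
          fix z' assume "z' \<in> {lo..<z} - {b..<z}"
          then have "\<not> b \<le> z'" by auto
          then show "path_count m ?y z' b = 0" using path_count_zD[of m ?y z' b] by blast
        qed
      qed simp
      then show "(\<Sum>z'\<in>{b..<z}. path_count m ?y z' b) * qn (k - m) (b - y (Suc k))
          = (\<Sum>z'\<in>{lo..<z}. path_count m ?y z' b * qn (k - m) (b - y (Suc k)))"
        by (simp add: sum_distrib_right)
    qed
    also have "\<dots> = (\<Sum>m<k. \<Sum>z'\<in>{lo..<z}. \<Sum>b\<in>{lo<..hi}. path_count m ?y z' b * qn (k - m) (b - y (Suc k)))"
      by (intro sum.cong refl sum.swap)
    also have "\<dots> = (\<Sum>z'\<in>{lo..<z}. \<Sum>m<k. \<Sum>b\<in>{lo<..hi}. path_count m ?y z' b * qn (k - m) (b - y (Suc k)))"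
      by (rule sum.swap)
    also have "\<dots> = qn (Suc k) (z - y (Suc k))"
    proof (cases "k = 0")
      case True
      then show ?thesis using False by (simp add: qn_1)
    next
      case k: False
      have "(\<Sum>z'\<in>{lo..<z}. \<Sum>m<k. \<Sum>b\<in>{lo<..hi}. path_count m ?y z' b * qn (k - m) (b - y (Suc k)))
          = (\<Sum>z'\<in>{lo..<z}. qn k (z' - y (Suc k)))"
      proof (intro sum.cong refl)
        fix z' assume "z' \<in> {lo..<z}"
        then show "(\<Sum>m<k. \<Sum>b\<in>{lo<..hi}. path_count m ?y z' b * qn (k - m) (b - y (Suc k)))
            = qn k (z' - y (Suc k))"
          using Suc.IH[of ?y z'] k Suc.prems by auto
      qed
      also have "\<dots> = qn (Suc k) (z - y (Suc k))"
      proof (cases "lo \<le> z")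
        case True
        have "(\<Sum>z'\<in>{lo..<z}. qn k (z' - y (Suc k))) = (\<Sum>e\<in>{lo - y (Suc k)..<z - y (Suc k)}. qn k e)"
          by (rule sum.reindex_bij_witness[where i = "\<lambda>e. e + y (Suc k)" and j = "\<lambda>z'. z' - y (Suc k)"]) auto
        then show ?thesis using qn_sum[of "lo - y (Suc k)" "z - y (Suc k)" k] True Suc.prems(2)[of "Suc k"] by simp
      next
        case False
        then show ?thesis using Suc.prems(2)[of "Suc k"] by (simp add: qn_eq_0)
      qed
      finally show ?thesis .
    qed
    finally show ?thesis .
  qed
qed simp

text \<open>The disc of radius \<delta> around 1 may leave the annulus. What links \<phi>^t and
  \<phi>^(-t) is therefore recorded at the point 1, as the relation \<open>Gf * Gi = 1\<close>
  between Taylor series.\<close>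

locale kernel_setting = gen_fun +
  fixes pw :: "real \<Rightarrow> complex \<Rightarrow> complex" and t :: real
    and \<theta> r \<delta> :: real and Gf Gi :: "complex fps" and N :: nat and y :: "nat \<Rightarrow> int"
  assumes theta: "\<theta> \<in> {\<rho><..<1}" and r: "r \<in> {\<rho><..<1}" and delta: "\<delta> \<in> {0<..<1}"
    and pw_eq: "\<And>w. w \<in> annulus \<rho> \<rho>' \<Longrightarrow> pw t w = g w"
    and inv_analytic: "(\<lambda>w. pw (- t) (1 - w)) analytic_on cball 0 \<delta>"
    and Gf: "(\<lambda>w. g (1 - w)) has_fps_expansion Gf"
    and Gi: "(\<lambda>w. pw (- t) (1 - w)) has_fps_expansion Gi"
    and Gf_Gi: "Gf * Gi = 1"
    and y: "y \<in> \<Omega> N"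
begin

lemma theta01: "0 < \<theta>" "\<theta> < 1" using theta radii by auto

lemma alpha_pos: "0 < alpha \<theta>" using theta01 by (simp add: alpha_def)

section \<open>The kernels in terms of path counts, Laurent and Taylor coefficients\<close>

lemma Q_pow_eq:
  "Q_pow \<theta> r n z1 z2 = of_real (alpha \<theta> ^ n * \<theta> powi (z1 - z2)) * of_nat (qn n (z1 - z2))"
proof -
  have r01: "0 < r" "r < 1" using r radii by auto
  have ne: "1 - w \<noteq> 0" if "norm w = r" for w :: complex using that r01 by auto
  have "circ_integral r (\<lambda>w. of_real \<theta> powi (z1 - z2) / w powi (z1 - z2 - int n + 1) * (1 - w) powi (- int n))
      = circ_integral r (\<lambda>w. of_real \<theta> powi (z1 - z2) * (w powi (int n - 1 - (z1 - z2)) * (1 - w) powi (- int n)))"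
  proof (rule circ_integral_cong[OF r01(1)])
    fix w :: complex
    have "w powi (int n - 1 - (z1 - z2)) = inverse (w powi (z1 - z2 - int n + 1))"
      by (subst power_int_minus[symmetric]) (simp add: algebra_simps)
    then show "of_real \<theta> powi (z1 - z2) / w powi (z1 - z2 - int n + 1) * (1 - w) powi (- int n)
        = of_real \<theta> powi (z1 - z2) * (w powi (int n - 1 - (z1 - z2)) * (1 - w) powi (- int n))"
      by (simp add: divide_inverse)
  qed
  also have "\<dots> = of_real \<theta> powi (z1 - z2) * of_nat (qn n (z1 - z2))"
    using r01 ne
    by (subst circ_integral_cmult)
       (auto simp: circ_integral_qn intro!: continuous_on_mult continuous_on_sphere_powi continuous_on_power_int continuous_intros)
  finally show ?thesis unfolding Q_pow_def by simp
qed

lemma S_ker_eq: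
  "S_ker pw \<theta> r t n z1 z2 = of_real (alpha \<theta> powi (1 - int n) * \<theta> powi (z2 - z1)) * hs (int n) (z2 - z1)"
proof -
  have r01: "0 < r" "\<rho> \<le> r" "r \<le> \<rho>'" using r radii by auto
  have cont: "continuous_on (sphere 0 r) (\<lambda>w. (1 - w) ^ n / w powi (z2 - z1 + int n + 1) * g w)"
    using r01 continuous_on_sphere_annulus[OF g_analytic r01(2,3)]
    by (intro continuous_on_mult continuous_on_divide continuous_on_sphere_powi continuous_intros) auto
  have "circ_integral r (\<lambda>w. of_real \<theta> powi (z2 - z1) / w powi (z2 - z1 + int n + 1) * (1 - w) ^ n * pw t w)
      = circ_integral r (\<lambda>w. of_real \<theta> powi (z2 - z1) * ((1 - w) ^ n / w powi (z2 - z1 + int n + 1) * g w))"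
    using r01 by (intro circ_integral_cong) (auto simp: pw_eq annulus_def)
  also have "\<dots> = of_real \<theta> powi (z2 - z1) * hs (int n) (z2 - z1)"
    using circ_integral_cmult[OF r01(1) cont] circ_integral_eq_hs[OF r] by simp
  finally show ?thesis unfolding S_ker_def by simp
qed

lemma Sbar_ker_eq:
  assumes "1 \<le> n"
  shows "Sbar_ker pw \<theta> \<delta> t n z1 z2 = of_real (alpha \<theta> ^ (n - 1) * \<theta> powi (z1 - z2))
     * fps_nth (fpsY (z2 - z1 + int n - 1) * Gi) (n - 1)"
proof -
  define c :: complex where "c = of_real (\<theta> powi (z1 - z2))"
  let ?f = "\<lambda>w. c * ((1 - w) powi (z2 - z1 + int n - 1) * pw (- t) (1 - w))"
  have c: "inverse (of_real \<theta> powi (z2 - z1)) = c"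
    unfolding c_def by (subst power_int_minus[symmetric]) simp
  have "circ_integral \<delta> (\<lambda>w. (1 - w) powi (z2 - z1 + int n - 1) / (of_real \<theta> powi (z2 - z1) * w ^ n) * pw (- t) (1 - w))
      = circ_integral \<delta> (\<lambda>w. ?f w / w ^ Suc (n - 1))"
    using assms delta by (intro circ_integral_cong) (auto simp: divide_inverse c[symmetric] simp del: power_Suc)
  also have "\<dots> = fps_nth (fps_const c * (fpsY (z2 - z1 + int n - 1) * Gi)) (n - 1)"
  proof (rule circ_integral_fps_nth)
    have "(\<lambda>w. (1 - w) powi (z2 - z1 + int n - 1)) analytic_on cball 0 \<delta>"
      using delta by (intro analytic_intros) auto
    then show "?f analytic_on cball 0 \<delta>" by (intro analytic_on_mult analytic_on_const inv_analytic)
    show "?f has_fps_expansion fps_const c * (fpsY (z2 - z1 + int n - 1) * Gi)"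
      by (intro fps_expansion_intros fpsY_has_fps_expansion Gi)
  qed (use delta in simp)
  also have "\<dots> = c * fps_nth (fpsY (z2 - z1 + int n - 1) * Gi) (n - 1)" by simp
  finally show ?thesis
    using assms unfolding Sbar_ker_def c_def by (simp add: power_int_def of_nat_diff nat_diff_distrib')
qed

text \<open>
  The coefficients of \<open>Sbar_(-t,n-m)(b, \<cdot>)\<close> with respect to \<open>Ek n 1, ..., Ek n n\<close>. They do not depend
  on \<open>n\<close>, which is what makes the kernel of finite rank uniformly in the levels.
\<close>

definition Sbar_coef :: "nat \<Rightarrow> nat \<Rightarrow> int \<Rightarrow> complex" where
  "Sbar_coef k m b = fps_nth (fps_X ^ m * (fpsY (- b - int m) * Gi)) (k - 1)"

lemma Ek_eq_nth: "k \<in> {1..n} \<Longrightarrow> Ek n k x = fps_nth (fpsY (x + int n - 1)) (n - 1 - (k - 1))"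
  by (auto simp: Ek_def algebra_simps)

text \<open>The sum over k is the Cauchy product, in degree n - 1, of w^m (1 - w)^(-b - m)
  \<open>Gi\<close> with (1 - w)^(x + n - 1). The exponents add up to the one in
  \<open>Sbar\<close>, and the factor w^m produces the cutoff m < n.\<close>

lemma sum_Ek_Sbar_coef:
  assumes "1 \<le> n"
  shows "(\<Sum>k\<in>{1..n}. Ek n k x * Sbar_coef k m b) = (if m < n then fps_nth (fpsY (x - b + int (n - m) - 1) * Gi) (n - m - 1) else 0)"
proof -
  have "(\<Sum>k\<in>{1..n}. Ek n k x * Sbar_coef k m b)
      = (\<Sum>i=0..n - 1. fps_nth (fps_X ^ m * (fpsY (- b - int m) * Gi)) i * fps_nth (fpsY (x + int n - 1)) (n - 1 - i))"
    using assms
    by (intro sum.reindex_bij_witness[where i = Suc and j = "\<lambda>k. k - 1"]) (auto simp: Sbar_coef_def Ek_eq_nth)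
  also have "\<dots> = fps_nth (fps_X ^ m * (fpsY (- b - int m) * Gi) * fpsY (x + int n - 1)) (n - 1)"
    by (simp add: fps_mult_nth)
  also have "fps_X ^ m * (fpsY (- b - int m) * Gi) * fpsY (x + int n - 1)
      = fps_X ^ m * (fpsY ((- b - int m) + (x + int n - 1)) * Gi)"
    by (simp only: fpsY_add mult_ac)
  finally have *: "(\<Sum>k\<in>{1..n}. Ek n k x * Sbar_coef k m b) = (if n - 1 < m then 0
      else fps_nth (fpsY ((- b - int m) + (x + int n - 1)) * Gi) (n - 1 - m))"
    by (simp only: fps_X_power_mult_nth)
  show ?thesis
  proof (cases "m < n")
    case True
    then have "(- b - int m) + (x + int n - 1) = x - b + int (n - m) - 1" "n - 1 - m = n - m - 1" "\<not> n - 1 < m"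
      by auto
    then show ?thesis using True by (simp only: * if_True if_False)
  qed (use assms * in auto)
qed

text \<open>
  The factor \<open>Gf\<close> cancels the factor \<open>Gi\<close> of \<open>Sbar_coef\<close>, so applying \<open>Lmat\<close> leaves path counts
  without any \<open>\<phi>\<close>. The entry \<open>Lmat l k\<close> is also the pairing of \<open>Ek M k\<close> with \<open>Psi l M\<close>,
  see \<open>has_sum_Ek_Psi\<close>.
\<close>

definition Lmat :: "nat \<Rightarrow> nat \<Rightarrow> complex" where
  "Lmat k l = (if l \<le> k then fps_nth (fpsY (y k + int k - 1) * Gf) (k - l) else 0)"

lemma Lmat_eq_Suc: "l \<in> {1..k} \<Longrightarrow> Lmat k l = fps_nth (fpsY (y k + int k - 1) * Gf) (k - 1 - (l - 1))"
  by (auto simp: Lmat_def)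

lemma sum_Lmat_Sbar_coef:
  assumes "k \<in> {1..N'}"
  shows "(\<Sum>l\<in>{1..N'}. Lmat k l * Sbar_coef l m b)
    = (if m < k then fps_nth (fpsY (y k - b + int (k - m) - 1)) (k - m - 1) else 0)"
proof -
  have "(\<Sum>l\<in>{1..N'}. Lmat k l * Sbar_coef l m b) = (\<Sum>l\<in>{1..k}. Lmat k l * Sbar_coef l m b)"
    using assms by (intro sum.mono_neutral_right) (auto simp: Lmat_def)
  also have "\<dots> = (\<Sum>i=0..k - 1. fps_nth (fps_X ^ m * (fpsY (- b - int m) * Gi)) i * fps_nth (fpsY (y k + int k - 1) * Gf) (k - 1 - i))"
    using assms
    by (intro sum.reindex_bij_witness[where i = Suc and j = "\<lambda>k. k - 1"]) (auto simp: Sbar_coef_def Lmat_eq_Suc)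
  also have "\<dots> = fps_nth (fps_X ^ m * (fpsY (- b - int m) * Gi) * (fpsY (y k + int k - 1) * Gf)) (k - 1)"
    by (simp add: fps_mult_nth)
  also have "fps_X ^ m * (fpsY (- b - int m) * Gi) * (fpsY (y k + int k - 1) * Gf)
      = fps_X ^ m * fpsY ((- b - int m) + (y k + int k - 1)) * (Gf * Gi)"
    by (simp only: fpsY_add mult_ac)
  finally have *: "(\<Sum>l\<in>{1..N'}. Lmat k l * Sbar_coef l m b) = (if k - 1 < m then 0
      else fps_nth (fpsY ((- b - int m) + (y k + int k - 1))) (k - 1 - m))"
    by (simp only: Gf_Gi mult_1_right fps_X_power_mult_nth)
  show ?thesis
  proof (cases "m < k")
    case True
    then have "(- b - int m) + (y k + int k - 1) = y k - b + int (k - m) - 1" "k - 1 - m = k - m - 1" "\<not> k - 1 < m"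
      by auto
    then show ?thesis using True by (simp only: * if_True if_False)
  qed (use assms * in auto)
qed

text \<open>A bound below every place B_\<tau>, since B_\<tau> > y_(\<tau>+1) \<ge> y_N; it keeps
  the sums over hitting places finite.\<close>

definition ylow :: int where "ylow = (if N = 0 then 0 else y N)"

lemma ylow_le: "j \<in> {1..N} \<Longrightarrow> ylow \<le> y j"
  using y by (cases "j = N") (auto simp: ylow_def Omega_iff less_imp_le)

text \<open>The coefficient of \<open>Ek n k\<close> in Sbar^epi(z, .) at level n, without the
  powers of \<alpha> and \<theta>; it is the same for all n \<ge> k.\<close>

definition hit_coef :: "nat \<Rightarrow> int \<Rightarrow> complex" where
  "hit_coef k z = (\<Sum>m<N. \<Sum>b\<in>{ylow<..z}. of_nat (path_count m y z b) * Sbar_coef k m b)"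

text \<open>For a hit at time m < k and place b, \<open>Lmat\<close> leaves a polynomial that equals
  the number of paths from b to y k in k - m steps, as b > y_(m+1) \<ge> y k. Summing over hits
  gives all paths from z to y k in k steps by first passage. Since \<open>Lmat\<close> is
  unitriangular, this determines \<open>hit_coef\<close>.\<close>

lemma sum_Lmat_hit_coef:
  assumes "k \<in> {1..N'}" "N' \<le> N"
  shows "(\<Sum>l\<in>{1..N'}. Lmat k l * hit_coef l z) = of_nat (qn k (z - y k))"
proof -
  have "(\<Sum>l\<in>{1..N'}. Lmat k l * hit_coef l z)
      = (\<Sum>m<N. \<Sum>b\<in>{ylow<..z}. of_nat (path_count m y z b) * (\<Sum>l\<in>{1..N'}. Lmat k l * Sbar_coef l m b))"
    unfolding hit_coef_def sum_distrib_left
    by (subst sum.swap, rule sum.cong[OF refl], subst sum.swap) (simp add: mult_ac)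
  also have "\<dots> = (\<Sum>m<N. \<Sum>b\<in>{ylow<..z}. if m < k then of_nat (path_count m y z b * qn (k - m) (b - y k)) else 0)"
  proof (intro sum.cong refl)
    fix m b
    show "of_nat (path_count m y z b) * (\<Sum>l\<in>{1..N'}. Lmat k l * Sbar_coef l m b)
        = (if m < k then of_nat (path_count m y z b * qn (k - m) (b - y k)) else 0)"
    proof (cases "m < k \<and> path_count m y z b \<noteq> 0")
      case True
      have "y k \<le> y (Suc m)"
        using True assms y by (cases "k = Suc m") (auto simp: Omega_iff less_imp_le)
      then have "1 \<le> b - y k" "1 \<le> k - m" using path_count_yD[of m y z b] True by auto
      then have "of_nat (qn (k - m) (b - y k)) = fps_nth (fpsY (int (k - m) - 1 - (b - y k))) (k - m - 1)"
        by (rule qn_eq_fpsY)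
      also have "int (k - m) - 1 - (b - y k) = y k - b + int (k - m) - 1" by simp
      finally have "(\<Sum>l\<in>{1..N'}. Lmat k l * Sbar_coef l m b) = of_nat (qn (k - m) (b - y k))"
        using sum_Lmat_Sbar_coef[OF assms(1), of m b] True by simp
      then show ?thesis using True by simp
    next
      case False
      then show ?thesis using sum_Lmat_Sbar_coef[OF assms(1), of m b] by auto
    qed
  qed
  also have "\<dots> = (\<Sum>m<k. \<Sum>b\<in>{ylow<..z}. of_nat (path_count m y z b * qn (k - m) (b - y k)))"
    using assms by (intro sum.mono_neutral_cong_right) auto
  also have "\<dots> = of_nat (\<Sum>m<k. \<Sum>b\<in>{ylow<..z}. path_count m y z b * qn (k - m) (b - y k))"
    by simp
  also have "(\<Sum>m<k. \<Sum>b\<in>{ylow<..z}. path_count m y z b * qn (k - m) (b - y k)) = qn k (z - y k)"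
    using assms ylow_le by (intro path_count_decomposition) auto
  finally show ?thesis .
qed

lemma Sbar_epi_eq:
  assumes "1 \<le> n" "n \<le> N"
  shows "Sbar_epi N y pw \<theta> \<delta> t n z x
    = of_real (alpha \<theta> ^ (n - 1) * \<theta> powi (z - x)) * (\<Sum>k\<in>{1..n}. Ek n k x * hit_coef k z)"
proof -
  let ?H = "map_pmf (first_above N y) (walk_pmf \<theta> N z)"
  define \<phi> where "\<phi> h = (case h of None \<Rightarrow> 0 | Some (m, b) \<Rightarrow>
      if m < n then Sbar_ker pw \<theta> \<delta> t (n - m) b x else 0)" for h :: "(nat \<times> int) option"
  have "Sbar_epi N y pw \<theta> \<delta> t n z x = (LINT B|walk_pmf \<theta> N z. \<phi> (first_above N y B))"
    unfolding Sbar_epi_def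
  proof (rule integral_cong_AE)
    show "AE B in measure_pmf (walk_pmf \<theta> N z).
        (let \<tau> = hit_time N y B in if \<tau> < enat n
          then Sbar_ker pw \<theta> \<delta> t (n - the_enat \<tau>) (B ! the_enat \<tau>) x else 0) = \<phi> (first_above N y B)"
    proof (rule AE_pmfI)
      fix B assume "B \<in> set_pmf (walk_pmf \<theta> N z)"
      then have len: "length B = N" by (rule length_walk)
      show "(let \<tau> = hit_time N y B in if \<tau> < enat n
          then Sbar_ker pw \<theta> \<delta> t (n - the_enat \<tau>) (B ! the_enat \<tau>) x else 0) = \<phi> (first_above N y B)"
      proof (cases "first_above N y B")
        case None
        then show ?thesis by (simp add: hit_time_eq[OF len] \<phi>_def)
      next
        case (Some p)
        obtain m b where p: "p = (m, b)" by (cases p)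
        then show ?thesis
          using first_above_SomeD[of N y B m b] Some len by (simp add: hit_time_eq[OF len] \<phi>_def)
      qed
    qed
  qed auto
  also have "\<dots> = (LINT h|?H. \<phi> h)" by simp
  also have "\<dots> = (\<Sum>h\<in>Some ` ({..<N} \<times> {ylow<..z}). pmf ?H h *\<^sub>R \<phi> h)"
  proof (rule integral_measure_pmf)
    fix h assume h: "h \<in> set_pmf ?H" "\<phi> h \<noteq> 0"
    then obtain B where B: "B \<in> set_pmf (walk_pmf \<theta> N z)" "h = first_above N y B" by auto
    obtain m b where mb: "h = Some (m, b)" using h(2) by (auto simp: \<phi>_def split: option.splits)
    have "m < N" "B ! m = b" "y (m + 1) < b"
      using first_above_SomeD[of N y B m b] mb B length_walk by auto
    moreover have "B ! m \<le> z" using walk_bounded[OF theta01 B(1)] \<open>m < N\<close> by blast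
    moreover have "ylow \<le> y (m + 1)" using \<open>m < N\<close> by (intro ylow_le) auto
    ultimately show "h \<in> Some ` ({..<N} \<times> {ylow<..z})" using mb by auto
  qed auto
  also have "\<dots> = (\<Sum>(m, b)\<in>{..<N} \<times> {ylow<..z}. pmf ?H (Some (m, b)) *\<^sub>R \<phi> (Some (m, b)))"
    by (subst sum.reindex) (auto simp: o_def case_prod_unfold)
  also have "\<dots> = (\<Sum>m<N. \<Sum>b\<in>{ylow<..z}. pmf ?H (Some (m, b)) *\<^sub>R \<phi> (Some (m, b)))"
    by (rule sum.cartesian_product[symmetric])
  also have "\<dots> = (\<Sum>m<N. \<Sum>b\<in>{ylow<..z}. of_real (alpha \<theta> ^ (n - 1) * \<theta> powi (z - x)) *
      (of_nat (path_count m y z b) * (\<Sum>k\<in>{1..n}. Ek n k x * Sbar_coef k m b)))"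
  proof (intro sum.cong refl)
    fix m b assume "m \<in> {..<N}"
    then have pm: "pmf ?H (Some (m, b)) = alpha \<theta> ^ m * \<theta> powi (z - b) * path_count m y z b"
      by (intro pmf_first_above theta01) auto
    show "pmf ?H (Some (m, b)) *\<^sub>R \<phi> (Some (m, b)) = of_real (alpha \<theta> ^ (n - 1) * \<theta> powi (z - x)) *
      (of_nat (path_count m y z b) * (\<Sum>k\<in>{1..n}. Ek n k x * Sbar_coef k m b))"
    proof (cases "m < n")
      case True
      \<comment> \<open>The powers \<alpha>^m \<theta>^(z - b) of the walk and \<alpha>^(n - m - 1)
        \<theta>^(b - x) of \<open>Sbar\<close> combine to a factor independent of m and b.\<close>
      then have "alpha \<theta> ^ (n - 1) = alpha \<theta> ^ m * alpha \<theta> ^ (n - m - 1)"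
        by (simp add: power_add[symmetric])
      moreover have "\<theta> powi (z - x) = \<theta> powi (z - b) * \<theta> powi (b - x)"
        using theta01 by (intro power_int_add_eq) auto
      ultimately show ?thesis
        using True sum_Ek_Sbar_coef[OF assms(1), of x m b]
        by (simp add: pm \<phi>_def Sbar_ker_eq scaleR_conv_of_real mult_ac)
    next
      case False
      then show ?thesis using sum_Ek_Sbar_coef[OF assms(1), of x m b] by (simp add: \<phi>_def)
    qed
  qed
  also have "\<dots> = of_real (alpha \<theta> ^ (n - 1) * \<theta> powi (z - x)) *
      (\<Sum>m<N. \<Sum>b\<in>{ylow<..z}. \<Sum>k\<in>{1..n}. Ek n k x * (of_nat (path_count m y z b) * Sbar_coef k m b))"
    by (simp add: sum_distrib_left mult_ac)
  also have "(\<Sum>m<N. \<Sum>b\<in>{ylow<..z}. \<Sum>k\<in>{1..n}. Ek n k x * (of_nat (path_count m y z b) * Sbar_coef k m b))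
      = (\<Sum>k\<in>{1..n}. Ek n k x * hit_coef k z)"
    unfolding hit_coef_def sum_distrib_left
    by (subst (2) sum.swap, subst sum.swap) simp
  finally show ?thesis .
qed

end

section \<open>The kernel as a finite rank perturbation\<close>

lemma summable_on_geometric_shift:
  assumes "0 \<le> q" "(q::real) < 1"
  shows "(\<lambda>z::int. q ^ nat \<bar>z - c\<bar>) summable_on UNIV"
  using summable_on_geometric_int[OF assms]
  by (subst summable_on_reindex_bij_witness[where S = UNIV and T = UNIV and i = "\<lambda>x. x + c"
        and j = "\<lambda>z. z - c" and h = "\<lambda>x. q ^ nat \<bar>x\<bar>"]) auto

lemma has_sum_int_partial:
  fixes f :: "int \<Rightarrow> complex"
  assumes "(f has_sum s) UNIV" "\<And>x. c < x \<Longrightarrow> f x = 0"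
  shows "(\<lambda>R. \<Sum>x\<in>{- int R..c}. f x) \<longlonglongrightarrow> s"
proof -
  have "(f has_sum s) {..c}"
    using assms by (subst has_sum_cong_neutral[where T = UNIV and g = f]) (auto simp: not_le)
  then have "(sum f \<longlongrightarrow> s) (finite_subsets_at_top {..c})" by (simp add: has_sum_def)
  moreover have "filterlim (\<lambda>R. {- int R..c}) (finite_subsets_at_top {..c}) sequentially"
    unfolding filterlim_finite_subsets_at_top
  proof (intro allI impI)
    fix X assume X: "finite X \<and> X \<subseteq> {..c}"
    show "\<forall>\<^sub>F R in sequentially. finite {- int R..c} \<and> X \<subseteq> {- int R..c} \<and> {- int R..c} \<subseteq> {..c}"
    proof (rule eventually_sequentiallyI[of "nat (Max ((\<lambda>x. \<bar>x\<bar>) ` X \<union> {0}))"])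
      fix R assume R: "nat (Max ((\<lambda>x. \<bar>x\<bar>) ` X \<union> {0})) \<le> R"
      have "\<bar>x\<bar> \<le> int R" if "x \<in> X" for x
      proof -
        have "\<bar>x\<bar> \<le> Max ((\<lambda>x. \<bar>x\<bar>) ` X \<union> {0})" using X that by (intro Max_ge) auto
        then show ?thesis using R by simp
      qed
      then have "X \<subseteq> {- int R..c}" using X by fastforce
      then show "finite {- int R..c} \<and> X \<subseteq> {- int R..c} \<and> {- int R..c} \<subseteq> {..c}" by auto
    qed
  qed
  ultimately show ?thesis by (rule filterlim_compose)
qed

section \<open>Convolution with path counts\<close>

context gen_fun
begin

lemma hs_qn_summable: "(\<lambda>z. hs j (x - z) * of_nat (qn k (z - c))) summable_on UNIV"
proof -
  obtain C where C: "0 \<le> C" "\<And>d. norm (hs j d) \<le> C * \<rho> powi (- d)" using hs_bound by blast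
  \<comment> \<open>Half the exponent of the decay \<rho>^(z - c) is given up to absorb the growth
    of the path counts.\<close>
  define \<kappa> where "\<kappa> = sqrt \<rho>"
  have \<kappa>: "0 < \<kappa>" "\<kappa> < 1" "\<rho> = \<kappa> * \<kappa>" using radii by (auto simp: \<kappa>_def)
  obtain C' where C': "0 \<le> C'" "\<And>d. real (qn k d) \<le> C' * \<kappa> powi (- d)"
    using qn_bound[OF \<kappa>(1,2)] by blast
  have "(\<lambda>z. norm (hs j (x - z) * of_nat (qn k (z - c)))) summable_on UNIV"
  proof (rule norm_summable_on_le)
    show "(\<lambda>z::int. (C * C' * \<rho> powi (c - x)) * \<kappa> ^ nat \<bar>z - c\<bar>) summable_on UNIV"
      using \<kappa> by (intro summable_on_cmult_right summable_on_geometric_shift) auto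
    fix z :: int
    show "norm (hs j (x - z) * of_nat (qn k (z - c))) \<le> (C * C' * \<rho> powi (c - x)) * \<kappa> ^ nat \<bar>z - c\<bar>"
    proof (cases "c \<le> z")
      case True
      have "norm (hs j (x - z) * of_nat (qn k (z - c))) \<le> (C * \<rho> powi (- (x - z))) * (C' * \<kappa> powi (- (z - c)))"
        unfolding norm_mult norm_of_nat using C C' radii by (intro mult_mono C(2) C'(2)) auto
      also have "\<rho> powi (- (x - z)) = \<rho> powi (c - x) * \<rho> powi (z - c)"
        using radii by (intro power_int_add_eq) auto
      also have "\<rho> powi (z - c) = \<kappa> powi (z - c) * \<kappa> powi (z - c)"
        unfolding \<kappa>(3) by (rule power_int_mult_distrib)
      also have "C * (\<rho> powi (c - x) * (\<kappa> powi (z - c) * \<kappa> powi (z - c))) * (C' * \<kappa> powi (- (z - c)))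
          = (C * C' * \<rho> powi (c - x)) * \<kappa> powi (z - c) * (\<kappa> powi (z - c) * \<kappa> powi (- (z - c)))"
        by (simp only: mult_ac)
      also have "\<kappa> powi (z - c) * \<kappa> powi (- (z - c)) = 1"
        using \<kappa> power_int_add_eq[of \<kappa> 0 "z - c" "- (z - c)"] by simp
      also have "\<kappa> powi (z - c) = \<kappa> ^ nat \<bar>z - c\<bar>" using True by (simp add: power_int_def)
      finally show ?thesis by simp
    next
      case False
      then show ?thesis using C C' \<kappa> radii by (simp add: qn_eq_0)
    qed
  qed
  then show ?thesis by (rule abs_summable_summable)
qed

text \<open>Summation over strict descents undoes a difference, so k steps lower the index of
  \<open>hs\<close> by k. In the induction the difference of the sums at x + 1 and x is evaluated
  twice: \<open>qn_rec\<close> reduces it to k steps, and \<open>hs_rec\<close> identifies it with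
  the sum at index j.\<close>

lemma has_sum_hs_qn:
  "((\<lambda>z. hs j (x - z) * of_nat (qn k (z - c))) has_sum hs (j - int k) (x - c)) UNIV"
proof (induction k arbitrary: j x)
  case 0
  show ?case by (rule has_sum_finite_neutralI[of "{c}"]) auto
next
  case (Suc k)
  let ?A = "\<lambda>x z. hs (j - 1) (x - z) * of_nat (qn (Suc k) (z - c))"
  have A: "(?A x has_sum infsum (?A x) UNIV) UNIV" for x by (intro has_sum_infsum hs_qn_summable)
  have B: "((\<lambda>z. hs (j - 1) (x - z) * of_nat (qn (Suc k) (z + 1 - c))) has_sum infsum (?A (x + 1)) UNIV) UNIV"
    using A[of "x + 1"]
    by (subst has_sum_reindex_bij_witness[where S = UNIV and i = "\<lambda>z. z - 1" and j = "\<lambda>z. z + 1"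
          and h = "?A (x + 1)"]) auto
  have "((\<lambda>z. hs (j - 1) (x - z) * of_nat (qn (Suc k) (z + 1 - c)) - ?A x z) has_sum
      infsum (?A (x + 1)) UNIV - infsum (?A x) UNIV) UNIV"
    by (rule has_sum_diff[OF B A])
  moreover have "hs (j - 1) (x - z) * of_nat (qn (Suc k) (z + 1 - c)) - ?A x z = hs (j - 1) (x - z) * of_nat (qn k (z - c))" for z
    using qn_rec[of k "z - c"] by (simp add: algebra_simps)
  ultimately have "infsum (?A (x + 1)) UNIV - infsum (?A x) UNIV = hs (j - 1 - int k) (x - c)"
    using has_sum_unique[OF _ Suc.IH[of "j - 1" x]] by simp
  moreover have "((\<lambda>z. ?A (x + 1) z - ?A x z) has_sum infsum (?A (x + 1)) UNIV - infsum (?A x) UNIV) UNIV"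
    by (rule has_sum_diff[OF A A])
  moreover have "?A (x + 1) z - ?A x z = hs j (x - z) * of_nat (qn (Suc k) (z - c))" for z
  proof -
    have "hs j (x - z) = hs (j - 1) (x + 1 - z) - hs (j - 1) (x - z)"
      using hs_rec[of j "x - z"] by (simp add: algebra_simps)
    then show ?thesis by (simp only: left_diff_distrib)
  qed
  ultimately show ?case by (simp add: algebra_simps)
qed

lemma has_sum_qn_hs:
  "((\<lambda>x'. of_nat (qn k (x - x')) * hs j (x' - c)) has_sum hs (j - int k) (x - c)) UNIV"
  using has_sum_hs_qn[of j x k c]
  by (subst has_sum_reindex_bij_witness[where S = UNIV and i = "\<lambda>z. x + c - z" and j = "\<lambda>x'. x + c - x'"
        and h = "\<lambda>z. hs j (x - z) * of_nat (qn k (z - c))"]) (auto simp: algebra_simps)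

end

lemma has_sum_sum_finite:
  fixes f :: "'b \<Rightarrow> 'a \<Rightarrow> complex"
  assumes "finite J" "\<And>l. l \<in> J \<Longrightarrow> (f l has_sum s l) A"
  shows "((\<lambda>x. \<Sum>l\<in>J. f l x) has_sum (\<Sum>l\<in>J. s l)) A"
  using assms by (induction J) (auto intro!: has_sum_add)

definition inverse_on :: "nat set \<Rightarrow> (nat \<Rightarrow> nat \<Rightarrow> complex) \<Rightarrow> (nat \<Rightarrow> nat \<Rightarrow> complex) \<Rightarrow> bool" where
  "inverse_on J Li L \<longleftrightarrow> (\<forall>i\<in>J. \<forall>j\<in>J. (\<Sum>k\<in>J. Li i k * L k j) = of_bool (i = j))"

context kernel_setting
begin

text \<open>Up to powers of \<alpha> and \<theta>, the adjoint of S_(-t,-n) applied to the column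
  Q^l(., y l). The index n - l is negative for l > n.\<close>

definition Psi :: "nat \<Rightarrow> nat \<Rightarrow> int \<Rightarrow> complex" where
  "Psi l n x = hs (int n - int l) (x - y l)"

text \<open>
  With \<open>P = Psi\<close> this is \<open>K_t\<close> conjugated by \<open>\<mu>\<close>; the parameter \<open>P\<close> makes room for the truncated
  functions \<open>PsiR\<close>.
\<close>

definition reduced_kernel :: "nat \<Rightarrow> (nat \<Rightarrow> nat \<Rightarrow> complex) \<Rightarrow> (nat \<Rightarrow> nat \<Rightarrow> int \<Rightarrow> complex) \<Rightarrow> nat \<times> int \<Rightarrow> nat \<times> int \<Rightarrow> complex" where
  "reduced_kernel M Li P = (\<lambda>(ni, x1) (nj, x2). - of_bool (ni < nj) * of_nat (qn (nj - ni) (x1 - x2))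
     + (\<Sum>k\<in>{1..M}. (\<Sum>l\<in>{1..M}. Li k l * P l ni x1) * Ek nj k x2))"

definition \<mu> :: "nat \<times> int \<Rightarrow> real" where
  "\<mu> = (\<lambda>(n, x). alpha \<theta> powi (- int n) * \<theta> powi x)"

lemma \<mu>_pos: "0 < \<mu> p"
  using alpha_pos theta01 by (auto simp: \<mu>_def split: prod.splits)

lemma \<mu>_quotient: "\<mu> (ni, x1) / \<mu> (nj, x2) = alpha \<theta> powi (int nj - int ni) * \<theta> powi (x1 - x2)"
  using alpha_pos theta01 by (simp add: \<mu>_def power_int_diff power_int_minus field_simps)

lemma hit_coef_eq:
  assumes "inverse_on {1..M} Li Lmat" "M \<le> N" "k \<in> {1..M}"
  shows "hit_coef k z = (\<Sum>l\<in>{1..M}. Li k l * of_nat (qn l (z - y l)))"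
proof -
  have "(\<Sum>l\<in>{1..M}. Li k l * of_nat (qn l (z - y l))) = (\<Sum>l\<in>{1..M}. \<Sum>i\<in>{1..M}. Li k l * Lmat l i * hit_coef i z)"
  proof (intro sum.cong refl)
    fix l assume "l \<in> {1..M}"
    then show "Li k l * of_nat (qn l (z - y l)) = (\<Sum>i\<in>{1..M}. Li k l * Lmat l i * hit_coef i z)"
      using sum_Lmat_hit_coef[of l M z] assms(2) by (simp only: sum_distrib_left[symmetric] mult.assoc)
  qed
  also have "\<dots> = (\<Sum>i\<in>{1..M}. (\<Sum>l\<in>{1..M}. Li k l * Lmat l i) * hit_coef i z)"
    by (subst sum.swap) (simp add: sum_distrib_right)
  also have "\<dots> = (\<Sum>i\<in>{1..M}. of_bool (k = i) * hit_coef i z)"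
    using assms(1,3) by (intro sum.cong refl) (simp add: inverse_on_def)
  also have "\<dots> = hit_coef k z" using assms(3) by simp
  finally show ?thesis ..
qed

text \<open>By \<open>hit_coef_eq\<close> the second factor depends on z through path counts from z
  to y l only, and their convolution with \<open>hs\<close> is \<open>Psi\<close>. The elementary
  factors form the quotient of the values of \<open>\<mu>\<close>.\<close>

lemma has_sum_kernel_comp:
  assumes "inverse_on {1..M} Li Lmat" "M \<le> N" "ni \<in> {1..M}" "nj \<in> {1..M}"
  shows "((\<lambda>z. kernel_adj (S_ker pw \<theta> r t ni) x1 z * Sbar_epi N y pw \<theta> \<delta> t nj z x2) has_sum
     of_real (\<mu> (ni, x1) / \<mu> (nj, x2)) * (\<Sum>k\<in>{1..M}. (\<Sum>l\<in>{1..M}. Li k l * Psi l ni x1) * Ek nj k x2)) UNIV"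
proof -
  have "((\<lambda>z. of_real (\<mu> (ni, x1) / \<mu> (nj, x2)) * (\<Sum>k\<in>{1..M}. (\<Sum>l\<in>{1..M}. Li k l * (hs (int ni) (x1 - z) * of_nat (qn l (z - y l)))) * Ek nj k x2)) has_sum
     of_real (\<mu> (ni, x1) / \<mu> (nj, x2)) * (\<Sum>k\<in>{1..M}. (\<Sum>l\<in>{1..M}. Li k l * Psi l ni x1) * Ek nj k x2)) UNIV"
    unfolding Psi_def
    by (intro has_sum_cmult_right has_sum_sum_finite has_sum_cmult_left has_sum_hs_qn) auto
  moreover have "of_real (\<mu> (ni, x1) / \<mu> (nj, x2)) * (\<Sum>k\<in>{1..M}. (\<Sum>l\<in>{1..M}. Li k l * (hs (int ni) (x1 - z) * of_nat (qn l (z - y l)))) * Ek nj k x2)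
      = kernel_adj (S_ker pw \<theta> r t ni) x1 z * Sbar_epi N y pw \<theta> \<delta> t nj z x2" for z
  proof -
    have "(\<Sum>k\<in>{1..M}. (\<Sum>l\<in>{1..M}. Li k l * (hs (int ni) (x1 - z) * of_nat (qn l (z - y l)))) * Ek nj k x2)
        = (\<Sum>k\<in>{1..M}. hs (int ni) (x1 - z) * (Ek nj k x2 * hit_coef k z))"
      using assms(1,2) by (intro sum.cong refl) (simp add: hit_coef_eq sum_distrib_left sum_distrib_right mult_ac)
    also have "\<dots> = hs (int ni) (x1 - z) * (\<Sum>k\<in>{1..nj}. Ek nj k x2 * hit_coef k z)"
      unfolding sum_distrib_left using assms(4) by (intro sum.mono_neutral_right) (auto simp: Ek_eq_0)
    finally have *: "(\<Sum>k\<in>{1..M}. (\<Sum>l\<in>{1..M}. Li k l * (hs (int ni) (x1 - z) * of_nat (qn l (z - y l)))) * Ek nj k x2)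
        = hs (int ni) (x1 - z) * (\<Sum>k\<in>{1..nj}. Ek nj k x2 * hit_coef k z)" .
    have "\<mu> (ni, x1) / \<mu> (nj, x2) = (alpha \<theta> powi (1 - int ni) * alpha \<theta> ^ (nj - 1)) * (\<theta> powi (x1 - z) * \<theta> powi (z - x2))"
    proof -
      have "alpha \<theta> powi (int nj - int ni) = alpha \<theta> powi (1 - int ni) * alpha \<theta> powi (int (nj - 1))"
        using alpha_pos assms(4) by (intro power_int_add_eq) auto
      moreover have "\<theta> powi (x1 - x2) = \<theta> powi (x1 - z) * \<theta> powi (z - x2)"
        using theta01 by (intro power_int_add_eq) auto
      ultimately show ?thesis by (simp add: \<mu>_quotient)
    qed
    then show ?thesis
      unfolding * kernel_adj_def S_ker_eq using assms(2,4) by (subst Sbar_epi_eq) (auto simp: mult_ac)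
  qed
  ultimately show ?thesis by simp
qed

lemma kernel_comp_converges_S_Sbar:
  assumes "inverse_on {1..M} Li Lmat" "M \<le> N" "ni \<in> {1..M}" "nj \<in> {1..M}"
  shows "kernel_comp_converges (kernel_adj (S_ker pw \<theta> r t ni)) (Sbar_epi N y pw \<theta> \<delta> t nj)"
  unfolding kernel_comp_converges_def
  using has_sum_imp_summable[OF has_sum_kernel_comp[OF assms]]
  by (simp add: summable_on_iff_abs_summable_on_complex)

lemma K_ext_eq:
  assumes "inverse_on {1..M} Li Lmat" "M \<le> N" "ni \<in> {1..M}" "nj \<in> {1..M}"
  shows "K_ext N y pw \<theta> r \<delta> t (ni, x1) (nj, x2) = of_real (\<mu> (ni, x1) / \<mu> (nj, x2)) * reduced_kernel M Li Psi (ni, x1) (nj, x2)"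
proof -
  have "kernel_comp (kernel_adj (S_ker pw \<theta> r t ni)) (Sbar_epi N y pw \<theta> \<delta> t nj) x1 x2
      = of_real (\<mu> (ni, x1) / \<mu> (nj, x2)) * (\<Sum>k\<in>{1..M}. (\<Sum>l\<in>{1..M}. Li k l * Psi l ni x1) * Ek nj k x2)"
    unfolding kernel_comp_def by (rule infsumI[OF has_sum_kernel_comp[OF assms]])
  moreover have "Q_pow \<theta> r (nj - ni) x1 x2 * of_bool (ni < nj)
      = of_real (\<mu> (ni, x1) / \<mu> (nj, x2)) * (of_bool (ni < nj) * of_nat (qn (nj - ni) (x1 - x2)))"
  proof (cases "ni < nj")
    case True
    then have eq: "alpha \<theta> ^ (nj - ni) = alpha \<theta> powi (int nj - int ni)"
      by (simp add: power_int_def nat_diff_distrib')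
    show ?thesis using True unfolding Q_pow_eq \<mu>_quotient eq by simp
  qed simp
  ultimately show ?thesis
    unfolding K_ext_def reduced_kernel_def by (simp add: ring_distribs)
qed

text \<open>
  \<open>Psi l n = Q^(M-n) Psi l M\<close> up to normalisation. Truncating this sum rather than \<open>Psi\<close> itself
  makes the linear system on a finite window exactly solvable.
\<close>

definition PsiR :: "nat \<Rightarrow> nat \<Rightarrow> nat \<Rightarrow> nat \<Rightarrow> int \<Rightarrow> complex" where
  "PsiR M R l n x = (\<Sum>x'\<in>{- int R..x}. of_nat (qn (M - n) (x - x')) * Psi l M x')"

lemma PsiR_tendsto:
  assumes "n \<le> M"
  shows "(\<lambda>R. PsiR M R l n x) \<longlonglongrightarrow> Psi l n x"
proof -
  have "((\<lambda>x'. of_nat (qn (M - n) (x - x')) * Psi l M x') has_sum Psi l n x) UNIV"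
    using has_sum_qn_hs[of "M - n" x "int M - int l" "y l"] assms by (simp add: Psi_def of_nat_diff)
  then show ?thesis
    unfolding PsiR_def by (rule has_sum_int_partial) (simp add: qn_eq_0)
qed

text \<open>Uniform in R because the terms are estimated in norm and compared with the full
  geometric series; the path counts use up a factor sqrt \<rho> of the decay.\<close>

lemma PsiR_bound:
  assumes "n \<le> M"
  obtains C where "0 \<le> C" "\<And>R x. norm (PsiR M R l n x) \<le> C * \<rho> powi (- x)"
proof -
  obtain C where C: "0 \<le> C" "\<And>d. norm (hs (int M - int l) d) \<le> C * \<rho> powi (- d)" using hs_bound by blast
  define \<kappa> where "\<kappa> = sqrt \<rho>"
  have \<kappa>: "0 < \<kappa>" "\<kappa> < 1" "\<rho> = \<kappa> * \<kappa>" using radii by (auto simp: \<kappa>_def)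
  obtain C' where C': "0 \<le> C'" "\<And>d. real (qn (M - n) d) \<le> C' * \<kappa> powi (- d)"
    using qn_bound[OF \<kappa>(1,2)] by blast
  define D where "D = C * C' * \<rho> powi y l"
  define G where "G = (\<Sum>\<^sub>\<infinity>z::int. \<kappa> ^ nat \<bar>z\<bar>)"
  have D: "0 \<le> D" using C C' radii by (simp add: D_def)
  have G: "0 \<le> G" unfolding G_def using \<kappa> by (intro infsum_nonneg) auto
  show thesis
  proof (rule that[of "D * G"])
    fix R x
    have "norm (PsiR M R l n x) \<le> (\<Sum>x'\<in>{- int R..x}. (D * \<rho> powi (- x)) * \<kappa> ^ nat \<bar>x - x'\<bar>)"
      unfolding PsiR_def
    proof (intro order.trans[OF norm_sum] sum_mono)
      fix x' assume x': "x' \<in> {- int R..x}"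
      have "norm (of_nat (qn (M - n) (x - x')) * Psi l M x') \<le> (C' * \<kappa> powi (- (x - x'))) * (C * \<rho> powi (- (x' - y l)))"
        unfolding norm_mult norm_of_nat Psi_def using C C' \<kappa> by (intro mult_mono C(2) C'(2)) auto
      also have "\<rho> powi (- (x' - y l)) = \<rho> powi (y l) * \<rho> powi (- x')"
        using radii by (intro power_int_add_eq) auto
      also have "\<rho> powi (- x') = \<rho> powi (- x) * \<rho> powi (x - x')"
        using radii by (intro power_int_add_eq) auto
      also have "\<rho> powi (x - x') = \<kappa> powi (x - x') * \<kappa> powi (x - x')"
        unfolding \<kappa>(3) by (rule power_int_mult_distrib)
      also have "C' * \<kappa> powi (- (x - x')) * (C * (\<rho> powi (y l) * (\<rho> powi (- x) * (\<kappa> powi (x - x') * \<kappa> powi (x - x')))))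
          = (D * \<rho> powi (- x)) * \<kappa> powi (x - x') * (\<kappa> powi (x - x') * \<kappa> powi (- (x - x')))"
        by (simp only: mult_ac D_def)
      also have "\<kappa> powi (x - x') * \<kappa> powi (- (x - x')) = 1"
        using \<kappa> power_int_add_eq[of \<kappa> 0 "x - x'" "- (x - x')"] by simp
      also have "\<kappa> powi (x - x') = \<kappa> ^ nat \<bar>x - x'\<bar>" using x' by (simp add: power_int_def)
      finally show "norm (of_nat (qn (M - n) (x - x')) * Psi l M x') \<le> (D * \<rho> powi (- x)) * \<kappa> ^ nat \<bar>x - x'\<bar>" by simp
    qed
    also have "\<dots> = (D * \<rho> powi (- x)) * (\<Sum>z\<in>(\<lambda>x'. x - x') ` {- int R..x}. \<kappa> ^ nat \<bar>z\<bar>)"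
      unfolding sum_distrib_left[symmetric] by (subst sum.reindex) (auto simp: inj_on_def)
    also have "\<dots> \<le> (D * \<rho> powi (- x)) * G"
      unfolding G_def using D radii \<kappa>
      by (intro mult_left_mono finite_sum_le_infsum summable_on_geometric_int) auto
    finally show "norm (PsiR M R l n x) \<le> D * G * \<rho> powi (- x)" by (simp add: mult_ac)
  qed (use D G in simp)
qed

end

section \<open>Truncation to finite windows\<close>

lemma powi_exponent_le:
  fixes \<beta> :: real
  assumes "0 < \<beta>" "\<beta> < 1" "e2 \<le> e1" "x \<le> A"
  shows "\<beta> powi (- (e1 * x)) \<le> \<beta> powi (- ((e1 - e2) * A)) * \<beta> powi (- (e2 * x))"
proof -
  have "\<beta> powi (- (e1 * x)) = \<beta> powi (- ((e1 - e2) * x)) * \<beta> powi (- (e2 * x))"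
    using assms(1) by (intro power_int_add_eq) (auto simp: algebra_simps)
  also have "\<beta> powi (- ((e1 - e2) * x)) \<le> \<beta> powi (- ((e1 - e2) * A))"
    using assms by (intro power_int_decreasing) (auto intro: mult_left_mono)
  finally show ?thesis using assms(1) by (simp add: mult_right_mono)
qed

lemma finite_uniform_bound:
  assumes "finite J" "\<And>j. j \<in> J \<Longrightarrow> \<exists>C\<ge>0. \<forall>x\<in>X. f j x \<le> C * h j x"
    and "\<And>j x. j \<in> J \<Longrightarrow> x \<in> X \<Longrightarrow> 0 \<le> (h j x :: real)"
  shows "\<exists>C\<ge>0. \<forall>j\<in>J. \<forall>x\<in>X. f j x \<le> C * h j x"
proof -
  obtain c where c: "\<And>j. j \<in> J \<Longrightarrow> 0 \<le> c j \<and> (\<forall>x\<in>X. f j x \<le> c j * h j x)"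
    using assms(2) by metis
  show ?thesis
  proof (intro exI[of _ "\<Sum>j\<in>J. c j"] conjI ballI)
    show "0 \<le> (\<Sum>j\<in>J. c j)" using c by (intro sum_nonneg) auto
    fix j x assume jx: "j \<in> J" "x \<in> X"
    have "c j \<le> (\<Sum>j\<in>J. c j)" using c jx assms(1) by (intro member_le_sum) auto
    then show "f j x \<le> (\<Sum>j\<in>J. c j) * h j x"
      using c[OF jx(1)] jx assms(3)[OF jx] mult_right_mono order_trans by blast
  qed
qed

context kernel_setting
begin

text \<open>The decay \<rho>^(-x) of \<open>Psi\<close> towards -\<infinity> is divided into 2 M + 2
  equal steps \<beta>. Level n is given the weight \<beta>^(-2 n x), and a further factor
  \<beta>^(-x) on either side is left for summability; the exponents 2 n + 1 needed for this stay
  below 2 M + 2 when n \<le> M.\<close>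

definition rate :: "nat \<Rightarrow> real" where
  "rate M = \<rho> powr (1 / (2 * real M + 2))"

lemma rate01: "0 < rate M" "rate M < 1"
  using radii powr_less_mono2[of "1 / (2 * real M + 2)" \<rho> 1] by (auto simp: rate_def)

lemma rate_power: "rate M powi (int (2 * M + 2)) = \<rho>"
proof -
  have "rate M ^ (2 * M + 2) = \<rho> powr ((1 / (2 * real M + 2)) * real (2 * M + 2))"
    unfolding rate_def using radii by (subst powr_realpow[symmetric]) (auto simp: powr_powr)
  also have "(1 / (2 * real M + 2)) * real (2 * M + 2) = 1" by simp
  finally show ?thesis using radii by (simp only: power_int_of_nat) simp
qed

lemma Ek_bound_powi:
  assumes "1 \<le> e" "0 \<le> A"
  shows "\<exists>C\<ge>0. \<forall>x\<le>A. norm (Ek n k x) \<le> C * rate M powi (e * x)"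
proof -
  let ?\<beta> = "rate M"
  have \<beta>: "0 < ?\<beta>" "?\<beta> < 1" by (rule rate01)+
  obtain C where C: "0 \<le> C" "\<And>x. norm (Ek n k x) \<le> C * (1 / ?\<beta>) ^ nat \<bar>x\<bar>"
    using Ek_bound[of "1 / ?\<beta>" n k] \<beta> by auto
  define D where "D = ?\<beta> powi (- (2 * A)) * ?\<beta> powi (- ((e - 1) * A))"
  show ?thesis
  proof (intro exI[of _ "C * D"] conjI allI impI)
    fix x :: int assume x: "x \<le> A"
    have "(1 / ?\<beta>) ^ nat \<bar>x\<bar> = ?\<beta> powi (- \<bar>x\<bar>)"
      using \<beta> by (simp add: power_int_def power_one_over inverse_eq_divide)
    \<comment> \<open>Uses |x| \<le> 2 A - x, valid for x \<le> A as A \<ge> 0.\<close>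
    also have "\<dots> \<le> ?\<beta> powi (- (2 * A) + x)"
      using \<beta> x assms(2) by (intro power_int_decreasing) auto
    also have "\<dots> = ?\<beta> powi (- (2 * A)) * ?\<beta> powi (- (- 1 * x))"
      using \<beta> by (intro power_int_add_eq) auto
    also have "\<dots> \<le> ?\<beta> powi (- (2 * A)) * (?\<beta> powi (- ((- 1 - (- e)) * A)) * ?\<beta> powi (- (- e * x)))"
      using \<beta> assms x by (intro mult_left_mono powi_exponent_le) auto
    also have "\<dots> = D * ?\<beta> powi (e * x)" by (simp add: D_def)
    finally have "C * (1 / ?\<beta>) ^ nat \<bar>x\<bar> \<le> C * (D * ?\<beta> powi (e * x))"
      by (rule mult_left_mono) (rule C)
    then show "norm (Ek n k x) \<le> C * D * ?\<beta> powi (e * x)" using C(2)[of x] by (simp add: mult.assoc)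
  qed (use C \<beta> in \<open>auto simp: D_def intro!: mult_nonneg_nonneg\<close>)
qed

lemma PsiR_bound_powi:
  assumes "n \<le> M" "e \<le> int (2 * M + 2)"
  shows "\<exists>C\<ge>0. \<forall>x\<le>A. \<forall>R. norm (PsiR M R l n x) \<le> C * rate M powi (- (e * x))"
proof -
  let ?\<beta> = "rate M"
  obtain C where C: "0 \<le> C" "\<And>R x. norm (PsiR M R l n x) \<le> C * \<rho> powi (- x)"
    using PsiR_bound[OF assms(1)] by blast
  show ?thesis
  proof (intro exI[of _ "C * ?\<beta> powi (- ((int (2 * M + 2) - e) * A))"] conjI allI impI)
    fix x R assume x: "x \<le> A"
    have "\<rho> powi (- x) = (?\<beta> powi (int (2 * M + 2))) powi (- x)" by (simp only: rate_power)
    also have "\<dots> = ?\<beta> powi (- (int (2 * M + 2) * x))"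
      by (simp only: power_int_mult[symmetric] mult_minus_right)
    also have "\<dots> \<le> ?\<beta> powi (- ((int (2 * M + 2) - e) * A)) * ?\<beta> powi (- (e * x))"
      by (intro powi_exponent_le rate01 assms x)
    finally have "C * \<rho> powi (- x) \<le> C * (?\<beta> powi (- ((int (2 * M + 2) - e) * A)) * ?\<beta> powi (- (e * x)))"
      by (rule mult_left_mono) (rule C)
    then show "norm (PsiR M R l n x) \<le> C * ?\<beta> powi (- ((int (2 * M + 2) - e) * A)) * ?\<beta> powi (- (e * x))"
      using C(2)[of R x] by (simp only: mult.assoc)
  qed (use C rate01[of M] in \<open>auto intro!: mult_nonneg_nonneg\<close>)
qed

text \<open>For n_i < n_j the exponents satisfy 2 n_i + 1 \<le> 2 n_j - 1. This is why the weights
  advance by two steps per level: one step pays for summability in each of the two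
  variables.\<close>

lemma qn_bound_powi:
  assumes "ni < nj"
  shows "\<exists>C\<ge>0. \<forall>x1\<le>A. \<forall>x2. real (qn d (x1 - x2))
    \<le> C * (rate M powi (- ((2 * int ni + 1) * x1)) * rate M powi ((2 * int nj - 1) * x2))"
proof -
  let ?\<beta> = "rate M"
  have \<beta>: "0 < ?\<beta>" "?\<beta> < 1" by (rule rate01)+
  define e where "e = 2 * int nj - 1"
  have e: "1 \<le> e" "2 * int ni + 1 \<le> e" using assms by (auto simp: e_def)
  define \<kappa> where "\<kappa> = ?\<beta> powi e"
  have "\<kappa> = ?\<beta> ^ nat e" using e by (simp add: \<kappa>_def power_int_def)
  then have \<kappa>: "0 < \<kappa>" "\<kappa> < 1" using \<beta> e by (auto simp: power_less_one_iff)
  obtain C where C: "0 \<le> C" "\<And>z. real (qn d z) \<le> C * \<kappa> powi (- z)" using qn_bound[OF \<kappa>] by blast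
  let ?D = "?\<beta> powi (- ((e - (2 * int ni + 1)) * A))"
  show ?thesis
    unfolding e_def[symmetric]
  proof (intro exI[of _ "C * ?D"] conjI allI impI)
    fix x1 x2 :: int assume x1: "x1 \<le> A"
    have "\<kappa> powi (- (x1 - x2)) = ?\<beta> powi (e * - (x1 - x2))"
      unfolding \<kappa>_def by (simp only: power_int_mult)
    also have "\<dots> = ?\<beta> powi (- (e * x1)) * ?\<beta> powi (e * x2)"
      using \<beta> by (intro power_int_add_eq) (auto simp: algebra_simps)
    also have "\<dots> \<le> (?D * ?\<beta> powi (- ((2 * int ni + 1) * x1))) * ?\<beta> powi (e * x2)"
      using \<beta> by (intro mult_right_mono powi_exponent_le e x1) auto
    finally have "C * \<kappa> powi (- (x1 - x2)) \<le> C * ((?D * ?\<beta> powi (- ((2 * int ni + 1) * x1))) * ?\<beta> powi (e * x2))"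
      by (rule mult_left_mono) (rule C)
    then show "real (qn d (x1 - x2)) \<le> C * ?D * (?\<beta> powi (- ((2 * int ni + 1) * x1)) * ?\<beta> powi (e * x2))"
      using C(2)[of "x1 - x2"] by (simp only: mult.assoc)
  qed (use C \<beta> in \<open>auto intro!: mult_nonneg_nonneg\<close>)
qed

lemma reduced_kernel_bound:
  assumes "ni \<in> {1..M}" "nj \<in> {1..M}" "0 \<le> A"
  shows "\<exists>C\<ge>0. \<forall>x1\<le>A. \<forall>x2\<le>A. \<forall>R. norm (reduced_kernel M Li (PsiR M R) (ni, x1) (nj, x2))
    \<le> C * (rate M powi (- ((2 * int ni + 1) * x1)) * rate M powi ((2 * int nj - 1) * x2))"
proof -
  let ?\<beta> = "rate M"
  have \<beta>: "0 < ?\<beta>" "?\<beta> < 1" by (rule rate01)+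
  have "\<forall>k. \<exists>C\<ge>0. \<forall>x\<le>A. norm (Ek nj k x) \<le> C * ?\<beta> powi ((2 * int nj - 1) * x)"
    using assms by (intro allI Ek_bound_powi) auto
  then obtain CE where CE: "\<And>k. 0 \<le> CE k" "\<And>k x. x \<le> A \<Longrightarrow> norm (Ek nj k x) \<le> CE k * ?\<beta> powi ((2 * int nj - 1) * x)"
    by metis
  have "\<forall>l. \<exists>C\<ge>0. \<forall>x\<le>A. \<forall>R. norm (PsiR M R l ni x) \<le> C * ?\<beta> powi (- ((2 * int ni + 1) * x))"
    using assms by (intro allI PsiR_bound_powi) auto
  then obtain CP where CP: "\<And>l. 0 \<le> CP l" "\<And>l x R. x \<le> A \<Longrightarrow> norm (PsiR M R l ni x) \<le> CP l * ?\<beta> powi (- ((2 * int ni + 1) * x))"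
    by metis
  obtain CQ where CQ: "0 \<le> CQ" "\<And>x1 x2. x1 \<le> A \<Longrightarrow> ni < nj \<Longrightarrow> real (qn (nj - ni) (x1 - x2))
    \<le> CQ * (?\<beta> powi (- ((2 * int ni + 1) * x1)) * ?\<beta> powi ((2 * int nj - 1) * x2))"
    using qn_bound_powi[of ni nj A "nj - ni" M] by (cases "ni < nj") auto
  define C where "C = CQ + (\<Sum>k\<in>{1..M}. (\<Sum>l\<in>{1..M}. norm (Li k l) * CP l) * CE k)"
  show ?thesis
  proof (intro exI[of _ C] conjI allI impI)
    show "0 \<le> C" using CE CP CQ by (auto simp: C_def intro!: add_nonneg_nonneg sum_nonneg mult_nonneg_nonneg)
    fix x1 x2 R assume x: "x1 \<le> A" "x2 \<le> A"
    let ?b1 = "?\<beta> powi (- ((2 * int ni + 1) * x1))" and ?b2 = "?\<beta> powi ((2 * int nj - 1) * x2)"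
    have b: "0 \<le> ?b1" "0 \<le> ?b2" using \<beta> by auto
    have 1: "norm (- of_bool (ni < nj) * complex_of_nat (qn (nj - ni) (x1 - x2))) \<le> CQ * (?b1 * ?b2)"
      using CQ(2)[OF x(1), of x2] CQ(1) b by (cases "ni < nj") (auto simp: norm_mult)
    have 2: "norm (\<Sum>k\<in>{1..M}. (\<Sum>l\<in>{1..M}. Li k l * PsiR M R l ni x1) * Ek nj k x2)
        \<le> (\<Sum>k\<in>{1..M}. (\<Sum>l\<in>{1..M}. norm (Li k l) * (CP l * ?b1)) * (CE k * ?b2))"
    proof (intro order.trans[OF norm_sum] sum_mono)
      fix k
      have "norm (\<Sum>l\<in>{1..M}. Li k l * PsiR M R l ni x1) \<le> (\<Sum>l\<in>{1..M}. norm (Li k l) * (CP l * ?b1))"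
        unfolding norm_mult by (intro order.trans[OF norm_sum] sum_mono) (simp add: norm_mult mult_left_mono CP(2)[OF x(1)])
      then show "norm ((\<Sum>l\<in>{1..M}. Li k l * PsiR M R l ni x1) * Ek nj k x2)
          \<le> (\<Sum>l\<in>{1..M}. norm (Li k l) * (CP l * ?b1)) * (CE k * ?b2)"
        unfolding norm_mult using CP(1) b CE(2)[OF x(2)]
        by (intro mult_mono) (auto intro!: sum_nonneg)
    qed
    have "(\<Sum>k\<in>{1..M}. (\<Sum>l\<in>{1..M}. norm (Li k l) * (CP l * ?b1)) * (CE k * ?b2))
        = (\<Sum>k\<in>{1..M}. (\<Sum>l\<in>{1..M}. norm (Li k l) * CP l) * CE k) * (?b1 * ?b2)"
      unfolding sum_distrib_right by (intro sum.cong refl) (simp add: sum_distrib_right mult_ac)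
    then have "norm (reduced_kernel M Li (PsiR M R) (ni, x1) (nj, x2)) \<le> CQ * (?b1 * ?b2)
        + (\<Sum>k\<in>{1..M}. (\<Sum>l\<in>{1..M}. norm (Li k l) * CP l) * CE k) * (?b1 * ?b2)"
      unfolding reduced_kernel_def prod.case
      using order.trans[OF norm_triangle_ineq add_mono[OF 1 2]] by simp
    then show "norm (reduced_kernel M Li (PsiR M R) (ni, x1) (nj, x2)) \<le> C * (?b1 * ?b2)"
      by (simp add: C_def distrib_right)
  qed
qed

end

locale threshold_setting = kernel_setting +
  fixes M :: nat and I :: "nat set" and a :: "nat \<Rightarrow> int" and Li :: "nat \<Rightarrow> nat \<Rightarrow> complex"
  assumes I: "I \<subseteq> {1..M}" "M \<in> I" "M \<le> N"
    \<comment> \<open>Coordinates decrease, so a threshold \<open>a M\<close> at an unselected level is no constraint.\<close>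
    and a_const: "\<And>n. n \<notin> I \<Longrightarrow> a n = a M"
    and Li: "inverse_on {1..M} Li Lmat"
begin

definition window :: "nat \<Rightarrow> (nat \<times> int) set" where
  "window R = {(n, x). n \<in> I \<and> - int R \<le> x \<and> x \<le> a n}"

definition chi :: "nat \<times> int \<Rightarrow> complex" where
  "chi = (\<lambda>(n, x). of_bool (n \<in> I \<and> x \<le> a n))"

definition K_limit :: "nat \<times> int \<Rightarrow> nat \<times> int \<Rightarrow> complex" where
  "K_limit p q = chi p * (of_real (\<mu> p / \<mu> q) * reduced_kernel M Li Psi p q) * chi q"

definition K_cut :: "nat \<Rightarrow> nat \<times> int \<Rightarrow> nat \<times> int \<Rightarrow> complex" where
  "K_cut R p q = of_bool (p \<in> window R) * (of_real (\<mu> p / \<mu> q) * reduced_kernel M Li (PsiR M R) p q) * of_bool (q \<in> window R)"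

lemma finite_I: "finite I" using I finite_subset by blast

lemma finite_window: "finite (window R)"
proof -
  have "window R \<subseteq> (\<Union>n\<in>I. {n} \<times> {- int R..a n})" by (auto simp: window_def)
  then show ?thesis using finite_I finite_subset by fastforce
qed

lemma K_cut_tendsto:
  assumes "p \<in> I \<times> UNIV" "q \<in> I \<times> UNIV"
  shows "(\<lambda>R. K_cut R p q) \<longlonglongrightarrow> K_limit p q"
proof -
  have cut: "(\<lambda>R. of_bool (p \<in> window R) :: complex) \<longlonglongrightarrow> chi p" for p
  proof (rule tendsto_eventually)
    show "\<forall>\<^sub>F R in sequentially. of_bool (p \<in> window R) = chi p"
      by (rule eventually_sequentiallyI[of "nat (- snd p)"]) (auto simp: window_def chi_def split: prod.splits)
  qed
  obtain ni x1 nj x2 where pq: "p = (ni, x1)" "q = (nj, x2)" by (cases p; cases q) auto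
  have "ni \<le> M" using assms I pq by auto
  then have "(\<lambda>R. reduced_kernel M Li (PsiR M R) p q) \<longlonglongrightarrow> reduced_kernel M Li Psi p q"
    unfolding pq reduced_kernel_def by (auto intro!: tendsto_intros PsiR_tendsto)
  then show ?thesis unfolding K_cut_def K_limit_def by (intro tendsto_intros cut)
qed

lemma fredholm_det_K_cut:
  "fredholm_det (I \<times> UNIV) (K_cut R) = dset (\<lambda>p q. of_bool (p = q) - reduced_kernel M Li (PsiR M R) p q) (window R)"
proof -
  have "fredholm_det (I \<times> UNIV) (K_cut R) = dset (\<lambda>p q. of_bool (p = q) - K_cut R p q) (window R)"
    by (rule fredholm_det_finite_support[OF finite_window]) (auto simp: window_def K_cut_def)
  also have "\<dots> = dset (\<lambda>p q. of_real (\<mu> p) * (of_bool (p = q) - reduced_kernel M Li (PsiR M R) p q) / of_real (\<mu> q)) (window R)"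
    using \<mu>_pos by (intro dset_cong) (auto simp: K_cut_def right_diff_distrib diff_divide_distrib dest: less_imp_neq[symmetric])
  also have "\<dots> = dset (\<lambda>p q. of_bool (p = q) - reduced_kernel M Li (PsiR M R) p q) (window R)"
    using \<mu>_pos by (intro dset_conjugate finite_window) (auto dest: less_imp_neq[symmetric])
  finally show ?thesis .
qed

lemma K_limit_fredholm:
  "fredholm_converges (I \<times> UNIV) K_limit"
  "(\<lambda>R. dset (\<lambda>p q. of_bool (p = q) - reduced_kernel M Li (PsiR M R) p q) (window R)) \<longlonglongrightarrow> fredholm_det (I \<times> UNIV) K_limit"
proof -
  let ?\<beta> = "rate M"
  have \<beta>: "0 < ?\<beta>" "?\<beta> < 1" by (rule rate01)+
  define A where "A = Max (insert 0 (a ` I))"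
  have A: "0 \<le> A" "n \<in> I \<Longrightarrow> a n \<le> A" for n using finite_I by (auto simp: A_def)
  let ?h = "\<lambda>(ni, nj) (x1, x2, R::nat). ?\<beta> powi (- ((2 * int ni + 1) * x1)) * ?\<beta> powi ((2 * int nj - 1) * x2)"
  have "\<exists>C\<ge>0. \<forall>nn\<in>I \<times> I. \<forall>xx\<in>{(x1, x2, R::nat). x1 \<le> A \<and> x2 \<le> A}.
      (\<lambda>(ni, nj) (x1, x2, R). norm (reduced_kernel M Li (PsiR M R) (ni, x1) (nj, x2))) nn xx \<le> C * ?h nn xx"
  proof (rule finite_uniform_bound)
    fix nn assume nn: "nn \<in> I \<times> I"
    obtain ni nj where n: "nn = (ni, nj)" by (cases nn)
    have "ni \<in> {1..M}" "nj \<in> {1..M}" using nn n I(1) by auto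
    then obtain C where "0 \<le> C" "\<forall>x1\<le>A. \<forall>x2\<le>A. \<forall>R. norm (reduced_kernel M Li (PsiR M R) (ni, x1) (nj, x2))
      \<le> C * (?\<beta> powi (- ((2 * int ni + 1) * x1)) * ?\<beta> powi ((2 * int nj - 1) * x2))"
      using reduced_kernel_bound[OF _ _ A(1), of ni M nj Li] by blast
    then show "\<exists>C\<ge>0. \<forall>xx\<in>{(x1, x2, R::nat). x1 \<le> A \<and> x2 \<le> A}.
      (\<lambda>(ni, nj) (x1, x2, R). norm (reduced_kernel M Li (PsiR M R) (ni, x1) (nj, x2))) nn xx \<le> C * ?h nn xx"
      unfolding n by (intro exI[of _ C]) auto
  qed (use finite_I \<beta> in auto)
  then obtain C where C: "0 \<le> C" "\<And>ni nj x1 x2 R. ni \<in> I \<Longrightarrow> nj \<in> I \<Longrightarrow> x1 \<le> A \<Longrightarrow> x2 \<le> A \<Longrightarrow>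
      norm (reduced_kernel M Li (PsiR M R) (ni, x1) (nj, x2)) \<le> C * (?\<beta> powi (- ((2 * int ni + 1) * x1)) * ?\<beta> powi ((2 * int nj - 1) * x2))"
    by fastforce
  \<comment> \<open>The exponent \<open>2 n\<close> grows with the level, so that \<open>Q^(n_j - n_i)\<close>, which does not decay
    along the diagonal, is conjugated into something dominated by a product.\<close>
  define w where "w = (\<lambda>(n, x). \<mu> (n, x) * ?\<beta> powi (- (2 * int n * x)))"
  define g where "g = (\<lambda>(n, x). if x \<le> a n then sqrt C * ?\<beta> powi (- x) else 0)"
  interpret kd: kernel_domination "I \<times> UNIV" w g
  proof
    show "0 < w p" for p using \<mu>_pos \<beta> by (auto simp: w_def split: prod.splits)
    show "0 \<le> g p" for p using C \<beta> by (auto simp: g_def split: prod.splits)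
    have gb: "g (n, x) \<le> (sqrt C * ?\<beta> powi (- (2 * A))) * ?\<beta> ^ nat \<bar>x\<bar>" if "n \<in> I" for n x
    proof (cases "x \<le> a n")
      case True
      then have "x \<le> A" using A(2)[OF that] by simp
      have "?\<beta> powi (- x) \<le> ?\<beta> powi (- (2 * A) + \<bar>x\<bar>)"
        using \<beta> \<open>x \<le> A\<close> A(1) by (intro power_int_decreasing) auto
      also have "\<dots> = ?\<beta> powi (- (2 * A)) * ?\<beta> powi \<bar>x\<bar>"
        using \<beta> by (intro power_int_add_eq) auto
      also have "?\<beta> powi \<bar>x\<bar> = ?\<beta> ^ nat \<bar>x\<bar>" by (simp add: power_int_def)
      finally have "sqrt C * ?\<beta> powi (- x) \<le> sqrt C * (?\<beta> powi (- (2 * A)) * ?\<beta> ^ nat \<bar>x\<bar>)"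
        by (rule mult_left_mono) (use C in simp)
      then show ?thesis using True by (simp add: g_def mult.assoc)
    next
      case False
      then show ?thesis using \<beta> C by (simp add: g_def)
    qed
    have "(\<lambda>p. (\<lambda>(n, x). sqrt C * ?\<beta> powi (- (2 * A)) * ?\<beta> ^ nat \<bar>x\<bar>) p) summable_on (\<Union>n\<in>I. Pair n ` (UNIV :: int set))"
    proof (rule summable_on_finite_union_disjoint[OF finite_I])
      fix n
      show "(\<lambda>p. (\<lambda>(n, x). sqrt C * ?\<beta> powi (- (2 * A)) * ?\<beta> ^ nat \<bar>x\<bar>) p) summable_on (Pair n ` (UNIV :: int set))"
        using \<beta> by (subst summable_on_reindex) (auto simp: o_def inj_on_def intro!: summable_on_cmult_right summable_on_geometric_int)
    qed auto
    also have "(\<Union>n\<in>I. Pair n ` (UNIV :: int set)) = I \<times> UNIV" by auto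
    finally show "g summable_on I \<times> UNIV"
      by (rule summable_on_comparison_test) (use gb C \<beta> in \<open>auto simp: g_def\<close>)
  qed
  have dom: "kd.dominated (K_cut R)" for R
    unfolding kd.dominated_def
  proof (intro ballI)
    fix p q :: "nat \<times> int" assume pq: "p \<in> I \<times> UNIV" "q \<in> I \<times> UNIV"
    obtain ni x1 nj x2 where pq': "p = (ni, x1)" "q = (nj, x2)" by (cases p; cases q) auto
    show "norm (K_cut R p q) \<le> w p * g p * (g q / w q)"
    proof (cases "p \<in> window R \<and> q \<in> window R")
      case True
      then have x: "ni \<in> I" "nj \<in> I" "x1 \<le> a ni" "x2 \<le> a nj" by (auto simp: window_def pq')
      then have xA: "x1 \<le> A" "x2 \<le> A" using A(2) order_trans by blast+
      have "norm (K_cut R p q) = (\<mu> p / \<mu> q) * norm (reduced_kernel M Li (PsiR M R) p q)"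
        using True \<mu>_pos[of p] \<mu>_pos[of q] by (simp add: K_cut_def norm_mult norm_divide)
      also have "\<dots> \<le> (\<mu> p / \<mu> q) * (C * (?\<beta> powi (- ((2 * int ni + 1) * x1)) * ?\<beta> powi ((2 * int nj - 1) * x2)))"
        unfolding pq' using \<mu>_pos[of "(ni, x1)"] \<mu>_pos[of "(nj, x2)"]
        by (intro mult_left_mono C(2) x xA) (auto simp: less_imp_le)
      also have "?\<beta> powi (- ((2 * int ni + 1) * x1)) = ?\<beta> powi (- (2 * int ni * x1)) * ?\<beta> powi (- x1)"
        using \<beta> by (intro power_int_add_eq) (auto simp: algebra_simps)
      also have "?\<beta> powi ((2 * int nj - 1) * x2) = ?\<beta> powi (- x2) * inverse (?\<beta> powi (- (2 * int nj * x2)))"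
        unfolding power_int_minus[symmetric] using \<beta> by (intro power_int_add_eq) (auto simp: algebra_simps)
      also have "(\<mu> p / \<mu> q) * (C * (?\<beta> powi (- (2 * int ni * x1)) * ?\<beta> powi (- x1) *
            (?\<beta> powi (- x2) * inverse (?\<beta> powi (- (2 * int nj * x2))))))
          = w p * g p * (g q / w q)"
      proof -
        have "sqrt C * sqrt C = C" using C(1) by simp
        then show ?thesis
          using x by (simp add: pq' w_def g_def divide_inverse mult_ac)
      qed
      finally show ?thesis .
    next
      case False
      then have "K_cut R p q = 0" by (auto simp: K_cut_def)
      moreover have "0 \<le> w p * g p * (g q / w q)"
        using kd.weight_pos[OF pq(1)] kd.weight_pos[OF pq(2)] kd.bound_nonneg[OF pq(1)] kd.bound_nonneg[OF pq(2)]
        by simp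
      ultimately show ?thesis by simp
    qed
  qed
  show "fredholm_converges (I \<times> UNIV) K_limit"
    by (rule kd.fredholm_det_tendsto(2)[OF dom K_cut_tendsto])
  show "(\<lambda>R. dset (\<lambda>p q. of_bool (p = q) - reduced_kernel M Li (PsiR M R) p q) (window R)) \<longlonglongrightarrow> fredholm_det (I \<times> UNIV) K_limit"
    using kd.fredholm_det_tendsto(1)[OF dom K_cut_tendsto] by (simp add: fredholm_det_K_cut)
qed

end

section \<open>Reduction to a finite determinant\<close>

lemma qn_sum_shift:
  assumes "lo \<le> x'"
  shows "(\<Sum>z\<in>{lo..<x}. qn d (z - x')) = qn (Suc d) (x - x')"
proof (cases "lo \<le> x")
  case True
  have "(\<Sum>z\<in>{lo..<x}. qn d (z - x')) = (\<Sum>e\<in>{lo - x'..<x - x'}. qn d e)"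
    by (rule sum.reindex_bij_witness[where i = "\<lambda>e. e + x'" and j = "\<lambda>z. z - x'"]) auto
  then show ?thesis using qn_sum[of "lo - x'" "x - x'" d] assms True by simp
qed (use assms in \<open>simp add: qn_eq_0\<close>)

context kernel_setting
begin

lemma dset_Lmat: "dset Lmat {1..M} = 1"
proof -
  have "dset Lmat {1..M} = (\<Prod>k\<in>{1..M}. Lmat k k)"
    by (rule dset_graded[where \<mu> = "\<lambda>k. M - k"]) (auto simp: Lmat_def split: if_splits)
  moreover have "Lmat k k = 1" for k
    using has_fps_expansion_imp_0_eq_fps_nth_0[OF Gf] g_at_1 by (simp add: Lmat_def)
  ultimately show ?thesis by simp
qed

end

context threshold_setting
begin

text \<open>
  The values \<open>killed_sum f (M - n) x\<close> solve the unipotent system \<open>(1 + Q) v = Q^(M-n) f\<close> on the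
  window: each summation starts above the threshold of the level it leaves.
\<close>

primrec killed_sum :: "(int \<Rightarrow> complex) \<Rightarrow> nat \<Rightarrow> int \<Rightarrow> complex" where
  "killed_sum f 0 = f"
| "killed_sum f (Suc s) = (\<lambda>x. \<Sum>z\<in>{a (M - s)<..<x}. killed_sum f s z)"

lemma killed_sum_support:
  assumes "\<And>x. x < c \<Longrightarrow> f x = 0"
  shows "x < c \<Longrightarrow> killed_sum f s x = 0"
  by (induction s arbitrary: x) (auto simp: assms intro!: sum.neutral)

text \<open>The first summation starts above \<open>a M\<close>, and summing over smaller arguments
  cannot create values further down. In particular nothing is left at or below the threshold of an
  unselected level, which is \<open>a M\<close>.\<close>

lemma killed_sum_low: "x \<le> a M + 1 \<Longrightarrow> killed_sum f (Suc s) x = 0"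
proof (induction s arbitrary: x)
  case 0
  then have "{a M<..<x} = {}" by auto
  then show ?case by (simp only: killed_sum.simps diff_zero sum.empty)
next
  case (Suc s)
  have "killed_sum f (Suc s) z = 0" if "z < x" for z using Suc that by simp
  then show ?case by (simp only: killed_sum.simps(2)[of f "Suc s"]) (auto intro!: sum.neutral)
qed

text \<open>It removes the truncation of \<open>Psi\<close> at -R from all levels below M as soon as
  -R \<le> \<open>a M\<close>.\<close>

lemma killed_sum_cong:
  assumes "\<And>x. a M < x \<Longrightarrow> f x = f' x"
  shows "killed_sum f (Suc s) x = killed_sum f' (Suc s) x"
proof (induction s arbitrary: x)
  case 0
  then show ?case using assms by (auto intro!: sum.cong)
next
  case (Suc s)
  then show ?case by (simp only: killed_sum.simps(2)[of _ "Suc s"])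
qed

text \<open>The free s-fold sum is decomposed at the first level M - s' among M, ..., M - s + 1
  where a path is at or below its threshold. From there the path continues without restriction;
  paths with no such level give the killed sum.\<close>

lemma killed_sum_resolvent:
  assumes f: "\<And>x. x < c \<Longrightarrow> f x = 0"
  shows "killed_sum f s x + (\<Sum>s'<s. \<Sum>x'\<in>{c..a (M - s')}. of_nat (qn (s - s') (x - x')) * killed_sum f s' x')
    = (\<Sum>x'\<in>{c..x}. of_nat (qn s (x - x')) * f x')"
proof (induction s arbitrary: x)
  case 0
  have "(\<Sum>x'\<in>{c..x}. of_nat (qn 0 (x - x')) * f x') = (\<Sum>x'\<in>{c..x} \<inter> {x}. f x')"
    by (intro sum.mono_neutral_cong_right) auto
  also have "\<dots> = f x" using f[of x] by (cases "c \<le> x") auto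
  finally show ?case by simp
next
  case (Suc s)
  let ?b = "a (M - s)"
  have T1: "killed_sum f (Suc s) x = (\<Sum>z\<in>{c..<x}. killed_sum f s z) - (\<Sum>z\<in>{c..?b}. of_nat (qn 1 (x - z)) * killed_sum f s z)"
  proof -
    have supp: "c \<le> z" if "killed_sum f s z \<noteq> 0" for z
      using killed_sum_support[of c f z s] f that by (cases "z < c") auto
    have "killed_sum f (Suc s) x = (\<Sum>z\<in>{z \<in> {c..<x}. ?b < z}. killed_sum f s z)"
      by (simp, intro sum.mono_neutral_right) (auto dest: supp)
    moreover have "(\<Sum>z\<in>{c..?b}. of_nat (qn 1 (x - z)) * killed_sum f s z) = (\<Sum>z\<in>{z \<in> {c..<x}. \<not> ?b < z}. killed_sum f s z)"
      by (intro sum.mono_neutral_cong_right) (auto simp: qn_1)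
    moreover have "(\<Sum>z\<in>{c..<x}. killed_sum f s z)
        = (\<Sum>z\<in>{z \<in> {c..<x}. ?b < z}. killed_sum f s z) + (\<Sum>z\<in>{z \<in> {c..<x}. \<not> ?b < z}. killed_sum f s z)"
      by (subst sum.union_disjoint[symmetric]) (auto intro!: sum.cong intro: finite_subset[of _ "{c..<x}"])
    ultimately show ?thesis by simp
  qed
  have T3: "(\<Sum>z\<in>{c..<x}. \<Sum>x'\<in>{c..z}. of_nat (qn s (z - x')) * f x')
      = (\<Sum>x'\<in>{c..x}. of_nat (qn (Suc s) (x - x')) * f x')"
  proof -
    have "(\<Sum>z\<in>{c..<x}. \<Sum>x'\<in>{c..z}. of_nat (qn s (z - x')) * f x')
        = (\<Sum>z\<in>{c..<x}. \<Sum>x'\<in>{c..x}. of_nat (qn s (z - x')) * f x')"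
      by (intro sum.cong refl sum.mono_neutral_left) (auto simp: qn_eq_0)
    also have "\<dots> = (\<Sum>x'\<in>{c..x}. (\<Sum>z\<in>{c..<x}. of_nat (qn s (z - x'))) * f x')"
      by (subst sum.swap) (simp add: sum_distrib_right)
    also have "\<dots> = (\<Sum>x'\<in>{c..x}. of_nat (qn (Suc s) (x - x')) * f x')"
    proof (intro sum.cong refl)
      fix x' assume "x' \<in> {c..x}"
      then have "(\<Sum>z\<in>{c..<x}. qn s (z - x')) = qn (Suc s) (x - x')" by (intro qn_sum_shift) auto
      then show "(\<Sum>z\<in>{c..<x}. of_nat (qn s (z - x'))) * f x' = of_nat (qn (Suc s) (x - x')) * f x'"
        by (simp only: of_nat_sum[symmetric])
    qed
    finally show ?thesis .
  qed
  have T4: "(\<Sum>z\<in>{c..<x}. \<Sum>s'<s. \<Sum>x'\<in>{c..a (M - s')}. of_nat (qn (s - s') (z - x')) * killed_sum f s' x')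
      = (\<Sum>s'<s. \<Sum>x'\<in>{c..a (M - s')}. of_nat (qn (Suc s - s') (x - x')) * killed_sum f s' x')"
  proof -
    have "(\<Sum>z\<in>{c..<x}. \<Sum>s'<s. \<Sum>x'\<in>{c..a (M - s')}. of_nat (qn (s - s') (z - x')) * killed_sum f s' x')
        = (\<Sum>s'<s. \<Sum>x'\<in>{c..a (M - s')}. \<Sum>z\<in>{c..<x}. of_nat (qn (s - s') (z - x')) * killed_sum f s' x')"
      by (subst sum.swap, intro sum.cong refl sum.swap)
    also have "\<dots> = (\<Sum>s'<s. \<Sum>x'\<in>{c..a (M - s')}. of_nat (qn (Suc s - s') (x - x')) * killed_sum f s' x')"
    proof (intro sum.cong refl)
      fix s' x' assume "s' \<in> {..<s}" "x' \<in> {c..a (M - s')}"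
      then have "(\<Sum>z\<in>{c..<x}. qn (s - s') (z - x')) = qn (Suc s - s') (x - x')"
        using qn_sum_shift[of c x' "s - s'" x] by (simp add: Suc_diff_le)
      then show "(\<Sum>z\<in>{c..<x}. of_nat (qn (s - s') (z - x')) * killed_sum f s' x')
          = of_nat (qn (Suc s - s') (x - x')) * killed_sum f s' x'"
        by (simp only: sum_distrib_right[symmetric] of_nat_sum[symmetric])
    qed
    finally show ?thesis .
  qed
  have "(\<Sum>z\<in>{c..<x}. killed_sum f s z) = (\<Sum>z\<in>{c..<x}. (\<Sum>x'\<in>{c..z}. of_nat (qn s (z - x')) * f x')
      - (\<Sum>s'<s. \<Sum>x'\<in>{c..a (M - s')}. of_nat (qn (s - s') (z - x')) * killed_sum f s' x'))"
    by (intro sum.cong refl) (simp add: Suc.IH[symmetric])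
  then have T2: "(\<Sum>z\<in>{c..<x}. killed_sum f s z) = (\<Sum>x'\<in>{c..x}. of_nat (qn (Suc s) (x - x')) * f x')
      - (\<Sum>s'<s. \<Sum>x'\<in>{c..a (M - s')}. of_nat (qn (Suc s - s') (x - x')) * killed_sum f s' x')"
    by (simp only: sum_subtractf T3 T4)
  show ?case unfolding T1 T2 by simp
qed

lemma window_Sigma: "window R = Sigma I (\<lambda>n. {- int R..a n})"
  by (auto simp: window_def)

lemma sum_window: "(\<Sum>q\<in>window R. h q) = (\<Sum>n\<in>I. \<Sum>x\<in>{- int R..a n}. (h (n, x) :: complex))"
  unfolding window_Sigma by (subst sum.Sigma) (auto simp: finite_I)

definition cut_Psi :: "nat \<Rightarrow> nat \<Rightarrow> int \<Rightarrow> complex" where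
  "cut_Psi R l x = (if - int R \<le> x then Psi l M x else 0)"

lemma cut_Psi_0: "x < - int R \<Longrightarrow> cut_Psi R l x = 0"
  by (simp add: cut_Psi_def)

lemma killed_sum_unselected:
  assumes "n \<in> {1..M}" "n \<notin> I" "x \<le> a n"
  shows "killed_sum f (M - n) x = 0"
proof -
  have "n \<noteq> M" using I assms by auto
  then obtain s where "M - n = Suc s" using assms by (metis Suc_diff_Suc atLeastAtMost_iff le_neq_implies_less)
  then show ?thesis using killed_sum_low[of x f s] a_const[OF assms(2)] assms(3) by simp
qed

definition Q_unip :: "nat \<times> int \<Rightarrow> nat \<times> int \<Rightarrow> complex" where
  "Q_unip p q = of_bool (p = q) + of_bool (fst p < fst q) * of_nat (qn (fst q - fst p) (snd p - snd q))"

definition killed_Psi :: "nat \<Rightarrow> nat \<Rightarrow> nat \<times> int \<Rightarrow> complex" where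
  "killed_Psi R l q = killed_sum (cut_Psi R l) (M - fst q) (snd q)"

text \<open>On the window the arguments lie at or below the thresholds, so the sum over q is the
  decomposition of \<open>killed_sum_resolvent\<close> with s = M - n. Unselected levels may be
  added, as killed sums vanish there up to the threshold.\<close>

lemma Q_unip_killed_Psi:
  assumes "p \<in> window R"
  shows "(\<Sum>q\<in>window R. Q_unip p q * killed_Psi R l q) = PsiR M R l (fst p) (snd p)"
proof -
  obtain n x where p: "p = (n, x)" by (cases p)
  have n: "n \<in> I" "n \<in> {1..M}" "- int R \<le> x" "x \<le> a n" using assms I by (auto simp: p window_def)
  let ?v = "\<lambda>n'. killed_sum (cut_Psi R l) (M - n')"
  have "(\<Sum>q\<in>window R. Q_unip p q * killed_Psi R l q) = (\<Sum>q\<in>window R. of_bool (p = q) * killed_Psi R l q)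
      + (\<Sum>q\<in>window R. of_bool (fst p < fst q) * of_nat (qn (fst q - fst p) (snd p - snd q)) * killed_Psi R l q)"
    by (simp add: Q_unip_def distrib_right sum.distrib)
  also have "(\<Sum>q\<in>window R. of_bool (p = q) * killed_Psi R l q) = (\<Sum>q\<in>{p}. killed_Psi R l q)"
    using assms by (intro sum.mono_neutral_cong_right finite_window) auto
  also have "\<dots> = ?v n x" by (simp add: killed_Psi_def p)
  also have "(\<Sum>q\<in>window R. of_bool (fst p < fst q) * of_nat (qn (fst q - fst p) (snd p - snd q)) * killed_Psi R l q)
      = (\<Sum>n'\<in>I. \<Sum>x'\<in>{- int R..a n'}. of_bool (n < n') * of_nat (qn (n' - n) (x - x')) * ?v n' x')"
    by (simp add: sum_window killed_Psi_def p)
  also have "\<dots> = (\<Sum>n'\<in>{n<..M}. \<Sum>x'\<in>{- int R..a n'}. of_nat (qn (n' - n) (x - x')) * ?v n' x')"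
  proof -
    have "(\<Sum>n'\<in>I. \<Sum>x'\<in>{- int R..a n'}. of_bool (n < n') * of_nat (qn (n' - n) (x - x')) * ?v n' x')
        = (\<Sum>n'\<in>I \<inter> {n<..M}. \<Sum>x'\<in>{- int R..a n'}. of_nat (qn (n' - n) (x - x')) * ?v n' x')"
      using I finite_I by (intro sum.mono_neutral_cong_right) (auto simp: not_less)
    also have "\<dots> = (\<Sum>n'\<in>{n<..M}. \<Sum>x'\<in>{- int R..a n'}. of_nat (qn (n' - n) (x - x')) * ?v n' x')"
    proof (intro sum.mono_neutral_left ballI)
      fix n' assume n': "n' \<in> {n<..M} - I \<inter> {n<..M}"
      then have "?v n' x' = 0" if "x' \<in> {- int R..a n'}" for x'
        using killed_sum_unselected[of n' x'] that by auto
      then show "(\<Sum>x'\<in>{- int R..a n'}. of_nat (qn (n' - n) (x - x')) * ?v n' x') = 0"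
        by (intro sum.neutral) auto
    qed auto
    finally show ?thesis .
  qed
  also have "\<dots> = (\<Sum>s'<M - n. \<Sum>x'\<in>{- int R..a (M - s')}. of_nat (qn (M - n - s') (x - x')) * killed_sum (cut_Psi R l) s' x')"
    by (rule sum.reindex_bij_witness[where i = "\<lambda>s'. M - s'" and j = "\<lambda>n'. M - n'"])
       (auto intro!: sum.cong arg_cong2[where f = qn])
  also have "?v n x + \<dots> = (\<Sum>x'\<in>{- int R..x}. of_nat (qn (M - n) (x - x')) * cut_Psi R l x')"
    by (rule killed_sum_resolvent[OF cut_Psi_0])
  also have "\<dots> = PsiR M R l n x"
    unfolding PsiR_def by (intro sum.cong) (auto simp: cut_Psi_def)
  finally show ?thesis by (simp add: p)
qed

lemma dset_Q_unip: "dset Q_unip (window R) = 1"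
proof -
  have "dset Q_unip (window R) = (\<Prod>p\<in>window R. Q_unip p p)"
    by (rule dset_graded[OF finite_window, of _ _ fst]) (auto simp: Q_unip_def split: if_splits)
  then show ?thesis by (simp add: Q_unip_def)
qed

lemma dset_Li: "dset Li {1..M} = 1"
proof -
  have "dset Li {1..M} * dset Lmat {1..M} = dset (\<lambda>i j. \<Sum>k\<in>{1..M}. Li i k * Lmat k j) {1..M}"
    by (rule dset_mult[symmetric]) simp
  also have "\<dots> = dset (\<lambda>i j. of_bool (i = j)) {1..M}"
    using Li by (intro dset_cong) (auto simp: inverse_on_def)
  also have "\<dots> = (\<Prod>k\<in>{1..M}. 1)"
    by (subst dset_graded[where \<mu> = id]) auto
  finally show ?thesis by (simp only: dset_Lmat prod.neutral_const mult_1_right)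
qed

definition window_mat :: "nat \<Rightarrow> nat \<Rightarrow> nat \<Rightarrow> complex" where
  "window_mat R l k = (\<Sum>q\<in>window R. Ek (fst q) k (snd q) * killed_Psi R l q)"

text \<open>The finite rank formula with P = \<open>Q_unip\<close>, of determinant 1, and U built
  from \<open>killed_Psi\<close>. Writing 1 as \<open>Li\<close> times \<open>Lmat\<close> lets
  \<open>Li\<close> be factored out of the transposed M \<times> M matrix, and it has determinant 1
  as well.\<close>

lemma dset_window_eq:
  "dset (\<lambda>p q. of_bool (p = q) - reduced_kernel M Li (PsiR M R) p q) (window R)
    = dset (\<lambda>l k. Lmat l k - window_mat R l k) {1..M}"
proof -
  let ?A = "\<lambda>p k. \<Sum>l\<in>{1..M}. Li k l * PsiR M R l (fst p) (snd p)"
  let ?B = "\<lambda>k q. Ek (fst q) k (snd q)"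
  let ?U = "\<lambda>q k. \<Sum>l\<in>{1..M}. Li k l * killed_Psi R l q"
  have "dset (\<lambda>p q. of_bool (p = q) - reduced_kernel M Li (PsiR M R) p q) (window R)
      = dset (\<lambda>p q. Q_unip p q - (\<Sum>k\<in>{1..M}. ?A p k * ?B k q)) (window R)"
    by (intro dset_cong) (auto simp: reduced_kernel_def Q_unip_def)
  also have "\<dots> = dset Q_unip (window R) * dset (\<lambda>k k'. of_bool (k = k') - (\<Sum>q\<in>window R. ?B k q * ?U q k')) {1..M}"
  proof (rule dset_minus_finite_rank[OF finite_window])
    fix p k assume "p \<in> window R" "k \<in> {1..M}"
    have "(\<Sum>q\<in>window R. Q_unip p q * ?U q k) = (\<Sum>l\<in>{1..M}. Li k l * (\<Sum>q\<in>window R. Q_unip p q * killed_Psi R l q))"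
      unfolding sum_distrib_left by (subst sum.swap) (simp add: mult_ac)
    then show "(\<Sum>q\<in>window R. Q_unip p q * ?U q k) = ?A p k"
      using Q_unip_killed_Psi[OF \<open>p \<in> window R\<close>] by simp
  qed simp
  also have "\<dots> = dset (\<lambda>k' k. of_bool (k = k') - (\<Sum>q\<in>window R. ?B k q * ?U q k')) {1..M}"
    by (subst dset_transpose[symmetric]) (auto simp: dset_Q_unip)
  also have "\<dots> = dset (\<lambda>k' k. \<Sum>l\<in>{1..M}. Li k' l * (Lmat l k - window_mat R l k)) {1..M}"
  proof (rule dset_cong)
    fix k' k assume k: "k' \<in> {1..M}" "k \<in> {1..M}"
    have "(\<Sum>q\<in>window R. ?B k q * ?U q k') = (\<Sum>l\<in>{1..M}. Li k' l * window_mat R l k)"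
      unfolding window_mat_def sum_distrib_left by (subst sum.swap) (simp add: mult_ac)
    moreover have "(\<Sum>l\<in>{1..M}. Li k' l * Lmat l k) = of_bool (k = k')"
      using Li k by (auto simp: inverse_on_def)
    ultimately show "of_bool (k = k') - (\<Sum>q\<in>window R. ?B k q * ?U q k')
        = (\<Sum>l\<in>{1..M}. Li k' l * (Lmat l k - window_mat R l k))"
      by (simp add: right_diff_distrib sum_subtractf)
  qed
  also have "\<dots> = dset (\<lambda>l k. Lmat l k - window_mat R l k) {1..M}"
    by (subst dset_mult[OF finite_atLeastAtMost]) (simp only: dset_Li mult_1_left)
  finally show ?thesis .
qed

text \<open>\<open>Lmat l k\<close> is the sum of \<open>Ek M k\<close> times \<open>Psi l M\<close>
  over all integers. Level M of the window removes, in the limit, the part up to \<open>a M\<close>;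
  the lower levels do not depend on R once -R \<le> \<open>a M\<close>.\<close>

definition limit_mat :: "nat \<Rightarrow> nat \<Rightarrow> complex" where
  "limit_mat l k = (\<Sum>\<^sub>\<infinity>x\<in>{a M<..}. Ek M k x * Psi l M x)
     - (\<Sum>n\<in>{1..<M}. \<Sum>x\<in>{a M<..a n}. Ek n k x * killed_sum (Psi l M) (M - n) x)"

lemma has_sum_Ek_Psi:
  assumes "l \<in> {1..M}" "k \<in> {1..M}"
  shows "((\<lambda>x. Ek M k x * Psi l M x) has_sum Lmat l k) UNIV"
proof -
  have eq: "fps_nth (fpsY (y l + int l - 1) * (fps_X ^ (M - l) * Gf)) (M - k)
      = fps_nth (fps_X ^ (M - l) * (fpsY (y l + int l - 1) * Gf)) (M - k)"
    by (simp only: mult_ac)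
  also have "\<dots> = Lmat l k"
    unfolding fps_X_power_mult_nth Lmat_def using assms by auto
  finally show ?thesis
    using has_sum_Ek_hs[OF Gf, of l M k "y l"] assms by (simp add: Psi_def of_nat_diff)
qed

lemma window_mat_eq:
  assumes "- int R \<le> a M"
  shows "window_mat R l k = (\<Sum>x\<in>{- int R..a M}. Ek M k x * Psi l M x)
     + (\<Sum>n\<in>{1..<M}. \<Sum>x\<in>{a M<..a n}. Ek n k x * killed_sum (Psi l M) (M - n) x)"
proof -
  have M: "1 \<le> M" using I by auto
  have "window_mat R l k = (\<Sum>n\<in>I. \<Sum>x\<in>{- int R..a n}. Ek n k x * killed_sum (cut_Psi R l) (M - n) x)"
    by (simp add: window_mat_def sum_window killed_Psi_def)
  also have "\<dots> = (\<Sum>n\<in>{1..M}. \<Sum>x\<in>{- int R..a n}. Ek n k x * killed_sum (cut_Psi R l) (M - n) x)"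
    using I killed_sum_unselected by (intro sum.mono_neutral_left) (auto intro!: sum.neutral)
  also have "{1..M} = insert M {1..<M}" using M by auto
  also have "(\<Sum>n\<in>insert M {1..<M}. \<Sum>x\<in>{- int R..a n}. Ek n k x * killed_sum (cut_Psi R l) (M - n) x)
      = (\<Sum>x\<in>{- int R..a M}. Ek M k x * cut_Psi R l x)
        + (\<Sum>n\<in>{1..<M}. \<Sum>x\<in>{- int R..a n}. Ek n k x * killed_sum (cut_Psi R l) (M - n) x)"
    by simp
  also have "(\<Sum>x\<in>{- int R..a M}. Ek M k x * cut_Psi R l x) = (\<Sum>x\<in>{- int R..a M}. Ek M k x * Psi l M x)"
    by (intro sum.cong) (auto simp: cut_Psi_def)
  also have "(\<Sum>n\<in>{1..<M}. \<Sum>x\<in>{- int R..a n}. Ek n k x * killed_sum (cut_Psi R l) (M - n) x)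
      = (\<Sum>n\<in>{1..<M}. \<Sum>x\<in>{a M<..a n}. Ek n k x * killed_sum (Psi l M) (M - n) x)"
  proof (rule sum.cong[OF refl])
    fix n assume "n \<in> {1..<M}"
    then obtain s where s: "M - n = Suc s" by (metis Suc_diff_Suc atLeastLessThan_iff)
    show "(\<Sum>x\<in>{- int R..a n}. Ek n k x * killed_sum (cut_Psi R l) (M - n) x)
        = (\<Sum>x\<in>{a M<..a n}. Ek n k x * killed_sum (Psi l M) (M - n) x)"
    proof (rule sum.mono_neutral_cong_right)
      show "\<forall>x\<in>{- int R..a n} - {a M<..a n}. Ek n k x * killed_sum (cut_Psi R l) (M - n) x = 0"
        unfolding s using killed_sum_low by auto
      show "Ek n k x * killed_sum (cut_Psi R l) (M - n) x = Ek n k x * killed_sum (Psi l M) (M - n) x" for x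
        unfolding s using assms by (subst killed_sum_cong[of "cut_Psi R l" "Psi l M"]) (auto simp: cut_Psi_def)
    qed (use assms in auto)
  qed
  finally show ?thesis .
qed

lemma fredholm_det_eq_limit_mat: "fredholm_det (I \<times> UNIV) K_limit = dset limit_mat {1..M}"
proof -
  have "(\<lambda>R. Lmat l k - window_mat R l k) \<longlonglongrightarrow> limit_mat l k" if lk: "l \<in> {1..M}" "k \<in> {1..M}" for l k
  proof -
    let ?f = "\<lambda>x. Ek M k x * Psi l M x"
    have s: "?f summable_on UNIV" using has_sum_imp_summable[OF has_sum_Ek_Psi[OF lk]] .
    have s1: "?f summable_on {..a M}" and s2: "?f summable_on {a M<..}"
      using s by (auto intro: summable_on_subset_banach)
    have "Lmat l k = infsum ?f UNIV" using infsumI[OF has_sum_Ek_Psi[OF lk]] by simp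
    also have "UNIV = {..a M} \<union> {a M<..}" by auto
    also have "infsum ?f \<dots> = infsum ?f {..a M} + infsum ?f {a M<..}"
      by (rule infsum_Un_disjoint[OF s1 s2]) auto
    finally have L: "Lmat l k = infsum ?f {..a M} + infsum ?f {a M<..}" .
    have "((\<lambda>x. if x \<le> a M then ?f x else 0) has_sum infsum ?f {..a M}) UNIV"
      using has_sum_infsum[OF s1] by (subst has_sum_cong_neutral[where T = "{..a M}" and g = ?f]) auto
    then have "(\<lambda>R. \<Sum>x\<in>{- int R..a M}. if x \<le> a M then ?f x else 0) \<longlonglongrightarrow> infsum ?f {..a M}"
      by (rule has_sum_int_partial) auto
    then have "(\<lambda>R. \<Sum>x\<in>{- int R..a M}. ?f x) \<longlonglongrightarrow> infsum ?f {..a M}" by (simp cong: sum.cong_simp)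
    then have "(\<lambda>R. Lmat l k - ((\<Sum>x\<in>{- int R..a M}. ?f x)
        + (\<Sum>n\<in>{1..<M}. \<Sum>x\<in>{a M<..a n}. Ek n k x * killed_sum (Psi l M) (M - n) x)))
        \<longlonglongrightarrow> Lmat l k - (infsum ?f {..a M} + (\<Sum>n\<in>{1..<M}. \<Sum>x\<in>{a M<..a n}. Ek n k x * killed_sum (Psi l M) (M - n) x))"
      by (intro tendsto_intros)
    also have "Lmat l k - (infsum ?f {..a M} + (\<Sum>n\<in>{1..<M}. \<Sum>x\<in>{a M<..a n}. Ek n k x * killed_sum (Psi l M) (M - n) x)) = limit_mat l k"
      by (simp add: limit_mat_def L)
    finally show ?thesis
    proof (rule Lim_transform_eventually)
      show "\<forall>\<^sub>F R in sequentially. Lmat l k - ((\<Sum>x\<in>{- int R..a M}. ?f x)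
        + (\<Sum>n\<in>{1..<M}. \<Sum>x\<in>{a M<..a n}. Ek n k x * killed_sum (Psi l M) (M - n) x)) = Lmat l k - window_mat R l k"
        by (rule eventually_sequentiallyI[of "nat (- a M)"]) (simp add: window_mat_eq)
    qed
  qed
  then have "(\<lambda>R. dset (\<lambda>l k. Lmat l k - window_mat R l k) {1..M}) \<longlonglongrightarrow> dset limit_mat {1..M}"
    by (rule tendsto_dset)
  then show ?thesis
    using K_limit_fredholm(2) LIMSEQ_unique unfolding dset_window_eq by blast
qed

end

section \<open>Summation by parts\<close>

lemma summation_by_parts:
  fixes E E' A A' :: "int \<Rightarrow> complex"
  assumes E: "\<And>x. E (x - 1) - E x = E' x" and A: "\<And>x. A' x - A' (x + 1) = A x"
    and s: "(\<lambda>x. E x * A' x) summable_on {c..}" and s': "(\<lambda>x. E' x * A' x) summable_on {c..}"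
  shows "infsum (\<lambda>x. E x * A x) {c..} = E (c - 1) * A' c - infsum (\<lambda>x. E' x * A' x) {c..}"
proof -
  let ?s1 = "infsum (\<lambda>x. E x * A' x) {c..}" and ?s2 = "infsum (\<lambda>x. E' x * A' x) {c..}"
  have h1: "((\<lambda>x. E x * A' x) has_sum ?s1) {c..}" by (rule has_sum_infsum[OF s])
  have h2: "((\<lambda>x. E' x * A' x) has_sum ?s2) {c..}" by (rule has_sum_infsum[OF s'])
  have "((\<lambda>x. E x * A' x + E' x * A' x) has_sum ?s1 + ?s2) {c..}" by (rule has_sum_add[OF h1 h2])
  then have h3: "((\<lambda>x. E (x - 1) * A' x) has_sum ?s1 + ?s2) {c..}"
    unfolding distrib_right[symmetric] E[symmetric] by simp
  have "((\<lambda>x. E (x - 1) * A' x) has_sum (?s1 + ?s2 - E (c - 1) * A' c)) {c + 1..}"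
  proof -
    have "((\<lambda>x. E (x - 1) * A' x) has_sum E (c - 1) * A' c) {c}" by (simp add: has_sum_finiteI)
    then have "((\<lambda>x. if x = c then E (x - 1) * A' x else 0) has_sum E (c - 1) * A' c) {c..}"
      by (subst has_sum_cong_neutral[where T = "{c}" and g = "\<lambda>x. E (x - 1) * A' x"]) auto
    from has_sum_diff[OF h3 this] show ?thesis
      by (subst has_sum_cong_neutral[where T = "{c..}"
            and g = "\<lambda>x. E (x - 1) * A' x - (if x = c then E (x - 1) * A' x else 0)"]) auto
  qed
  then have h4: "((\<lambda>x. E x * A' (x + 1)) has_sum (?s1 + ?s2 - E (c - 1) * A' c)) {c..}"
    by (subst has_sum_reindex_bij_witness[where S = "{c..}" and T = "{c + 1..}" and i = "\<lambda>x. x - 1"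
          and j = "\<lambda>x. x + 1" and h = "\<lambda>x. E (x - 1) * A' x"]) auto
  have "((\<lambda>x. E x * A x) has_sum (?s1 - (?s1 + ?s2 - E (c - 1) * A' c))) {c..}"
    using has_sum_diff[OF h1 h4] by (simp add: right_diff_distrib[symmetric] A)
  then show ?thesis by (simp add: infsumI)
qed

context threshold_setting
begin

text \<open>
  \<open>s\<close>-fold antiderivatives of \<open>Psi l M\<close>, provided by the family \<open>Fr\<close>.
\<close>

definition Psi_int :: "nat \<Rightarrow> nat \<Rightarrow> int \<Rightarrow> complex" where
  "Psi_int l s x = (- 1) ^ (M - l) * Fr (int l + int s - int M) (x - y l)"

lemma Psi_int_0: "l \<in> {1..M} \<Longrightarrow> Psi_int l 0 x = Psi l M x"
  using Fr_nonpos[of "M - l" "x - y l"]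
  by (simp add: Psi_int_def Psi_def of_nat_diff power_mult_distrib[symmetric])

lemma Psi_int_rec: "Psi_int l (Suc s) x - Psi_int l (Suc s) (x + 1) = Psi_int l s x"
proof -
  have "int l + int s - int M = (int l + int (Suc s) - int M) - 1" by simp
  then have "Fr (int l + int s - int M) (x - y l)
      = Fr (int l + int (Suc s) - int M) (x - y l) - Fr (int l + int (Suc s) - int M) (x - y l + 1)"
    by (simp only: Fr_rec)
  moreover have "x + 1 - y l = x - y l + 1" by simp
  ultimately show ?thesis unfolding Psi_int_def by (simp only: right_diff_distrib)
qed

lemma Psi_int_sum:
  assumes "lo \<le> hi"
  shows "(\<Sum>z\<in>{lo..<hi}. Psi_int l s z) = Psi_int l (Suc s) lo - Psi_int l (Suc s) hi"
  using assms
proof (induction hi rule: int_ge_induct)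
  case (step hi)
  have "{lo..<hi + 1} = insert hi {lo..<hi}" using step by auto
  then show ?case using step Psi_int_rec[of l s hi] by (simp add: algebra_simps)
qed simp

lemma Ek_Psi_int_summable: "(\<lambda>x. Ek n k x * Psi_int l s x) summable_on {c..}"
proof -
  obtain C where C: "0 \<le> C" "\<And>x. norm (Fr (int l + int s - int M) x) \<le> C * \<rho>' powi (- x)" using Fr_bound by blast
  define b where "b = sqrt \<rho>'"
  have b: "1 < b" "\<rho>' = b * b" using radii by (auto simp: b_def)
  obtain C' where C': "0 \<le> C'" "\<And>x. norm (Ek n k x) \<le> C' * b ^ nat \<bar>x\<bar>" using Ek_bound[OF b(1)] by blast
  define D where "D = C' * (C * (\<rho>' powi y l * \<rho>' powi (2 * \<bar>c\<bar>)))"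
  have "(\<lambda>x. norm (Ek n k x * Psi_int l s x)) summable_on {c..}"
  proof (rule norm_summable_on_le)
    show "(\<lambda>x::int. D * (1 / b) ^ nat \<bar>x\<bar>) summable_on {c..}"
      using b by (intro summable_on_cmult_right summable_on_subset_banach[OF summable_on_geometric_int]) auto
    fix x assume x: "x \<in> {c..}"
    have "norm (Psi_int l s x) = norm (Fr (int l + int s - int M) (x - y l))"
      by (simp add: Psi_int_def norm_mult norm_power)
    also have "\<dots> \<le> C * \<rho>' powi (- (x - y l))" by (rule C)
    also have "\<rho>' powi (- (x - y l)) = \<rho>' powi y l * \<rho>' powi (- x)"
      using radii by (intro power_int_add_eq) auto
    \<comment> \<open>Uses - x \<le> 2 |c| - |x| for x \<ge> c.\<close>
    also have "C * (\<rho>' powi y l * \<rho>' powi (- x)) \<le> C * (\<rho>' powi y l * \<rho>' powi (2 * \<bar>c\<bar> + - \<bar>x\<bar>))"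
      using radii C x by (intro mult_left_mono power_int_increasing) auto
    also have "\<rho>' powi (2 * \<bar>c\<bar> + - \<bar>x\<bar>) = \<rho>' powi (2 * \<bar>c\<bar>) * \<rho>' powi (- \<bar>x\<bar>)"
      using radii by (intro power_int_add_eq) auto
    finally have "norm (Ek n k x * Psi_int l s x) \<le> (C' * b ^ nat \<bar>x\<bar>) * (C * (\<rho>' powi y l * (\<rho>' powi (2 * \<bar>c\<bar>) * \<rho>' powi (- \<bar>x\<bar>))))"
      unfolding norm_mult using C' b by (intro mult_mono) auto
    also have "\<dots> = D * (b ^ nat \<bar>x\<bar> * \<rho>' powi (- \<bar>x\<bar>))" by (simp add: D_def mult_ac)
    also have "\<rho>' powi (- \<bar>x\<bar>) = (1 / b) ^ nat \<bar>x\<bar> * (1 / b) ^ nat \<bar>x\<bar>"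
      using b by (simp add: power_int_def power_one_over power_mult_distrib inverse_eq_divide)
    also have "b ^ nat \<bar>x\<bar> * ((1 / b) ^ nat \<bar>x\<bar> * (1 / b) ^ nat \<bar>x\<bar>) = (1 / b) ^ nat \<bar>x\<bar>"
      using b by (simp add: power_one_over)
    finally show "norm (Ek n k x * Psi_int l s x) \<le> D * (1 / b) ^ nat \<bar>x\<bar>" .
  qed
  then show ?thesis by (rule abs_summable_summable)
qed

text \<open>Suffix maxima are indexed here by the number s of summations, as the levels are
  traversed downwards from M.\<close>

definition cutoff :: "nat \<Rightarrow> int" where "cutoff s = suffix_max M a (M - s)"

lemma cutoff_0 [simp]: "cutoff 0 = a M" by (simp add: cutoff_def)

lemma cutoff_Suc: "Suc s \<le> M \<Longrightarrow> cutoff (Suc s) = max (a (M - Suc s)) (cutoff s)"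
  unfolding cutoff_def by (subst suffix_max_rec) (auto simp: Suc_diff_Suc)

lemma cutoff_ge: "s \<le> M \<Longrightarrow> a M \<le> cutoff s"
  by (induction s) (auto simp: cutoff_Suc)

text \<open>For i = M - k this is, up to the sign (-1)^(M - l), the entry F_(l - k + 1)(b_k + 1 -
  y_l) of the determinant for the chain.\<close>

definition boundary :: "nat \<Rightarrow> nat \<Rightarrow> complex" where "boundary l i = Psi_int l (Suc i) (cutoff i + 1)"

text \<open>The coefficient of \<open>boundary l i\<close> after s + 1 killed summations. That it
  does not involve l is what allows the limiting matrix to factor.\<close>

primrec killed_const :: "nat \<Rightarrow> nat \<Rightarrow> int \<Rightarrow> complex" where
  "killed_const 0 = (\<lambda>i x. of_bool (cutoff 0 < x))"
| "killed_const (Suc s) = (\<lambda>i x. if i \<le> s then \<Sum>z\<in>{a (M - Suc s)<..<x}. killed_const s i z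
     else (- 1) ^ Suc s * of_bool (cutoff (Suc s) < x))"

lemma Psi_int_sum_above: "(\<Sum>z\<in>{lo<..<x}. of_bool (b < z) * Psi_int l s z)
    = of_bool (max lo b < x) * (Psi_int l (Suc s) (max lo b + 1) - Psi_int l (Suc s) x)"
proof -
  have "(\<Sum>z\<in>{lo<..<x}. of_bool (b < z) * Psi_int l s z) = (\<Sum>z\<in>{max lo b + 1..<x}. Psi_int l s z)"
    by (intro sum.mono_neutral_cong_right) auto
  also have "\<dots> = of_bool (max lo b < x) * (Psi_int l (Suc s) (max lo b + 1) - Psi_int l (Suc s) x)"
    using Psi_int_sum[of "max lo b + 1" x l s] by (cases "max lo b < x") auto
  finally show ?thesis .
qed

text \<open>Each summation replaces the antiderivative by the next one with the opposite sign and
  adds a boundary term at the lower end. This end is the larger of the new threshold and the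
  previous cutoff, hence the next suffix maximum.\<close>

lemma killed_sum_eq_killed_const:
  assumes "l \<in> {1..M}" "s < M"
  shows "killed_sum (Psi l M) (Suc s) x = (\<Sum>i\<le>s. boundary l i * killed_const s i x)
    + (- 1) ^ Suc s * (of_bool (cutoff s < x) * Psi_int l (Suc s) x)"
  using assms(2)
proof (induction s arbitrary: x)
  case 0
  have "killed_sum (Psi l M) (Suc 0) x = (\<Sum>z\<in>{a M<..<x}. of_bool (a M < z) * Psi_int l 0 z)"
    using assms(1) by (auto simp: Psi_int_0 intro!: sum.cong)
  also have "\<dots> = of_bool (a M < x) * (Psi_int l (Suc 0) (a M + 1) - Psi_int l (Suc 0) x)"
    using Psi_int_sum_above[where lo = "a M" and b = "a M" and s = 0] by simp
  finally show ?case by (simp add: boundary_def algebra_simps)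
next
  case (Suc s)
  let ?a = "a (M - Suc s)"
  have "killed_sum (Psi l M) (Suc (Suc s)) x = (\<Sum>z\<in>{?a<..<x}. killed_sum (Psi l M) (Suc s) z)" by (rule killed_sum.simps(2)[THEN fun_cong])
  also have "\<dots> = (\<Sum>z\<in>{?a<..<x}. (\<Sum>i\<le>s. boundary l i * killed_const s i z)
      + (- 1) ^ Suc s * (of_bool (cutoff s < z) * Psi_int l (Suc s) z))"
    using Suc by (intro sum.cong refl) auto
  also have "\<dots> = (\<Sum>i\<le>s. boundary l i * (\<Sum>z\<in>{?a<..<x}. killed_const s i z))
      + (- 1) ^ Suc s * (\<Sum>z\<in>{?a<..<x}. of_bool (cutoff s < z) * Psi_int l (Suc s) z)"
    unfolding sum.distrib sum_distrib_left by (subst sum.swap) (rule refl)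
  also have "(\<Sum>i\<le>s. boundary l i * (\<Sum>z\<in>{?a<..<x}. killed_const s i z)) = (\<Sum>i\<le>s. boundary l i * killed_const (Suc s) i x)"
    by (intro sum.cong refl) auto
  also have "(\<Sum>z\<in>{?a<..<x}. of_bool (cutoff s < z) * Psi_int l (Suc s) z)
      = of_bool (cutoff (Suc s) < x) * (boundary l (Suc s) - Psi_int l (Suc (Suc s)) x)"
    using Suc.prems by (simp add: Psi_int_sum_above cutoff_Suc boundary_def)
  finally show ?case by (simp add: algebra_simps)
qed

text \<open>
  Collects, at each summation by parts, the boundary term and the part of the killed sums that
  stems from earlier boundary terms.
\<close>

primrec tri_coef :: "nat \<Rightarrow> nat \<Rightarrow> nat \<Rightarrow> complex" where
  "tri_coef 0 = (\<lambda>i k. 0)"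
| "tri_coef (Suc S) = (\<lambda>i k. (if i < S then tri_coef S i k else (- 1) ^ S * Ek (M - S) k (cutoff S))
     - (\<Sum>x\<in>{a M<..a (M - Suc S)}. Ek (M - Suc S) k x * killed_const S i x))"

text \<open>The polynomials \<open>Ek n k\<close> vanish for n < k, which removes every later
  correction when k \<ge> M - i. What remains is the boundary term (-1)^i
  \<open>Ek (M - i) k\<close>, which in that range is nonzero only for k = M - i.\<close>

lemma tri_coef_triangular:
  assumes "S \<le> M" "i < S" "M - i \<le> k"
  shows "tri_coef S i k = (if k = M - i then (- 1) ^ i else 0)"
  using assms
proof (induction S)
  case (Suc S)
  have "(\<Sum>x\<in>{a M<..a (M - Suc S)}. Ek (M - Suc S) k x * killed_const S i x) = 0"
    using Suc.prems by (intro sum.neutral ballI) (simp add: Ek_eq_0)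
  then show ?case using Suc by (auto simp: Ek_eq_0 less_Suc_eq)
qed simp

definition tail_sum :: "nat \<Rightarrow> nat \<Rightarrow> nat \<Rightarrow> complex" where
  "tail_sum l k S = infsum (\<lambda>x. Ek (M - S) k x * Psi_int l S x) {cutoff S + 1..}"

text \<open>Summation by parts moves one difference from \<open>Psi_int\<close> to
  \<open>Ek\<close>, so the tail passes from level M - S to the level below with the opposite sign.
  The killed sum of that level cancels the stretch of the tail between the cutoffs S and S + 1, up
  to multiples of boundary values.\<close>

lemma limit_mat_partial:
  assumes l: "l \<in> {1..M}" and "S \<le> M"
  shows "tail_sum l k 0 - (\<Sum>s\<in>{1..S}. \<Sum>x\<in>{a M<..a (M - s)}. Ek (M - s) k x * killed_sum (Psi l M) s x)
    = (\<Sum>i<S. boundary l i * tri_coef S i k) + (- 1) ^ S * tail_sum l k S"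
  using assms(2)
proof (induction S)
  case (Suc S)
  let ?n = "M - Suc S" and ?a = "a (M - Suc S)"
  let ?D = "\<lambda>i. \<Sum>x\<in>{a M<..?a}. Ek ?n k x * killed_const S i x"
  have n: "M - S = Suc ?n" using Suc.prems by simp
  have parts: "tail_sum l k S = Ek (M - S) k (cutoff S) * boundary l S - infsum (\<lambda>x. Ek ?n k x * Psi_int l (Suc S) x) {cutoff S + 1..}"
    unfolding tail_sum_def boundary_def n
    by (subst summation_by_parts[where E' = "Ek ?n k" and A' = "Psi_int l (Suc S)"])
       (auto simp: Ek_rec Psi_int_rec Ek_Psi_int_summable)
  have vterm: "(\<Sum>x\<in>{a M<..?a}. Ek ?n k x * killed_sum (Psi l M) (Suc S) x)
      = (\<Sum>i\<le>S. boundary l i * ?D i) + (- 1) ^ Suc S * (\<Sum>x\<in>{cutoff S + 1..?a}. Ek ?n k x * Psi_int l (Suc S) x)"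
  proof -
    have "(\<Sum>x\<in>{a M<..?a}. Ek ?n k x * killed_sum (Psi l M) (Suc S) x)
        = (\<Sum>x\<in>{a M<..?a}. (\<Sum>i\<le>S. boundary l i * (Ek ?n k x * killed_const S i x))
            + (- 1) ^ Suc S * (of_bool (cutoff S < x) * (Ek ?n k x * Psi_int l (Suc S) x)))"
      using Suc.prems by (intro sum.cong refl) (simp only: killed_sum_eq_killed_const[OF l], simp add: sum_distrib_left algebra_simps)
    also have "\<dots> = (\<Sum>i\<le>S. boundary l i * ?D i)
        + (- 1) ^ Suc S * (\<Sum>x\<in>{a M<..?a}. of_bool (cutoff S < x) * (Ek ?n k x * Psi_int l (Suc S) x))"
      unfolding sum.distrib sum_distrib_left by (subst sum.swap) (rule refl)
    also have "(\<Sum>x\<in>{a M<..?a}. of_bool (cutoff S < x) * (Ek ?n k x * Psi_int l (Suc S) x))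
        = (\<Sum>x\<in>{cutoff S + 1..?a}. Ek ?n k x * Psi_int l (Suc S) x)"
      using cutoff_ge[of S] Suc.prems by (intro sum.mono_neutral_cong_right) auto
    finally show ?thesis .
  qed
  have tail: "infsum (\<lambda>x. Ek ?n k x * Psi_int l (Suc S) x) {cutoff S + 1..}
      = (\<Sum>x\<in>{cutoff S + 1..?a}. Ek ?n k x * Psi_int l (Suc S) x) + tail_sum l k (Suc S)"
  proof -
    have "{cutoff S + 1..} = {cutoff S + 1..?a} \<union> {cutoff (Suc S) + 1..}"
      using cutoff_Suc[OF Suc.prems] by auto
    moreover have "infsum (\<lambda>x. Ek ?n k x * Psi_int l (Suc S) x) ({cutoff S + 1..?a} \<union> {cutoff (Suc S) + 1..})
        = infsum (\<lambda>x. Ek ?n k x * Psi_int l (Suc S) x) {cutoff S + 1..?a} + infsum (\<lambda>x. Ek ?n k x * Psi_int l (Suc S) x) {cutoff (Suc S) + 1..}"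
      using cutoff_Suc[OF Suc.prems] by (intro infsum_Un_disjoint Ek_Psi_int_summable) auto
    ultimately show ?thesis by (simp add: tail_sum_def)
  qed
  have tri_coef: "(\<Sum>i<Suc S. boundary l i * tri_coef (Suc S) i k)
      = (\<Sum>i<S. boundary l i * tri_coef S i k) + boundary l S * ((- 1) ^ S * Ek (M - S) k (cutoff S)) - (\<Sum>i\<le>S. boundary l i * ?D i)"
    by (simp add: lessThan_Suc_atMost[symmetric] right_diff_distrib sum_subtractf)
  have "tail_sum l k 0 - (\<Sum>s\<in>{1..Suc S}. \<Sum>x\<in>{a M<..a (M - s)}. Ek (M - s) k x * killed_sum (Psi l M) s x)
      = (tail_sum l k 0 - (\<Sum>s\<in>{1..S}. \<Sum>x\<in>{a M<..a (M - s)}. Ek (M - s) k x * killed_sum (Psi l M) s x))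
        - (\<Sum>x\<in>{a M<..?a}. Ek ?n k x * killed_sum (Psi l M) (Suc S) x)"
    by simp
  also have "\<dots> = ((\<Sum>i<S. boundary l i * tri_coef S i k) + (- 1) ^ S * tail_sum l k S)
      - ((\<Sum>i\<le>S. boundary l i * ?D i) + (- 1) ^ Suc S * (\<Sum>x\<in>{cutoff S + 1..?a}. Ek ?n k x * Psi_int l (Suc S) x))"
    using Suc by (simp only: vterm Suc_leD)
  also have "\<dots> = (\<Sum>i<Suc S. boundary l i * tri_coef (Suc S) i k) + (- 1) ^ Suc S * tail_sum l k (Suc S)"
    unfolding tri_coef parts tail by (simp add: algebra_simps)
  finally show ?case .
qed simp

lemma limit_mat_eq:
  assumes "l \<in> {1..M}" "k \<in> {1..M}"
  shows "limit_mat l k = (\<Sum>i\<in>{1..M}. boundary l (M - i) * tri_coef M (M - i) k)"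
proof -
  have M: "1 \<le> M" using assms by auto
  have "{a M<..} = {a M + 1..}" by auto
  then have "limit_mat l k = tail_sum l k 0 - (\<Sum>n\<in>{1..<M}. \<Sum>x\<in>{a M<..a n}. Ek n k x * killed_sum (Psi l M) (M - n) x)"
    using assms(1) by (simp add: limit_mat_def tail_sum_def Psi_int_0)
  also have "(\<Sum>n\<in>{1..<M}. \<Sum>x\<in>{a M<..a n}. Ek n k x * killed_sum (Psi l M) (M - n) x)
      = (\<Sum>s\<in>{1..<M}. \<Sum>x\<in>{a M<..a (M - s)}. Ek (M - s) k x * killed_sum (Psi l M) s x)"
    by (rule sum.reindex_bij_witness[where i = "\<lambda>s. M - s" and j = "\<lambda>n. M - n"]) auto
  also have "\<dots> = (\<Sum>s\<in>{1..M}. \<Sum>x\<in>{a M<..a (M - s)}. Ek (M - s) k x * killed_sum (Psi l M) s x)"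
    using assms(2) by (intro sum.mono_neutral_left) (auto simp: Ek_eq_0 intro!: sum.neutral)
  also have "tail_sum l k 0 - \<dots> = (\<Sum>i<M. boundary l i * tri_coef M i k) + (- 1) ^ M * tail_sum l k M"
    by (rule limit_mat_partial[OF assms(1) order.refl])
  \<comment> \<open>After M steps the polynomials sit at level 0, where all those with k \<ge> 1 are
    zero.\<close>
  also have "tail_sum l k M = 0" using assms(2) by (simp add: tail_sum_def Ek_eq_0)
  also have "(\<Sum>i<M. boundary l i * tri_coef M i k) = (\<Sum>i\<in>{1..M}. boundary l (M - i) * tri_coef M (M - i) k)"
    by (rule sum.reindex_bij_witness[where i = "\<lambda>i. M - i" and j = "\<lambda>i. M - i"]) auto
  finally show ?thesis by simp
qed

text \<open>The product of the signs (-1)^(M - l) occurs twice, from the rows of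
  \<open>boundary\<close> and from the diagonal of the triangular factor, and cancels.\<close>

lemma dset_limit_mat: "dset limit_mat {1..M} = dset (\<lambda>k j. Fr (int j - int k + 1) (suffix_max M a k + 1 - y j)) {1..M}"
proof -
  have "dset limit_mat {1..M} = dset (\<lambda>l k. \<Sum>i\<in>{1..M}. boundary l (M - i) * tri_coef M (M - i) k) {1..M}"
    by (intro dset_cong limit_mat_eq)
  also have "\<dots> = dset (\<lambda>l i. boundary l (M - i)) {1..M} * dset (\<lambda>i k. tri_coef M (M - i) k) {1..M}"
    by (rule dset_mult) simp
  also have "dset (\<lambda>i k. tri_coef M (M - i) k) {1..M} = (\<Prod>i\<in>{1..M}. tri_coef M (M - i) i)"
  proof (rule dset_graded[where \<mu> = "\<lambda>k. M - k"])
    fix i k assume "i \<in> {1..M}" "k \<in> {1..M}" "i \<noteq> k" "tri_coef M (M - i) k \<noteq> 0"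
    then show "M - i < M - k" using tri_coef_triangular[of M "M - i" k] by (cases "i \<le> k") auto
  qed simp
  also have "\<dots> = (\<Prod>i\<in>{1..M}. (- 1) ^ (M - i))"
    by (intro prod.cong refl) (auto simp: tri_coef_triangular)
  also have "dset (\<lambda>l i. boundary l (M - i)) {1..M}
      = dset (\<lambda>l i. (- 1) ^ (M - l) * Fr (int l - int i + 1) (suffix_max M a i + 1 - y l)) {1..M}"
    by (intro dset_cong) (auto simp: boundary_def Psi_int_def cutoff_def of_nat_diff algebra_simps)
  also have "\<dots> = (\<Prod>l\<in>{1..M}. (- 1) ^ (M - l)) * dset (\<lambda>l i. Fr (int l - int i + 1) (suffix_max M a i + 1 - y l)) {1..M}"
    by (rule dset_scale_rows)
  also have "dset (\<lambda>l i. Fr (int l - int i + 1) (suffix_max M a i + 1 - y l)) {1..M}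
      = dset (\<lambda>k j. Fr (int j - int k + 1) (suffix_max M a k + 1 - y j)) {1..M}"
    by (rule dset_transpose) simp
  finally have "dset limit_mat {1..M} = ((\<Prod>l\<in>{1..M}. (- 1) ^ (M - l)) * (\<Prod>i\<in>{1..M}. (- 1) ^ (M - i)))
      * dset (\<lambda>k j. Fr (int j - int k + 1) (suffix_max M a k + 1 - y j)) {1..M}"
    by (simp only: mult_ac)
  also have "(\<Prod>l\<in>{1..M}. (- 1) ^ (M - l)) * (\<Prod>i\<in>{1..M}. (- 1) ^ (M - i)) = (1 :: complex)"
    unfolding prod.distrib[symmetric] by (intro prod.neutral) (simp add: power_mult_distrib[symmetric])
  finally show ?thesis by simp
qed

end

section \<open>The Markov chain and the Fredholm determinant\<close>

lemma fredholm_minor_cong: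
  assumes "\<And>p q. p \<in> S \<Longrightarrow> q \<in> S \<Longrightarrow> K p q = K' p q" "p \<in> {..<k} \<rightarrow>\<^sub>E S"
  shows "fredholm_minor K k p = fredholm_minor K' k p"
  unfolding fredholm_minor_eq_dset using assms by (intro dset_cong) auto

lemma fredholm_cong:
  assumes "\<And>p q. p \<in> S \<Longrightarrow> q \<in> S \<Longrightarrow> K p q = K' p q"
  shows "fredholm_det S K = fredholm_det S K'" "fredholm_converges S K \<longleftrightarrow> fredholm_converges S K'"
proof -
  note minor = fredholm_minor_cong[of S K K', OF assms]
  have "fredholm_coeff S K = fredholm_coeff S K'"
    unfolding fredholm_coeff_def by (intro ext arg_cong2[where f = "(*)"] refl infsum_cong minor)
  moreover have "(\<lambda>p. norm (fredholm_minor K k p)) summable_on ({..<k} \<rightarrow>\<^sub>E S)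
      \<longleftrightarrow> (\<lambda>p. norm (fredholm_minor K' k p)) summable_on ({..<k} \<rightarrow>\<^sub>E S)" for k
    by (intro summable_on_cong arg_cong[where f = norm] minor)
  ultimately show "fredholm_det S K = fredholm_det S K'" "fredholm_converges S K \<longleftrightarrow> fredholm_converges S K'"
    unfolding fredholm_det_def fredholm_converges_def by simp_all
qed

lemma fredholm_empty:
  "fredholm_converges {} K" "fredholm_det {} K = 1"
proof -
  interpret kernel_domination "{}" "\<lambda>_. 1" "\<lambda>_. 0" by standard auto
  show "fredholm_converges {} K" by (rule fredholm_converges_dominated) (simp add: dominated_def)
  show "fredholm_det {} K = 1"
    by (subst fredholm_det_finite_support[of "{}"]) (auto simp: dset_def)
qed

text \<open>Reduces discrete and continuous time to one setting: g is an integer power of \<phi> or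
  exp (t L), analytic on the annulus with value 1 at 1. The inverse is kept as
  \<open>pw (- t)\<close>, since \<open>Sbar\<close> may evaluate it off the annulus. The time 0 is
  needed to condition on the initial state.\<close>

lemma power_family_cases:
  assumes adm: "admissible U \<rho> \<rho>' \<phi>" and pf: "power_family T U (annulus \<rho> \<rho>') \<phi> pw" and "t \<in> T"
  obtains g where "gen_fun \<rho> \<rho>' g" "\<And>w. w \<in> annulus \<rho> \<rho>' \<Longrightarrow> pw t w = g w"
    "\<And>w. w \<in> annulus \<rho> \<rho>' \<Longrightarrow> g w * pw (- t) w = 1" "0 \<in> T"
proof -
  have radii: "0 < \<rho>" "\<rho> < 1" "1 < \<rho>'" and phi: "\<phi> analytic_on annulus \<rho> \<rho>'"
    "\<And>w. w \<in> annulus \<rho> \<rho>' \<Longrightarrow> \<phi> w \<noteq> 0" "\<phi> 1 = 1" "annulus \<rho> \<rho>' \<subseteq> U"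
    using adm by (auto simp: admissible_def)
  have one: "1 \<in> annulus \<rho> \<rho>'" using radii by (auto simp: annulus_def)
  from pf consider (int) "T = \<int>" "\<And>k w. w \<in> U \<Longrightarrow> pw (of_int k) w = \<phi> w powi k"
    | (real) L where "T = UNIV" "L analytic_on annulus \<rho> \<rho>'" "L 1 = 0"
        "\<And>t w. w \<in> annulus \<rho> \<rho>' \<Longrightarrow> pw t w = exp (of_real t * L w)"
    unfolding power_family_def by blast
  then show thesis
  proof cases
    case int
    obtain k where k: "t = of_int k" using assms(3) int(1) by (auto elim: Ints_cases)
    show thesis
    proof (rule that[of "\<lambda>w. \<phi> w powi k"])
      show "gen_fun \<rho> \<rho>' (\<lambda>w. \<phi> w powi k)"
        using radii phi by unfold_locales (auto intro!: analytic_intros)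
      show "pw t w = \<phi> w powi k" if "w \<in> annulus \<rho> \<rho>'" for w
        using int(2)[of w k] phi(4) that k by auto
      show "\<phi> w powi k * pw (- t) w = 1" if "w \<in> annulus \<rho> \<rho>'" for w
        using int(2)[of w "- k"] phi(2)[OF that] phi(4) that k by (auto simp: power_int_minus)
    qed (use int in auto)
  next
    case real
    show thesis
    proof (rule that[of "\<lambda>w. exp (of_real t * L w)"])
      show "gen_fun \<rho> \<rho>' (\<lambda>w. exp (of_real t * L w))"
        using radii real(2,3) by unfold_locales (auto intro!: analytic_intros)
      show "exp (of_real t * L w) * pw (- t) w = 1" if "w \<in> annulus \<rho> \<rho>'" for w
        using real(4)[OF that, of "- t"] by (simp add: exp_add[symmetric])
    qed (use real in auto)
  qed
qed

context gen_fun
begin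

lemma transition_det_eq_trans_dset:
  assumes "\<And>w. w \<in> annulus \<rho> \<rho>' \<Longrightarrow> pw t w = g w"
  shows "transition_det N pw \<rho>' t y x = trans_dset N y x"
proof -
  have F: "F_fun pw \<rho>' n x t = Fr n x" for n x
    unfolding F_fun_def Fr_def coef_def
  proof (rule circ_integral_cong)
    fix w :: complex assume w: "norm w = \<rho>'"
    have "w powi (- (x - n) - 1) = inverse (w powi (x - n + 1))"
      by (subst power_int_minus[symmetric]) (simp add: algebra_simps)
    moreover have "pw t w = g w" using assms w radii by (auto simp: annulus_def)
    ultimately show "(w - 1) powi - n / w powi (x - n + 1) * pw t w = (w - 1) powi - n * g w * w powi (- (x - n) - 1)"
      by (simp add: divide_inverse)
  qed (use radii in simp)
  \<comment> \<open>Matrix index a stands for particle N - a; the reversal turns F_(i - j) into the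
    index j - i of \<open>trans_dset\<close>.\<close>
  have img: "(\<lambda>a. N - a) ` {..<N} = {1..N}"
  proof (intro equalityI subsetI)
    fix i assume "i \<in> {1..N}"
    then have "i = N - (N - i)" "N - i \<in> {..<N}" by auto
    then show "i \<in> (\<lambda>a. N - a) ` {..<N}" by blast
  qed auto
  have "trans_dset N y x = dset (\<lambda>i j. Fr (int j - int i) (x i - y j)) ((\<lambda>a. N - a) ` {..<N})"
    by (simp only: trans_dset_def img)
  also have "\<dots> = dset (\<lambda>a b. Fr (int (N - b) - int (N - a)) (x (N - a) - y (N - b))) {..<N}"
    by (rule dset_reindex) (auto simp: inj_on_def)
  also have "\<dots> = dset (\<lambda>a b. Fr (int a - int b) (x (N - a) - y (N - b))) {..<N}"
    by (intro dset_cong) (auto simp: of_nat_diff)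
  also have "\<dots> = transition_det N pw \<rho>' t y x"
    unfolding transition_det_def F by (rule det_mat_eq_dset[symmetric])
  finally show ?thesis ..
qed

lemma obtain_fps:
  assumes "(\<lambda>w. gi (1 - w)) analytic_on cball 0 \<delta>" "0 < \<delta>"
    and "\<And>w. w \<in> annulus \<rho> \<rho>' \<Longrightarrow> g w * gi w = 1"
  obtains Gf Gi where "(\<lambda>w. g (1 - w)) has_fps_expansion Gf" "(\<lambda>w. gi (1 - w)) has_fps_expansion Gi" "Gf * Gi = 1"
proof -
  have "(\<lambda>w. g (1 - w)) analytic_on {0}"
  proof -
    have "g analytic_on {1}" by (rule analytic_on_subset[OF g_analytic]) (use radii in \<open>auto simp: annulus_def\<close>)
    then show ?thesis
      by (intro analytic_on_compose_gen[of "\<lambda>w. 1 - w" "{0}" g "{1}", unfolded o_def] analytic_intros) auto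
  qed
  then obtain Gf where Gf: "(\<lambda>w. g (1 - w)) has_fps_expansion Gf"
    using analytic_at_imp_has_fps_expansion_0 by blast
  have "(\<lambda>w. gi (1 - w)) analytic_on {0}" by (rule analytic_on_subset[OF assms(1)]) (use assms(2) in auto)
  then obtain Gi where Gi: "(\<lambda>w. gi (1 - w)) has_fps_expansion Gi"
    using analytic_at_imp_has_fps_expansion_0 by blast
  have ev: "\<forall>\<^sub>F w in nhds 0. g (1 - w) * gi (1 - w) = 1"
  proof -
    \<comment> \<open>The disc of this radius around 1 lies in the annulus, where the two functions
      are inverse to each other.\<close>
    define e where "e = min (1 - \<rho>) (\<rho>' - 1)"
    have "0 < e" using radii by (simp add: e_def)
    then have "\<forall>\<^sub>F w in nhds (0::complex). w \<in> ball 0 e" by (intro eventually_nhds_in_open) auto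
    then show ?thesis
    proof eventually_elim
      case (elim w)
      have "norm (1 - w) \<le> 1 + norm w" "1 - norm w \<le> norm (1 - w)"
        using norm_triangle_ineq4[of 1 w] norm_triangle_ineq2[of 1 w] by auto
      then have "1 - w \<in> annulus \<rho> \<rho>'" using elim by (auto simp: annulus_def e_def)
      then show ?case by (rule assms(3))
    qed
  qed
  have "(\<lambda>w. g (1 - w) * gi (1 - w)) has_fps_expansion Gf * Gi" by (intro has_fps_expansion_mult Gf Gi)
  then have "(\<lambda>w. 1) has_fps_expansion Gf * Gi"
    using has_fps_expansion_cong[OF ev refl] by blast
  moreover have "(\<lambda>w::complex. 1) has_fps_expansion (1 :: complex fps)" by simp
  ultimately have "Gf * Gi = 1"
    by (intro fps_ext) (metis fps_nth_fps_expansion)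
  then show thesis using that Gf Gi by blast
qed

end

section \<open>The conditional law of the chain\<close>

lemma countable_Omega: "countable (\<Omega> N)"
proof -
  have "\<Omega> N \<subseteq> {1..N} \<rightarrow>\<^sub>E UNIV" by (auto simp: \<Omega>_def)
  moreover have "countable ({1..N} \<rightarrow>\<^sub>E (UNIV :: int set))" by (intro countable_PiE) auto
  ultimately show ?thesis by (rule countable_subset)
qed

text \<open>The Markov property is used with present time 0 and no past. It speaks of single states;
  countable additivity over the state space extends it to B.\<close>

lemma markov_chain_law:
  assumes mc: "markov_chain M T S p X" and S: "countable S" and T: "0 \<in> T" "t \<in> T" "0 \<le> t"
    and y: "y \<in> S" and pos: "\<P>(\<omega> in M. X 0 \<omega> = y) > 0"
    and D: "set_pmf D \<subseteq> S" "\<And>x. x \<in> S \<Longrightarrow> of_real (pmf D x) = p t y x"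
  shows "\<P>(\<omega> in M. X t \<omega> \<in> B \<bar> X 0 \<omega> = y) = measure_pmf.prob D B"
proof -
  interpret prob_space M using mc by (simp add: markov_chain_def)
  have meas: "X s \<in> M \<rightarrow>\<^sub>M count_space S" if "s \<in> T" "0 \<le> s" for s
    using mc that by (auto simp: markov_chain_def)
  have cond: "of_real \<P>(\<omega> in M. X t \<omega> = x \<bar> X 0 \<omega> = y) = p t y x" if "x \<in> S" for x
  proof -
    have "\<forall>s\<in>T \<inter> {0..}. \<forall>u\<in>T \<inter> {s..}. \<forall>F h. \<forall>x\<in>S.
        finite F \<and> F \<subseteq> T \<inter> {0..s} \<and> \<P>(\<omega> in M. X s \<omega> = h s \<and> (\<forall>r\<in>F. X r \<omega> = h r)) > 0 \<longrightarrow>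
        of_real \<P>(\<omega> in M. X u \<omega> = x \<bar> X s \<omega> = h s \<and> (\<forall>r\<in>F. X r \<omega> = h r)) = p (u - s) (h s) x"
      using mc unfolding markov_chain_def by blast
    from this[THEN bspec[of _ _ 0], THEN bspec[of _ _ t], THEN spec[of _ "{}"], THEN spec[of _ "\<lambda>_. y"], THEN bspec[OF _ that]]
    show ?thesis using T pos by simp
  qed
  have sets: "{\<omega> \<in> space M. X s \<omega> = x} \<in> events" if "s \<in> T" "0 \<le> s" "x \<in> S" for s x
  proof -
    have "X s -` {x} \<inter> space M \<in> events" using meas[OF that(1,2)] that(3) by (intro measurable_sets) auto
    moreover have "X s -` {x} \<inter> space M = {\<omega> \<in> space M. X s \<omega> = x}" by auto
    ultimately show ?thesis by simp
  qed
  define c where "c = \<P>(\<omega> in M. X 0 \<omega> = y)"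
  define A where "A x = {\<omega> \<in> space M. X t \<omega> = x \<and> X 0 \<omega> = y}" for x
  have A: "A x \<in> events" if "x \<in> S" for x
  proof -
    have "A x = {\<omega> \<in> space M. X t \<omega> = x} \<inter> {\<omega> \<in> space M. X 0 \<omega> = y}" by (auto simp: A_def)
    then show ?thesis using sets[OF T(2,3) that] sets[OF T(1) _ y] by auto
  qed
  have pA: "prob (A x) = c * pmf D x" if "x \<in> S" for x
  proof -
    have "complex_of_real (prob (A x) / c) = of_real (pmf D x)"
      using cond[OF that] D(2)[OF that] by (simp add: cond_prob_def A_def c_def)
    then have "prob (A x) / c = pmf D x" by (simp only: of_real_eq_iff)
    then show ?thesis using pos by (simp add: c_def field_simps)
  qed
  have XS: "X t \<omega> \<in> S" if "\<omega> \<in> space M" for \<omega>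
    using measurable_space[OF meas[OF T(2,3)] that] by simp
  have un: "{\<omega> \<in> space M. X t \<omega> \<in> B \<and> X 0 \<omega> = y} = (\<Union>x\<in>B \<inter> S. A x)"
    using XS by (auto simp: A_def)
  have "emeasure M {\<omega> \<in> space M. X t \<omega> \<in> B \<and> X 0 \<omega> = y} = (\<integral>\<^sup>+x. emeasure M (A x) \<partial>count_space (B \<inter> S))"
    unfolding un
  proof (rule emeasure_UN_countable)
    show "countable (B \<inter> S)" using S by (rule countable_subset[rotated]) auto
    show "disjoint_family_on A (B \<inter> S)" by (auto simp: disjoint_family_on_def A_def)
  qed (use A in auto)
  also have "\<dots> = (\<integral>\<^sup>+x. ennreal c * ennreal (pmf D x) \<partial>count_space (B \<inter> S))"
    using pA pos by (intro nn_integral_cong) (auto simp: emeasure_eq_measure ennreal_mult c_def)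
  also have "\<dots> = ennreal c * emeasure (measure_pmf D) (B \<inter> S)"
    by (simp add: nn_integral_cmult nn_integral_pmf)
  also have "\<dots> = ennreal (c * measure_pmf.prob D (B \<inter> S))"
    using pos by (simp add: measure_pmf.emeasure_eq_measure ennreal_mult c_def)
  also have "measure_pmf.prob D (B \<inter> S) = measure_pmf.prob D B"
    using D(1) by (intro measure_pmf_cong_set) auto
  finally have "prob {\<omega> \<in> space M. X t \<omega> \<in> B \<and> X 0 \<omega> = y} = c * measure_pmf.prob D B"
    using pos by (simp add: emeasure_eq_measure c_def)
  then show ?thesis using pos by (simp add: cond_prob_def c_def)
qed

theorem theorem1p2:
  fixes N m :: nat
    and T :: "real set"
    and U :: "complex set"
    and \<rho> \<rho>' r \<theta> \<delta> t :: real
    and \<phi> :: "complex \<Rightarrow> complex"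
    and pw :: "real \<Rightarrow> complex \<Rightarrow> complex"
    and M :: "'w measure"
    and X :: "real \<Rightarrow> 'w \<Rightarrow> nat \<Rightarrow> int"
    and y :: "nat \<Rightarrow> int"
    and n :: "nat \<Rightarrow> nat"
    and a :: "nat \<Rightarrow> real"
  assumes "admissible U \<rho> \<rho>' \<phi>"
    and "power_family T U (annulus \<rho> \<rho>') \<phi> pw"
    and "stochastic_transitions T (\<Omega> N) (transition_det N pw \<rho>')"
    and "markov_chain M T (\<Omega> N) (transition_det N pw \<rho>') X"
    and "r \<in> {\<rho><..<1}" and "\<theta> \<in> {\<rho><..<1}"
    and "t \<in> T" and "0 \<le> t"
    and "\<delta> \<in> {0<..<1}" and "(\<lambda>w. pw (- t) (1 - w)) analytic_on cball 0 \<delta>"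
    and "strict_mono_on {1..m} n" and "n ` {1..m} \<subseteq> {1..N}"
    and "y \<in> \<Omega> N" and "\<P>(\<omega> in M. X 0 \<omega> = y) > 0"
  shows "(\<forall>i\<in>{1..m}. \<forall>j\<in>{1..m}. kernel_comp_converges
             (kernel_adj (S_ker pw \<theta> r t (n i))) (Sbar_epi N y pw \<theta> \<delta> t (n j))) \<and>
         fredholm_converges (n ` {1..m} \<times> UNIV)
           (sandwich (chi_bar m n a) (K_ext N y pw \<theta> r \<delta> t)) \<and>
         of_real \<P>(\<omega> in M. (\<forall>i\<in>{1..m}. real_of_int (X t \<omega> (n i)) > a i) \<bar> X 0 \<omega> = y)
           = fredholm_det (n ` {1..m} \<times> UNIV)
               (sandwich (chi_bar m n a) (K_ext N y pw \<theta> r \<delta> t))"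
proof (cases "m = 0")
  case True
  \<comment> \<open>No constraint is imposed: the conditional probability is 1 because the condition
    has positive probability, and the determinant over the empty space is 1 as well.\<close>
  then show ?thesis using assms(14) by (simp add: fredholm_empty cond_prob_def)
next
  case False
  obtain g where g: "gen_fun \<rho> \<rho>' g" "\<And>w. w \<in> annulus \<rho> \<rho>' \<Longrightarrow> pw t w = g w"
    "\<And>w. w \<in> annulus \<rho> \<rho>' \<Longrightarrow> g w * pw (- t) w = 1" "0 \<in> T"
    using power_family_cases[OF assms(1,2,7)] by blast
  interpret gen_fun \<rho> \<rho>' g by (rule g(1))
  obtain Gf Gi where G: "(\<lambda>w. g (1 - w)) has_fps_expansion Gf"
    "(\<lambda>w. pw (- t) (1 - w)) has_fps_expansion Gi" "Gf * Gi = 1"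
    using obtain_fps[OF assms(10) _ g(3)] assms(9) by auto
  interpret kernel_setting \<rho> \<rho>' g pw t \<theta> r \<delta> Gf Gi N y
    by unfold_locales (use assms g G in auto)
  define L where "L = n m"
  define I where "I = n ` {1..m}"
  have inj: "inj_on n {1..m}" using assms(11) strict_mono_on_imp_inj_on by blast
  have le: "n i \<le> L" if "i \<in> {1..m}" for i
    using strict_mono_onD[OF assms(11), of i m] that False
    by (cases "i = m") (auto simp: L_def less_imp_le)
  have m: "m \<in> {1..m}" using False by simp
  then have "L \<in> {1..N}" using assms(12) unfolding L_def by blast
  then have I: "I \<subseteq> {1..L}" "L \<in> I" "L \<le> N"
    using assms(12) le m by (auto simp: I_def L_def)
  \<comment> \<open>For an integer x, x > a is the same as x > \<lfloor>a\<rfloor>, so thresholds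
    can be taken in the integers. Levels outside I get the threshold of level L = n_m.\<close>
  define a' where "a' k = (if k \<in> I then \<lfloor>a (the_inv_into {1..m} n k)\<rfloor> else \<lfloor>a m\<rfloor>)" for k
  have a'_n: "a' (n i) = \<lfloor>a i\<rfloor>" if "i \<in> {1..m}" for i
    using that inj by (simp add: a'_def I_def the_inv_into_f_f)
  have a'_L: "a' L = \<lfloor>a m\<rfloor>" using a'_n[of m] False by (simp add: L_def)
  obtain Li where Li: "inverse_on {1..L} Li Lmat"
    using dset_inverse[of "{1..L}" Lmat] dset_Lmat[of L] unfolding inverse_on_def
    by (metis finite_atLeastAtMost zero_neq_one)
  interpret threshold_setting \<rho> \<rho>' g pw t \<theta> r \<delta> Gf Gi N y L I a' Li
    by unfold_locales (use I a'_L Li in \<open>auto simp: a'_def\<close>)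
  have K: "sandwich (chi_bar m n a) (K_ext N y pw \<theta> r \<delta> t) p q = K_limit p q"
    if pq: "p \<in> I \<times> UNIV" "q \<in> I \<times> UNIV" for p q
  proof -
    obtain ni x1 nj x2 where p: "p = (ni, x1)" "q = (nj, x2)" by (cases p; cases q) auto
    have "ni \<in> {1..L}" "nj \<in> {1..L}" using pq I(1) p by auto
    moreover have "chi_bar m n a p = chi p" for p
      unfolding chi_def chi_bar_def by (auto simp: I_def a'_n le_floor_iff split: prod.splits)
    ultimately show ?thesis
      using K_ext_eq[OF Li I(3)] by (simp add: sandwich_def K_limit_def p)
  qed
  obtain D where D: "set_pmf D \<subseteq> \<Omega> N"
    "\<And>x. x \<in> \<Omega> N \<Longrightarrow> of_real (pmf D x) = transition_det N pw \<rho>' t y x"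
    using assms(3,7,8,13) unfolding stochastic_transitions_def by blast
  have D': "of_real (pmf D x) = trans_dset N y x" if "x \<in> \<Omega> N" for x
    using D(2)[OF that] transition_det_eq_trans_dset[of pw t, OF g(2)] by simp
  have L1: "1 \<le> L" using I by auto
  \<comment> \<open>The law of the first L particles, whose determinant has size L, the size reached
    on the kernel side.\<close>
  define DL where "DL = map_pmf (\<lambda>x. restrict x {1..L}) D"
  have DL: "set_pmf DL \<subseteq> \<Omega> L" "\<And>x. x \<in> \<Omega> L \<Longrightarrow> of_real (pmf DL x) = trans_dset L y x"
    using trans_marginal_le[OF D(1) D' L1 I(3)] by (auto simp: DL_def)
  let ?B = "{x. \<forall>i\<in>{1..m}. a i < real_of_int (x (n i))}"
  have "\<P>(\<omega> in M. X t \<omega> \<in> ?B \<bar> X 0 \<omega> = y) = measure_pmf.prob D ?B"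
    by (rule markov_chain_law[OF assms(4) countable_Omega g(4) assms(7,8,13,14) D])
  also have "\<dots> = measure_pmf.prob D ((\<lambda>x. restrict x {1..L}) -` {x. \<forall>k\<in>{1..L}. a' k < x k})"
  proof (rule measure_pmf_cong_set)
    fix x assume "x \<in> set_pmf D"
    then have x: "x \<in> \<Omega> N" using D(1) by auto
    \<comment> \<open>The constraints added at unselected k hold automatically: x k > x L > a' L =
      a' k.\<close>
    have "(\<forall>k\<in>{1..L}. a' k < x k) \<longleftrightarrow> (\<forall>k\<in>I. a' k < x k)"
    proof
      assume *: "\<forall>k\<in>I. a' k < x k"
      show "\<forall>k\<in>{1..L}. a' k < x k"
      proof
        fix k assume k: "k \<in> {1..L}"
        show "a' k < x k"
        proof (cases "k \<in> I")
          case False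
          then have "k < L" using k I(2) by (cases "k = L") auto
          then have "x L < x k" using x k I by (auto simp: Omega_iff)
          then show ?thesis using * I(2) a_const[OF False] by force
        qed (use * in auto)
      qed
    qed (use I in auto)
    also have "\<dots> \<longleftrightarrow> x \<in> ?B" by (auto simp: I_def a'_n floor_less_iff)
    finally show "x \<in> ?B \<longleftrightarrow> x \<in> (\<lambda>x. restrict x {1..L}) -` {x. \<forall>k\<in>{1..L}. a' k < x k}" by auto
  qed
  also have "\<dots> = measure_pmf.prob DL {x. \<forall>k\<in>{1..L}. a' k < x k}"
    unfolding DL_def by (rule measure_map_pmf[symmetric])
  finally have "complex_of_real \<P>(\<omega> in M. X t \<omega> \<in> ?B \<bar> X 0 \<omega> = y)
      = dset (\<lambda>k j. Fr (int j - int k + 1) (suffix_max L a' k + 1 - y j)) {1..L}"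
    using prob_eq_dset[OF DL L1] by simp
  also have "\<dots> = fredholm_det (I \<times> UNIV) K_limit"
    using fredholm_det_eq_limit_mat dset_limit_mat by simp
  also have "\<dots> = fredholm_det (I \<times> UNIV) (sandwich (chi_bar m n a) (K_ext N y pw \<theta> r \<delta> t))"
    by (rule fredholm_cong(1)[symmetric]) (rule K)
  finally have prob: "complex_of_real \<P>(\<omega> in M. X t \<omega> \<in> ?B \<bar> X 0 \<omega> = y)
      = fredholm_det (I \<times> UNIV) (sandwich (chi_bar m n a) (K_ext N y pw \<theta> r \<delta> t))" .
  have conv: "fredholm_converges (I \<times> UNIV) (sandwich (chi_bar m n a) (K_ext N y pw \<theta> r \<delta> t))"
    using fredholm_cong(2)[of "I \<times> UNIV" "sandwich (chi_bar m n a) (K_ext N y pw \<theta> r \<delta> t)" K_limit] K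
      K_limit_fredholm(1) by blast
  have comp: "kernel_comp_converges (kernel_adj (S_ker pw \<theta> r t (n i))) (Sbar_epi N y pw \<theta> \<delta> t (n j))"
    if "i \<in> {1..m}" "j \<in> {1..m}" for i j
    by (rule kernel_comp_converges_S_Sbar[OF Li I(3)]) (use that I(1) in \<open>auto simp: I_def image_subset_iff\<close>)
  show ?thesis using prob conv comp by (simp add: I_def)
qed

end
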